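(* Let $d>4$ and $r>4$, and let $P,Q$ be Borel probability measures on $\mathbb{R}^d$ with $\int\|x\|_2^r\,dP(x)\le M_r^r<\infty$ and $\int\|x\|_2^r\,dQ(x)\le M_r^r<\infty$. Suppose $P$ is non-atomic. Let $\alpha,\beta>0$ and assume there exists a function $\varphi_0:\mathbb{R}^d\to\mathbb{R}$ that is strictly convex and continuously differentiable, whose restriction to $\mathrm{supp}(P)$ solves the semi-dual problem for $(P,Q)$, and which satisfies $$\tfrac\alpha2\|y-x\|_2^2\le\varphi_0(y)-\varphi_0(x)-\langle\nabla\varphi_0(x),y-x\rangle\le\tfrac\beta2\|y-x\|_2^2\quad\text{for all }x,y\in\mathbb{R}^d.$$ Let $T_0=\nabla\varphi_0$. Then there exists a constant $C>0$ depending on $M_r,\alpha,\beta,d,r$ such that, for all $n\ge2$ and $m\ge1$, the one-nearest-neighbor estimator $\widehat T^{\mathrm{1NN}}_{nm}$ satisfies $$R(\widehat T^{\mathrm{1NN}}_{nm},T_0)\le C\big(n^{-2/d}+m^{-2/d}\big)\log n.$$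
   Context: $X_1,\dots,X_n\sim P$ and $Y_1,\dots,Y_m\sim Q$ are i.i.d. samples. The risk is $R(\widehat T,T_0)=\mathbb{E}\big[\int\|\widehat T(x)-T_0(x)\|_2^2\,dP(x)\big]$, expectation over the samples. For a convex function $\varphi$ on $\mathbb{R}^d$, $\varphi^*(y)=\sup_{x}[\langle x,y\rangle-\varphi(x)]$; a function solves the semi-dual problem for $(P,Q)$ if it minimizes $\int\varphi\,dP+\int\varphi^*\,dQ$ over $\varphi\in L^1(P)$. The estimator: let $\widehat\pi\in\mathbb{R}^{n\times m}$ be a minimizer of $\sum_{i=1}^n\sum_{j=1}^m\pi_{ij}\|X_i-Y_j\|_2^2$ over matrices $\pi\in\mathbb{R}^{n\times m}$ with nonnegative entries, each of whose $n$ rows sums to $1/n$ and each of whose $m$ columns sums to $1/m$ (an optimal coupling of the empirical measures). Let $V_j=\{x\in\mathbb{R}^d:\|x-X_j\|_2\le\|x-X_i\|_2\ \forall i\ne j\}$, $j=1,\dots,n$, be the Voronoi cells, and $$\widehat T^{\mathrm{1NN}}_{nm}(x)=\sum_{i=1}^n\sum_{j=1}^m(n\widehat\pi_{ij})\,I(x\in V_i)\,Y_j,$$ where, if $x$ lies in several cells, only one of them is used (ties broken, e.g., by smallest index), so that the cells act as a partition of $\mathbb{R}^d$. *)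

theory Defs
  imports "HOL-Probability.Probability"
begin

definition borel_prob :: "'a::euclidean_space measure \<Rightarrow> bool" where
  "borel_prob P \<longleftrightarrow> prob_space P \<and> sets P = sets borel"

definition nonatomic :: "'a measure \<Rightarrow> bool" where
  "nonatomic M \<longleftrightarrow>
     \<not> (\<exists>A\<in>sets M. emeasure M A > 0 \<and>
          (\<forall>B\<in>sets M. B \<subseteq> A \<longrightarrow> emeasure M B = 0 \<or> emeasure M (A - B) = 0))"

definition strictly_convex :: "('a::real_vector \<Rightarrow> real) \<Rightarrow> bool" where
  "strictly_convex f \<longleftrightarrow>
     (\<forall>x y. \<forall>t\<in>{0<..<1}. x \<noteq> y \<longrightarrow>
        f ((1 - t) *\<^sub>R x + t *\<^sub>R y) < (1 - t) * f x + t * f y)"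

definition conjugate :: "('a::real_inner \<Rightarrow> real) \<Rightarrow> 'a \<Rightarrow> ereal" where
  "conjugate \<phi> y = (SUP x. ereal (x \<bullet> y - \<phi> x))"

definition ereal_integral :: "'a measure \<Rightarrow> ('a \<Rightarrow> ereal) \<Rightarrow> ereal" where
  "ereal_integral M f =
     enn2ereal (\<integral>\<^sup>+ x. e2ennreal (f x) \<partial>M) - enn2ereal (\<integral>\<^sup>+ x. e2ennreal (- f x) \<partial>M)"

(* When Q has a finite first moment, the negative part of the conjugate is Q-integrable, because
   the conjugate dominates an affine function, so the second term is well defined in (-\<infinity>, \<infinity>]. *)
definition semi_dual_objective ::
    "'a::euclidean_space measure \<Rightarrow> 'a measure \<Rightarrow> ('a \<Rightarrow> real) \<Rightarrow> ereal" where
  "semi_dual_objective P Q \<phi> = ereal (\<integral>x. \<phi> x \<partial>P) + ereal_integral Q (conjugate \<phi>)"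

(* As an element of L^1(P), \<phi> matters only through its restriction to the support of P; the
   conjugate is the one of the function \<phi> on the whole space.  Taking the supremum over the
   support only would be a different condition: if P lives on a hyperplane, it would leave
   the component of Q normal to that hyperplane unconstrained. *)
definition solves_semi_dual ::
    "'a::euclidean_space measure \<Rightarrow> 'a measure \<Rightarrow> ('a \<Rightarrow> real) \<Rightarrow> bool" where
  "solves_semi_dual P Q \<phi> \<longleftrightarrow>
     integrable P \<phi> \<and>
     (\<forall>\<psi>. integrable P \<psi> \<longrightarrow> semi_dual_objective P Q \<phi> \<le> semi_dual_objective P Q \<psi>)"

abbreviation sample_space :: "nat \<Rightarrow> (nat \<Rightarrow> 'a::euclidean_space) measure" where
  "sample_space n \<equiv> (\<Pi>\<^sub>M i\<in>{..<n}. borel)"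

(* J is a possible joint law of (X_0, ..., X_{n-1}) and (Y_0, ..., Y_{m-1}): each of the two
   samples is i.i.d.  The dependence between the two samples is arbitrary; mutually
   independent samples are the case where J is the product of the two marginals. *)
definition iid_samples_law ::
    "'a::euclidean_space measure \<Rightarrow> 'a measure \<Rightarrow> nat \<Rightarrow> nat \<Rightarrow>
     ((nat \<Rightarrow> 'a) \<times> (nat \<Rightarrow> 'a)) measure \<Rightarrow> bool" where
  "iid_samples_law P Q n m J \<longleftrightarrow>
     sets J = sets (sample_space n \<Otimes>\<^sub>M sample_space m) \<and>
     distr J (sample_space n) fst = (\<Pi>\<^sub>M i\<in>{..<n}. P) \<and>
     distr J (sample_space m) snd = (\<Pi>\<^sub>M j\<in>{..<m}. Q)"

definition coupling_matrix :: "nat \<Rightarrow> nat \<Rightarrow> (nat \<Rightarrow> nat \<Rightarrow> real) \<Rightarrow> bool" where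
  "coupling_matrix n m p \<longleftrightarrow>
     (\<forall>i<n. \<forall>j<m. 0 \<le> p i j) \<and>
     (\<forall>i<n. (\<Sum>j<m. p i j) = 1 / real n) \<and>
     (\<forall>j<m. (\<Sum>i<n. p i j) = 1 / real m)"

definition transport_cost ::
    "nat \<Rightarrow> nat \<Rightarrow> (nat \<Rightarrow> 'a::euclidean_space) \<Rightarrow> (nat \<Rightarrow> 'a) \<Rightarrow> (nat \<Rightarrow> nat \<Rightarrow> real) \<Rightarrow> real" where
  "transport_cost n m X Y p = (\<Sum>i<n. \<Sum>j<m. p i j * (norm (X i - Y j))\<^sup>2)"

definition optimal_coupling ::
    "nat \<Rightarrow> nat \<Rightarrow> (nat \<Rightarrow> 'a::euclidean_space) \<Rightarrow> (nat \<Rightarrow> 'a) \<Rightarrow> (nat \<Rightarrow> nat \<Rightarrow> real) \<Rightarrow> bool" where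
  "optimal_coupling n m X Y p \<longleftrightarrow>
     coupling_matrix n m p \<and>
     (\<forall>p'. coupling_matrix n m p' \<longrightarrow> transport_cost n m X Y p \<le> transport_cost n m X Y p')"

(* An optimal coupling selected from the data; measurability is what makes the risk of the
   resulting estimator an expectation. *)
definition optimal_coupling_estimator ::
    "nat \<Rightarrow> nat \<Rightarrow>
     ((nat \<Rightarrow> 'a::euclidean_space) \<Rightarrow> (nat \<Rightarrow> 'a) \<Rightarrow> nat \<Rightarrow> nat \<Rightarrow> real) \<Rightarrow> bool" where
  "optimal_coupling_estimator n m \<pi> \<longleftrightarrow>
     (\<forall>X\<in>space (sample_space n). \<forall>Y\<in>space (sample_space m). optimal_coupling n m X Y (\<pi> X Y)) \<and>
     (\<forall>i<n. \<forall>j<m. (\<lambda>(X, Y). \<pi> X Y i j) \<in> borel_measurable (sample_space n \<Otimes>\<^sub>M sample_space m))"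

definition voronoi :: "nat \<Rightarrow> (nat \<Rightarrow> 'a::euclidean_space) \<Rightarrow> nat \<Rightarrow> 'a set" where
  "voronoi n X j = {x. \<forall>i<n. i \<noteq> j \<longrightarrow> norm (x - X j) \<le> norm (x - X i)}"

(* k X x is the index of the one Voronoi cell that is used for the point x. *)
definition tie_breaking :: "nat \<Rightarrow> ((nat \<Rightarrow> 'a::euclidean_space) \<Rightarrow> 'a \<Rightarrow> nat) \<Rightarrow> bool" where
  "tie_breaking n k \<longleftrightarrow>
     (\<forall>X\<in>space (sample_space n). \<forall>x. k X x < n \<and> x \<in> voronoi n X (k X x)) \<and>
     (\<lambda>(X, x). k X x) \<in> measurable (sample_space n \<Otimes>\<^sub>M borel) (count_space UNIV)"

definition T_1NN ::
    "nat \<Rightarrow> nat \<Rightarrow>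
     ((nat \<Rightarrow> 'a::euclidean_space) \<Rightarrow> (nat \<Rightarrow> 'a) \<Rightarrow> nat \<Rightarrow> nat \<Rightarrow> real) \<Rightarrow>
     ((nat \<Rightarrow> 'a) \<Rightarrow> 'a \<Rightarrow> nat) \<Rightarrow>
     (nat \<Rightarrow> 'a) \<Rightarrow> (nat \<Rightarrow> 'a) \<Rightarrow> 'a \<Rightarrow> 'a" where
  "T_1NN n m \<pi> k X Y x =
     (\<Sum>i<n. \<Sum>j<m. (real n * \<pi> X Y i j * indicator {z. k X z = i} x) *\<^sub>R Y j)"

definition risk ::
    "((nat \<Rightarrow> 'a::euclidean_space) \<times> (nat \<Rightarrow> 'a)) measure \<Rightarrow> 'a measure \<Rightarrow>
     ((nat \<Rightarrow> 'a) \<Rightarrow> (nat \<Rightarrow> 'a) \<Rightarrow> 'a \<Rightarrow> 'a) \<Rightarrow> ('a \<Rightarrow> 'a) \<Rightarrow> ennreal" where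
  "risk J P T T0 =
     (\<integral>\<^sup>+ (X, Y). (\<integral>\<^sup>+ x. ennreal ((norm (T X Y x - T0 x))\<^sup>2) \<partial>P) \<partial>J)"

lemma tie_breaking_smallest_index:
  assumes "n > 0"
  shows "tie_breaking n (\<lambda>X x. LEAST i. i < n \<and> (x::'a::euclidean_space) \<in> voronoi n X i)"
proof -
  have ex: "\<exists>i<n. x \<in> voronoi n X i" for X and x :: 'a
  proof -
    have "finite ((\<lambda>i. norm (x - X i)) ` {..<n})" "(\<lambda>i. norm (x - X i)) ` {..<n} \<noteq> {}"
      using assms by auto
    then have "Min ((\<lambda>i. norm (x - X i)) ` {..<n}) \<in> (\<lambda>i. norm (x - X i)) ` {..<n}"
      by (rule Min_in)
    then obtain i where i: "i < n" "Min ((\<lambda>i. norm (x - X i)) ` {..<n}) = norm (x - X i)"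
      by auto
    have "norm (x - X i) \<le> norm (x - X j)" if "j < n" for j
      unfolding i(2)[symmetric] using that by (intro Min_le) auto
    with i(1) show ?thesis by (auto simp: voronoi_def)
  qed
  have "(\<lambda>(X, x). LEAST i. i < n \<and> x \<in> voronoi n X i) \<in>
      measurable (sample_space n \<Otimes>\<^sub>M (borel :: 'a measure)) (count_space UNIV)"
    unfolding case_prod_beta
  proof (rule measurable_Least)
    fix i
    show "Measurable.pred (sample_space n \<Otimes>\<^sub>M borel)
        (\<lambda>z::(nat \<Rightarrow> 'a) \<times> 'a. i < n \<and> snd z \<in> voronoi n (fst z) i)"
    proof (cases "i < n")
      case True
      have comp: "(\<lambda>z::(nat \<Rightarrow> 'a) \<times> 'a. fst z j) \<in> borel_measurable (sample_space n \<Otimes>\<^sub>M borel)"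
        if "j < n" for j
        using measurable_compose[OF measurable_fst measurable_component_singleton[of j "{..<n}"]] that
        by auto
      have dist: "(\<lambda>z::(nat \<Rightarrow> 'a) \<times> 'a. norm (snd z - fst z j)) \<in> borel_measurable (sample_space n \<Otimes>\<^sub>M borel)"
        if "j < n" for j
        by (rule measurable_compose[OF borel_measurable_diff[OF measurable_snd comp[OF that]]]) simp
      have "Measurable.pred (sample_space n \<Otimes>\<^sub>M borel)
          (\<lambda>z::(nat \<Rightarrow> 'a) \<times> 'a. norm (snd z - fst z i) \<le> norm (snd z - fst z j))" if "j < n" for j
        unfolding pred_def by (rule borel_measurable_le[OF dist[OF True] dist[OF that]])
      then have "Measurable.pred (sample_space n \<Otimes>\<^sub>M borel)
          (\<lambda>z::(nat \<Rightarrow> 'a) \<times> 'a. \<forall>j\<in>{..<n}. j \<noteq> i \<longrightarrow> norm (snd z - fst z i) \<le> norm (snd z - fst z j))"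
        by (intro pred_intros_finite(3) pred_intros_imp') auto
      moreover have "i < n \<and> snd z \<in> voronoi n (fst z) i \<longleftrightarrow>
          (\<forall>j\<in>{..<n}. j \<noteq> i \<longrightarrow> norm (snd z - fst z i) \<le> norm (snd z - fst z j))"
        for z :: "(nat \<Rightarrow> 'a) \<times> 'a"
        using True by (auto simp: voronoi_def)
      ultimately show ?thesis by (simp only:)
    qed (simp only: simp_thms measurable_const space_count_space UNIV_I)
  qed
  moreover have "(LEAST i. i < n \<and> x \<in> voronoi n X i) < n \<and>
      x \<in> voronoi n X (LEAST i. i < n \<and> x \<in> voronoi n X i)" for X and x :: 'a
    using LeastI_ex[OF ex[of x X]] by simp
  ultimately show ?thesis unfolding tie_breaking_def by blast
qed

end

theory Submission
  imports Defs
begin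

text \<open>
Let $\widehat T_i = \sum_j n \pi_{ij} Y_j$ be the barycentre that the optimal coupling assigns to
$X_i$; the estimator is constant with value $\widehat T_i$ on the cell $V_i$.  Inserting $T_0(X_i)$
and using that $T_0$ is $\beta$-Lipschitz bounds the loss by
$2 \sum_i P(V_i) |\widehat T_i - T_0(X_i)|^2 + 2 \beta^2 \int |x - X_{k(x)}|^2 dP$.

The unweighted sum $\frac1n \sum_i |\widehat T_i - T_0(X_i)|^2$ is at most
$\sum_{ij} \pi_{ij} |Y_j - T_0(X_i)|^2$ by Jensen.  The Fenchel gap
$\varphi_0(x) + \varphi_0^*(y) - \langle x, y\rangle$ lies between $|y - T_0(x)|^2 / (2\beta)$ and
$|y - T_0(x)|^2 / (2\alpha)$, and its integral against a coupling differs from half the transport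
cost by a quantity that depends on the marginals only.  Hence $\pi$, which minimizes the transport
cost, is within the factor $\beta/\alpha$ of every coupling for the cost $|Y_j - T_0(X_i)|^2$ as
well (\<open>coupling_stability\<close>).  Optimality of $\varphi_0$ in the semi-dual problem gives
$T_0{}_\# P = Q$ (\<open>pushforward\<close>), so $T_0(X_1), \dots, T_0(X_n)$ and $Y_1, \dots, Y_m$ are two
samples from the same law $Q$, and only the cost of matching two samples of one law remains.

That cost has expectation $O(n^{-2/d} + m^{-2/d})$ (\<open>expected_matching_cost\<close>): match the samples
greedily inside the cells of nested dyadic partitions, finest level first.  The mass that leaves a
cell is then at most the difference of the two empirical masses of the cell, whose expectation is
at most $\sqrt{Q(F)/n} + \sqrt{Q(F)/m}$.  The sum over the dyadic shells
$2^{k-1} < |x| \le 2^k$ converges because $r > 4$, and because $d > 4$ the finest level dominates the sum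
over the levels.

The true weights $P(V_i)$ replace $1/n$ at the price of the logarithm: outside an event of
probability $O(n^{-4})$ every cell has mass $O(\log n / n)$ (\<open>max_voronoi_mass\<close>), since a cell
seen from $X_i$ inside a narrow cone ends at the first sample point met in that cone.  On the
exceptional event a crude fourth moment bound is enough.

Finally, the nearest-neighbour distance is again a matching cost: every coupling of $X$ with an
independent copy $X'$ moves $X'_j$ at least as far as its nearest neighbour in $X$
(\<open>expected_nearest_neighbour_distance\<close>).
\<close>

section \<open>Greedy couplings along nested partitions\<close>

definition subcoupling :: "'i set \<Rightarrow> 'j set \<Rightarrow> ('i \<Rightarrow> real) \<Rightarrow> ('j \<Rightarrow> real) \<Rightarrow> ('i \<Rightarrow> 'j \<Rightarrow> real) \<Rightarrow> bool" where
  "subcoupling I J a b g \<longleftrightarrow>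
     (\<forall>i\<in>I. \<forall>j\<in>J. 0 \<le> g i j) \<and>
     (\<forall>i\<in>I. (\<Sum>j\<in>J. g i j) \<le> a i) \<and> (\<forall>j\<in>J. (\<Sum>i\<in>I. g i j) \<le> b j)"

text \<open>
In each cell the leftover masses $u_i$ and $v_j$, with totals $U$ and $V$, are joined by the product
$u_i v_j / \max(U, V)$.  This exhausts the poorer side of the cell and never overdraws the richer
one.  Because no earlier mass crosses the cells, the mass matched inside a cell is afterwards at
least the smaller of its two masses.
\<close>

lemma subcoupling_step:
  fixes c :: "'i \<Rightarrow> 'c" and c' :: "'j \<Rightarrow> 'c"
  assumes fin: "finite I" "finite J" and sub: "subcoupling I J a b g"
    and supp: "\<And>i j. i \<in> I \<Longrightarrow> j \<in> J \<Longrightarrow> g i j \<noteq> 0 \<Longrightarrow> c i = c' j"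
  shows "\<exists>g'. subcoupling I J a b g' \<and> (\<forall>i\<in>I. \<forall>j\<in>J. g i j \<le> g' i j) \<and>
    (\<forall>i\<in>I. \<forall>j\<in>J. g' i j \<noteq> 0 \<longrightarrow> c i = c' j) \<and>
    (\<forall>F. min (\<Sum>i | i \<in> I \<and> c i = F. a i) (\<Sum>j | j \<in> J \<and> c' j = F. b j)
      \<le> (\<Sum>i | i \<in> I \<and> c i = F. \<Sum>j | j \<in> J \<and> c' j = F. g' i j))"
proof -
  define u where "u i = a i - (\<Sum>j\<in>J. g i j)" for i
  define v where "v j = b j - (\<Sum>i\<in>I. g i j)" for j
  define U where "U F = (\<Sum>i | i \<in> I \<and> c i = F. u i)" for F
  define V where "V F = (\<Sum>j | j \<in> J \<and> c' j = F. v j)" for F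
  define g' where "g' i j = g i j + (if c i = c' j then u i * v j / max (U (c i)) (V (c i)) else 0)" for i j
  have u0: "u i \<ge> 0" if "i \<in> I" for i using sub that by (auto simp: subcoupling_def u_def)
  have v0: "v j \<ge> 0" if "j \<in> J" for j using sub that by (auto simp: subcoupling_def v_def)
  have U0: "U F \<ge> 0" for F unfolding U_def by (rule sum_nonneg) (auto simp: u0)
  have V0: "V F \<ge> 0" for F unfolding V_def by (rule sum_nonneg) (auto simp: v0)
  have min_eq: "x * y / max x y = min x y" if "x \<ge> 0" "y \<ge> 0" for x y :: real
    using that by (cases "x \<le> y") (auto simp: max_def min_def)
  have frac: "w * y / max x y \<le> w" "w * x / max x y \<le> w" if "x \<ge> 0" "y \<ge> 0" "w \<ge> 0" for w x y :: real
  proof -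
    have "w * y \<le> w * max x y" "w * x \<le> w * max x y" using that by (auto intro!: mult_left_mono)
    moreover have "0 \<le> max x y" using that by simp
    ultimately show "w * y / max x y \<le> w" "w * x / max x y \<le> w"
      using that by (cases "max x y = 0"; simp add: divide_le_eq)+
  qed
  have inc: "g i j \<le> g' i j" if "i \<in> I" "j \<in> J" for i j
    using u0[OF that(1)] v0[OF that(2)] U0[of "c i"] V0[of "c i"]
    by (auto simp: g'_def le_max_iff_disj)
  have row: "(\<Sum>j\<in>J. g' i j) \<le> a i" if "i \<in> I" for i
  proof -
    have "(\<Sum>j\<in>J. g' i j) = (\<Sum>j\<in>J. g i j) + (\<Sum>j | j \<in> J \<and> c i = c' j. u i * v j / max (U (c i)) (V (c i)))"
      by (simp only: g'_def sum.distrib sum.inter_filter[OF fin(2)])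
    also have "(\<Sum>j | j \<in> J \<and> c i = c' j. u i * v j / max (U (c i)) (V (c i)))
        = u i * V (c i) / max (U (c i)) (V (c i))"
      unfolding V_def by (simp add: sum_distrib_left sum_divide_distrib eq_commute)
    also have "\<dots> \<le> u i" by (rule frac(1)[OF U0 V0 u0[OF that]])
    finally show ?thesis by (simp add: u_def)
  qed
  have col: "(\<Sum>i\<in>I. g' i j) \<le> b j" if "j \<in> J" for j
  proof -
    have "(\<Sum>i\<in>I. g' i j) = (\<Sum>i\<in>I. g i j) + (\<Sum>i | i \<in> I \<and> c i = c' j. u i * v j / max (U (c i)) (V (c i)))"
      by (simp only: g'_def sum.distrib sum.inter_filter[OF fin(1)])
    also have "(\<Sum>i | i \<in> I \<and> c i = c' j. u i * v j / max (U (c i)) (V (c i)))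
        = (\<Sum>i | i \<in> I \<and> c i = c' j. v j * u i / max (U (c' j)) (V (c' j)))"
      by (rule sum.cong) auto
    also have "\<dots> = v j * U (c' j) / max (U (c' j)) (V (c' j))"
      unfolding U_def by (simp add: sum_distrib_left sum_divide_distrib)
    also have "\<dots> \<le> v j" by (rule frac(2)[OF U0 V0 v0[OF that]])
    finally show ?thesis by (simp add: v_def)
  qed
  have mass: "(\<Sum>i | i \<in> I \<and> c i = F. \<Sum>j | j \<in> J \<and> c' j = F. g' i j)
      \<ge> min (\<Sum>i | i \<in> I \<and> c i = F. a i) (\<Sum>j | j \<in> J \<and> c' j = F. b j)" for F
  proof -
    let ?I = "{i. i \<in> I \<and> c i = F}" and ?J = "{j. j \<in> J \<and> c' j = F}"
    let ?G = "\<Sum>i\<in>?I. \<Sum>j\<in>?J. g i j"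
    have "(\<Sum>i\<in>?I. \<Sum>j\<in>?J. g' i j) = (\<Sum>i\<in>?I. \<Sum>j\<in>?J. g i j + u i * v j / max (U F) (V F))"
      by (intro sum.cong) (auto simp: g'_def)
    also have "\<dots> = ?G + U F * V F / max (U F) (V F)"
      by (simp add: sum.distrib U_def V_def sum_product sum_divide_distrib)
    also have "\<dots> = ?G + min (U F) (V F)" using min_eq U0 V0 by simp
    also have "U F = (\<Sum>i\<in>?I. a i) - ?G"
    proof -
      have "(\<Sum>j\<in>J. g i j) = (\<Sum>j\<in>?J. g i j)" if "i \<in> ?I" for i
        using that fin supp by (intro sum.mono_neutral_right) auto
      then show ?thesis unfolding U_def u_def by (simp add: sum_subtractf)
    qed
    also have "V F = (\<Sum>j\<in>?J. b j) - ?G"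
    proof -
      have "(\<Sum>i\<in>I. g i j) = (\<Sum>i\<in>?I. g i j)" if "j \<in> ?J" for j
        using that fin supp by (intro sum.mono_neutral_right) auto
      then have "V F = (\<Sum>j\<in>?J. b j) - (\<Sum>j\<in>?J. \<Sum>i\<in>?I. g i j)"
        unfolding V_def v_def by (simp add: sum_subtractf)
      then show ?thesis by (subst sum.swap)
    qed
    finally show ?thesis by simp
  qed
  have "subcoupling I J a b g'"
    using row col inc sub unfolding subcoupling_def by (auto intro: order_trans[OF _ inc])
  moreover have "c i = c' j" if "i \<in> I" "j \<in> J" "g' i j \<noteq> 0" for i j
    using that supp by (auto simp: g'_def split: if_splits)
  ultimately show ?thesis using inc mass by (intro exI[of _ g']) blast
qed

text \<open>
Induction from the finest level $L$ down to $l$: coarser steps only add mass, so what finer levels have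
achieved is kept, and nestedness makes everything matched so far stay inside the coarser cells.
\<close>

lemma nested_subcoupling:
  fixes cell :: "nat \<Rightarrow> 'p \<Rightarrow> 'c"
  assumes fin: "finite I" "finite J" and a: "\<And>i. i \<in> I \<Longrightarrow> a i \<ge> 0" and b: "\<And>j. j \<in> J \<Longrightarrow> b j \<ge> 0"
    and nest: "\<And>l x y. cell (Suc l) x = cell (Suc l) y \<Longrightarrow> cell l x = cell l y"
  shows "l \<le> L \<Longrightarrow> \<exists>g. subcoupling I J a b g \<and>
    (\<forall>i\<in>I. \<forall>j\<in>J. g i j \<noteq> 0 \<longrightarrow> cell l (X i) = cell l (Y j)) \<and>
    (\<forall>l'\<in>{l..L}. \<forall>F. min (\<Sum>i | i \<in> I \<and> cell l' (X i) = F. a i) (\<Sum>j | j \<in> J \<and> cell l' (Y j) = F. b j)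
      \<le> (\<Sum>i | i \<in> I \<and> cell l' (X i) = F. \<Sum>j | j \<in> J \<and> cell l' (Y j) = F. g i j))"
proof (induction rule: inc_induct)
  case base
  have "subcoupling I J a b (\<lambda>_ _. 0)" using a b by (simp add: subcoupling_def)
  from subcoupling_step[OF fin this, where c = "\<lambda>i. cell L (X i)" and c' = "\<lambda>j. cell L (Y j)"]
  obtain g where "subcoupling I J a b g"
      "\<forall>i\<in>I. \<forall>j\<in>J. g i j \<noteq> 0 \<longrightarrow> cell L (X i) = cell L (Y j)"
      "\<forall>F. min (\<Sum>i | i \<in> I \<and> cell L (X i) = F. a i) (\<Sum>j | j \<in> J \<and> cell L (Y j) = F. b j)
        \<le> (\<Sum>i | i \<in> I \<and> cell L (X i) = F. \<Sum>j | j \<in> J \<and> cell L (Y j) = F. g i j)"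
    by auto
  then show ?case by (intro exI[of _ g] conjI) simp_all
next
  case (step l)
  then obtain g where g: "subcoupling I J a b g"
      "\<forall>i\<in>I. \<forall>j\<in>J. g i j \<noteq> 0 \<longrightarrow> cell (Suc l) (X i) = cell (Suc l) (Y j)" and
      mass: "\<forall>l'\<in>{Suc l..L}. \<forall>F.
         min (\<Sum>i | i \<in> I \<and> cell l' (X i) = F. a i) (\<Sum>j | j \<in> J \<and> cell l' (Y j) = F. b j)
         \<le> (\<Sum>i | i \<in> I \<and> cell l' (X i) = F. \<Sum>j | j \<in> J \<and> cell l' (Y j) = F. g i j)"
    by blast
  have "cell l (X i) = cell l (Y j)" if "i \<in> I" "j \<in> J" "g i j \<noteq> 0" for i j
    using nest g(2) that by blast
  from subcoupling_step[OF fin g(1), where c = "\<lambda>i. cell l (X i)" and c' = "\<lambda>j. cell l (Y j)", OF this]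
  obtain g' where g': "subcoupling I J a b g'"
      "\<forall>i\<in>I. \<forall>j\<in>J. g i j \<le> g' i j"
      "\<forall>i\<in>I. \<forall>j\<in>J. g' i j \<noteq> 0 \<longrightarrow> cell l (X i) = cell l (Y j)" and
      mass': "\<forall>F. min (\<Sum>i | i \<in> I \<and> cell l (X i) = F. a i) (\<Sum>j | j \<in> J \<and> cell l (Y j) = F. b j)
        \<le> (\<Sum>i | i \<in> I \<and> cell l (X i) = F. \<Sum>j | j \<in> J \<and> cell l (Y j) = F. g' i j)"
    by blast
  have "min (\<Sum>i | i \<in> I \<and> cell l' (X i) = F. a i) (\<Sum>j | j \<in> J \<and> cell l' (Y j) = F. b j)
      \<le> (\<Sum>i | i \<in> I \<and> cell l' (X i) = F. \<Sum>j | j \<in> J \<and> cell l' (Y j) = F. g' i j)"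
    if "l' \<in> {l..L}" for l' F
  proof (cases "l' = l")
    case True then show ?thesis using mass' by simp
  next
    case False
    then have "l' \<in> {Suc l..L}" using that by auto
    from mass[rule_format, OF this, of F] show ?thesis
      by (rule order_trans) (use g'(2) in \<open>auto intro!: sum_mono\<close>)
  qed
  then show ?case using g'(1,3) by (intro exI[of _ g'] conjI) blast+
qed

text \<open>
One more step with the trivial partition turns the subcoupling into a coupling.  A single coupling
thus matches as much mass as possible inside every cell of every level simultaneously.
\<close>

lemma nested_coupling:
  fixes cell :: "nat \<Rightarrow> 'p \<Rightarrow> 'c" and a :: "'i \<Rightarrow> real" and b :: "'j \<Rightarrow> real"
  assumes fin: "finite I" "finite J" and a: "\<And>i. i \<in> I \<Longrightarrow> a i \<ge> 0" and b: "\<And>j. j \<in> J \<Longrightarrow> b j \<ge> 0"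
    and tot: "sum a I = sum b J"
    and nest: "\<And>l x y. cell (Suc l) x = cell (Suc l) y \<Longrightarrow> cell l x = cell l y"
  obtains g where "\<And>i j. i \<in> I \<Longrightarrow> j \<in> J \<Longrightarrow> 0 \<le> g i j"
    "\<And>i. i \<in> I \<Longrightarrow> (\<Sum>j\<in>J. g i j) = a i" "\<And>j. j \<in> J \<Longrightarrow> (\<Sum>i\<in>I. g i j) = b j"
    "\<And>l F. l \<le> L \<Longrightarrow> min (\<Sum>i | i \<in> I \<and> cell l (X i) = F. a i) (\<Sum>j | j \<in> J \<and> cell l (Y j) = F. b j)
      \<le> (\<Sum>i | i \<in> I \<and> cell l (X i) = F. \<Sum>j | j \<in> J \<and> cell l (Y j) = F. g i j)"
proof -
  have "\<exists>g. subcoupling I J a b g \<and>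
      (\<forall>i\<in>I. \<forall>j\<in>J. g i j \<noteq> 0 \<longrightarrow> cell 0 (X i) = cell 0 (Y j)) \<and>
      (\<forall>l\<in>{0..L}. \<forall>F. min (\<Sum>i | i \<in> I \<and> cell l (X i) = F. a i) (\<Sum>j | j \<in> J \<and> cell l (Y j) = F. b j)
        \<le> (\<Sum>i | i \<in> I \<and> cell l (X i) = F. \<Sum>j | j \<in> J \<and> cell l (Y j) = F. g i j))"
    by (rule nested_subcoupling[OF fin]) (use a b in \<open>auto intro: nest\<close>)
  then obtain g where g: "subcoupling I J a b g" and mass: "\<forall>l\<in>{0..L}. \<forall>F.
         min (\<Sum>i | i \<in> I \<and> cell l (X i) = F. a i) (\<Sum>j | j \<in> J \<and> cell l (Y j) = F. b j)
         \<le> (\<Sum>i | i \<in> I \<and> cell l (X i) = F. \<Sum>j | j \<in> J \<and> cell l (Y j) = F. g i j)"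
    by blast
  from subcoupling_step[OF fin g, where c = "\<lambda>_. ()" and c' = "\<lambda>_. ()"]
  obtain g' where g': "subcoupling I J a b g'"
    "\<forall>i\<in>I. \<forall>j\<in>J. g i j \<le> g' i j"
    "min (sum a I) (sum b J) \<le> (\<Sum>i\<in>I. \<Sum>j\<in>J. g' i j)"
    by auto
  have row: "(\<Sum>j\<in>J. g' i j) = a i" if "i \<in> I" for i
  proof (rule ccontr)
    assume "(\<Sum>j\<in>J. g' i j) \<noteq> a i"
    then have "(\<Sum>j\<in>J. g' i j) < a i" using g'(1) that by (auto simp: subcoupling_def less_le)
    then have "(\<Sum>i\<in>I. \<Sum>j\<in>J. g' i j) < sum a I"
      using g'(1) that fin by (intro sum_strict_mono_ex1) (auto simp: subcoupling_def)
    then show False using g'(3) tot by simp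
  qed
  have col: "(\<Sum>i\<in>I. g' i j) = b j" if "j \<in> J" for j
  proof (rule ccontr)
    assume "(\<Sum>i\<in>I. g' i j) \<noteq> b j"
    then have "(\<Sum>i\<in>I. g' i j) < b j" using g'(1) that by (auto simp: subcoupling_def less_le)
    then have "(\<Sum>j\<in>J. \<Sum>i\<in>I. g' i j) < sum b J"
      using g'(1) that fin by (intro sum_strict_mono_ex1) (auto simp: subcoupling_def)
    then show False using g'(3) tot by (subst (asm) sum.swap) simp
  qed
  have "min (\<Sum>i | i \<in> I \<and> cell l (X i) = F. a i) (\<Sum>j | j \<in> J \<and> cell l (Y j) = F. b j)
      \<le> (\<Sum>i | i \<in> I \<and> cell l (X i) = F. \<Sum>j | j \<in> J \<and> cell l (Y j) = F. g' i j)"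
    if "l \<le> L" for l F
  proof -
    have "l \<in> {0..L}" using that by simp
    from mass[rule_format, OF this, of F] show ?thesis
      by (rule order_trans) (use g'(2) in \<open>auto intro!: sum_mono\<close>)
  qed
  with row col g'(1) show ?thesis by (intro that[of g']) (auto simp: subcoupling_def)
qed

text \<open>
The mass that row indices send out of a cell $F$ is $a(F) - g(F \times F)$, and column indices receive
$b(F) - g(F \times F)$ from outside.  Their sum is at most $|a(F) - b(F)|$ once
$g(F \times F) \ge \min(a(F), b(F))$.
\<close>

lemma nested_coupling_cost_le:
  fixes h :: "'c \<Rightarrow> real" and c :: "'i \<Rightarrow> 'c" and c' :: "'j \<Rightarrow> 'c"
  assumes fin: "finite I" "finite J" "finite S"
    and sub: "c ` I \<subseteq> S" "c' ` J \<subseteq> S" and h: "\<And>F. F \<in> S \<Longrightarrow> 0 \<le> h F"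
    and row: "\<And>i. i \<in> I \<Longrightarrow> (\<Sum>j\<in>J. g i j) = a i" and col: "\<And>j. j \<in> J \<Longrightarrow> (\<Sum>i\<in>I. g i j) = b j"
    and mass: "\<And>F. min (\<Sum>i | i \<in> I \<and> c i = F. a i) (\<Sum>j | j \<in> J \<and> c' j = F. b j)
      \<le> (\<Sum>i | i \<in> I \<and> c i = F. \<Sum>j | j \<in> J \<and> c' j = F. g i j)"
  shows "(\<Sum>i\<in>I. \<Sum>j\<in>J. g i j * (if c i = c' j then 0 else h (c i) + h (c' j)))
    \<le> (\<Sum>F\<in>S. h F * \<bar>(\<Sum>i | i \<in> I \<and> c i = F. a i) - (\<Sum>j | j \<in> J \<and> c' j = F. b j)\<bar>)"
proof -
  let ?A = "\<lambda>F. \<Sum>i | i \<in> I \<and> c i = F. a i" and ?B = "\<lambda>F. \<Sum>j | j \<in> J \<and> c' j = F. b j"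
  let ?G = "\<lambda>F. \<Sum>i | i \<in> I \<and> c i = F. \<Sum>j | j \<in> J \<and> c' j = F. g i j"
  have 1: "(\<Sum>i\<in>I. \<Sum>j\<in>J. g i j * (if c i = c' j then 0 else h (c i))) = (\<Sum>F\<in>S. h F * (?A F - ?G F))"
  proof -
    have "(\<Sum>i\<in>I. \<Sum>j\<in>J. g i j * (if c i = c' j then 0 else h (c i)))
        = (\<Sum>F\<in>S. \<Sum>i | i \<in> I \<and> c i = F. \<Sum>j\<in>J. g i j * (if c i = c' j then 0 else h (c i)))"
      by (rule sum.group[OF fin(1,3) sub(1), symmetric])
    also have "\<dots> = (\<Sum>F\<in>S. \<Sum>i | i \<in> I \<and> c i = F. h F * (a i - (\<Sum>j | j \<in> J \<and> c' j = F. g i j)))"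
    proof (intro sum.cong refl)
      fix F i assume i: "i \<in> {i. i \<in> I \<and> c i = F}"
      have "(\<Sum>j\<in>J. g i j * (if c i = c' j then 0 else h (c i)))
          = (\<Sum>j\<in>J. h F * (g i j - (if c' j = F then g i j else 0)))"
        using i by (intro sum.cong) auto
      also have "\<dots> = h F * (a i - (\<Sum>j | j \<in> J \<and> c' j = F. g i j))"
        using i fin row by (simp add: sum_distrib_left[symmetric] sum_subtractf sum.inter_filter)
      finally show "(\<Sum>j\<in>J. g i j * (if c i = c' j then 0 else h (c i))) = \<dots>" .
    qed
    finally show ?thesis by (simp add: sum_distrib_left[symmetric] sum_subtractf)
  qed
  have 2: "(\<Sum>i\<in>I. \<Sum>j\<in>J. g i j * (if c i = c' j then 0 else h (c' j))) = (\<Sum>F\<in>S. h F * (?B F - ?G F))"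
  proof -
    have "(\<Sum>i\<in>I. \<Sum>j\<in>J. g i j * (if c i = c' j then 0 else h (c' j)))
       = (\<Sum>j\<in>J. \<Sum>i\<in>I. g i j * (if c i = c' j then 0 else h (c' j)))" by (rule sum.swap)
    also have "\<dots> = (\<Sum>F\<in>S. \<Sum>j | j \<in> J \<and> c' j = F. \<Sum>i\<in>I. g i j * (if c i = c' j then 0 else h (c' j)))"
      by (rule sum.group[OF fin(2,3) sub(2), symmetric])
    also have "\<dots> = (\<Sum>F\<in>S. \<Sum>j | j \<in> J \<and> c' j = F. h F * (b j - (\<Sum>i | i \<in> I \<and> c i = F. g i j)))"
    proof (intro sum.cong refl)
      fix F j assume j: "j \<in> {j. j \<in> J \<and> c' j = F}"
      have "(\<Sum>i\<in>I. g i j * (if c i = c' j then 0 else h (c' j)))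
          = (\<Sum>i\<in>I. h F * (g i j - (if c i = F then g i j else 0)))"
        using j by (intro sum.cong) auto
      also have "\<dots> = h F * (b j - (\<Sum>i | i \<in> I \<and> c i = F. g i j))"
        using j fin col by (simp add: sum_distrib_left[symmetric] sum_subtractf sum.inter_filter)
      finally show "(\<Sum>i\<in>I. g i j * (if c i = c' j then 0 else h (c' j))) = \<dots>" .
    qed
    also have "\<dots> = (\<Sum>F\<in>S. h F * (?B F - (\<Sum>j | j \<in> J \<and> c' j = F. \<Sum>i | i \<in> I \<and> c i = F. g i j)))"
      by (simp add: sum_distrib_left[symmetric] sum_subtractf)
    finally show ?thesis by (subst sum.swap)
  qed
  have "(\<Sum>i\<in>I. \<Sum>j\<in>J. g i j * (if c i = c' j then 0 else h (c i) + h (c' j)))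
     = (\<Sum>F\<in>S. h F * (?A F - ?G F)) + (\<Sum>F\<in>S. h F * (?B F - ?G F))"
    unfolding 1[symmetric] 2[symmetric] sum.distrib[symmetric]
    by (intro sum.cong refl) (simp add: algebra_simps)
  also have "\<dots> = (\<Sum>F\<in>S. h F * (?A F + ?B F - 2 * ?G F))"
    unfolding sum.distrib[symmetric] by (intro sum.cong refl) (simp add: algebra_simps)
  also have "\<dots> \<le> (\<Sum>F\<in>S. h F * \<bar>?A F - ?B F\<bar>)"
  proof (intro sum_mono mult_left_mono h)
    fix F show "?A F + ?B F - 2 * ?G F \<le> \<bar>?A F - ?B F\<bar>" using mass[of F] by linarith
  qed
  finally show ?thesis .
qed

section \<open>Dyadic cells\<close>

definition shell :: "'a::euclidean_space \<Rightarrow> nat" where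
  "shell x = (LEAST k. norm x \<le> 2 ^ k)"

text \<open>
Inside the shell $2^{k-1} < |x| \le 2^k$ (the unit ball for $k = 0$) the mesh of the grid is $2^{k-l}$,
proportional to the radius, so that one finite set of indices serves all shells.
\<close>

definition dyadic_cell :: "nat \<Rightarrow> 'a::euclidean_space \<Rightarrow> nat \<times> ('a \<Rightarrow> int)" where
  "dyadic_cell l x = (shell x, \<lambda>b\<in>Basis. \<lfloor>2 ^ l * (x \<bullet> b) / 2 ^ shell x\<rfloor>)"

definition dyadic_grid :: "nat \<Rightarrow> ('a::euclidean_space \<Rightarrow> int) set" where
  "dyadic_grid l = (\<Pi>\<^sub>E b\<in>Basis. {- (2 ^ l)..2 ^ l})"

lemma norm_le_shell: "norm x \<le> 2 ^ shell x"
proof -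
  obtain k :: nat where "norm x < 2 ^ k" using real_arch_pow[of 2 "norm x"] by auto
  then have "norm x \<le> 2 ^ k" by simp
  then show ?thesis unfolding shell_def by (rule LeastI)
qed

lemma shell_less: "k < shell x \<Longrightarrow> 2 ^ k < norm x"
  unfolding shell_def by (drule not_less_Least) simp

lemma shell_le_iff: "shell x \<le> k \<longleftrightarrow> norm x \<le> 2 ^ k"
proof
  assume "norm x \<le> 2 ^ k"
  then show "shell x \<le> k" unfolding shell_def by (rule Least_le)
next
  assume "shell x \<le> k"
  then have "(2::real) ^ shell x \<le> 2 ^ k" by (intro power_increasing) auto
  with norm_le_shell[of x] show "norm x \<le> 2 ^ k" by linarith
qed

lemma measurable_shell[measurable]: "(shell :: 'a::euclidean_space \<Rightarrow> nat) \<in> measurable borel (count_space UNIV)"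
proof (subst measurable_count_space_eq2_countable, intro conjI ballI)
  fix k
  have "(shell :: 'a \<Rightarrow> nat) -` {k} = {x. norm x \<le> 2 ^ k} - (if k = 0 then {} else {x. norm x \<le> 2 ^ (k - 1)})"
    by (auto simp: shell_le_iff[symmetric])
  then show "(shell :: 'a \<Rightarrow> nat) -` {k} \<inter> space borel \<in> sets borel" by simp
qed auto

lemma finite_dyadic_grid: "finite (dyadic_grid l :: ('a::euclidean_space \<Rightarrow> int) set)"
  unfolding dyadic_grid_def by (intro finite_PiE) auto

lemma card_dyadic_grid:
  "card (dyadic_grid l :: ('a::euclidean_space \<Rightarrow> int) set) \<le> 4 ^ DIM('a) * (2 ^ l) ^ DIM('a)"
proof -
  have "card (dyadic_grid l :: ('a \<Rightarrow> int) set) = (nat (2 ^ l - - (2 ^ l) + 1)) ^ DIM('a)"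
    unfolding dyadic_grid_def by (subst card_PiE) auto
  also have "nat (2 ^ l - - (2 ^ l) + 1) \<le> 4 * 2 ^ l"
  proof -
    have "2 ^ l - - (2 ^ l) + 1 \<le> (4::int) * 2 ^ l"
      using one_le_power[of "2::int" l] by linarith
    then show ?thesis by (simp add: nat_le_iff)
  qed
  then have "(nat (2 ^ l - - (2 ^ l) + 1)) ^ DIM('a) \<le> (4 * 2 ^ l) ^ DIM('a)"
    by (rule power_mono) simp
  finally show ?thesis by (simp add: power_mult_distrib)
qed

lemma dyadic_cell_in_grid: "dyadic_cell l x \<in> {shell x} \<times> dyadic_grid l"
proof -
  have "\<lfloor>2 ^ l * (x \<bullet> b) / 2 ^ shell x\<rfloor> \<in> {- (2 ^ l)..2 ^ l}" if b: "b \<in> Basis" for b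
  proof -
    have "\<bar>x \<bullet> b\<bar> \<le> 2 ^ shell x"
      using Basis_le_norm[OF b, of x] norm_le_shell[of x] by linarith
    then have "2 ^ l * \<bar>x \<bullet> b\<bar> \<le> 2 ^ l * 2 ^ shell x" by simp
    then have "2 ^ l * \<bar>x \<bullet> b\<bar> / 2 ^ shell x \<le> 2 ^ l" by (simp add: divide_le_eq)
    then have "\<bar>2 ^ l * (x \<bullet> b) / 2 ^ shell x\<bar> \<le> 2 ^ l" by (simp add: abs_mult)
    then have 1: "- (2 ^ l) \<le> 2 ^ l * (x \<bullet> b) / 2 ^ shell x"
      and 2: "2 ^ l * (x \<bullet> b) / 2 ^ shell x \<le> 2 ^ l" by linarith+
    have "- (2 ^ l) \<le> \<lfloor>2 ^ l * (x \<bullet> b) / 2 ^ shell x\<rfloor>"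
      using 1 by (simp add: le_floor_iff)
    moreover have "\<lfloor>2 ^ l * (x \<bullet> b) / 2 ^ shell x\<rfloor> \<le> 2 ^ l"
      using floor_mono[OF 2] floor_of_int[of "2 ^ l", where ?'a = real] by simp
    ultimately have "\<lfloor>2 ^ l * (x \<bullet> b) / 2 ^ shell x\<rfloor> \<in> {- (2 ^ l)..2 ^ l}" by simp
    then show ?thesis by simp
  qed
  then show ?thesis unfolding dyadic_cell_def dyadic_grid_def by auto
qed

text \<open>
The grid index at level $l$ is the integer half of the index at level $l + 1$.
\<close>

lemma dyadic_cell_nested: "dyadic_cell (Suc l) x = dyadic_cell (Suc l) y \<Longrightarrow> dyadic_cell l x = dyadic_cell l y"
proof -
  assume eq: "dyadic_cell (Suc l) x = dyadic_cell (Suc l) y"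
  have half: "\<lfloor>2 ^ l * t / s\<rfloor> = \<lfloor>2 ^ Suc l * t / s\<rfloor> div 2" for t s :: real
  proof -
    have "\<lfloor>2 ^ Suc l * t / s / of_int 2\<rfloor> = \<lfloor>2 ^ Suc l * t / s\<rfloor> div 2"
      by (rule floor_divide_real_eq_div) simp
    then show ?thesis by simp
  qed
  from eq have s: "shell x = shell y" by (simp add: dyadic_cell_def)
  have "\<lfloor>2 ^ Suc l * (x \<bullet> b) / 2 ^ shell x\<rfloor> = \<lfloor>2 ^ Suc l * (y \<bullet> b) / 2 ^ shell y\<rfloor>" if "b \<in> Basis" for b
    using fun_cong[OF arg_cong[where f = snd, OF eq], of b] that by (simp add: dyadic_cell_def)
  then show ?thesis using s unfolding dyadic_cell_def half by (auto simp: restrict_def)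
qed

lemma dyadic_cell_measurable[measurable]: "{x. dyadic_cell l x = F} \<in> sets borel"
proof -
  obtain k v where F: "F = (k, v)" by force
  have fl: "{x::'a. \<lfloor>2 ^ l * (x \<bullet> b) / 2 ^ k\<rfloor> = v b} \<in> sets borel" for b
  proof -
    have "{x::'a. \<lfloor>2 ^ l * (x \<bullet> b) / 2 ^ k\<rfloor> = v b}
        = {x. of_int (v b) \<le> 2 ^ l * (x \<bullet> b) / 2 ^ k} \<inter> {x. 2 ^ l * (x \<bullet> b) / 2 ^ k < of_int (v b) + 1}"
      by (auto simp: floor_eq_iff)
    also have "\<dots> \<in> sets borel"
      by (intro sets.Int borel_closed borel_open closed_Collect_le open_Collect_less continuous_intros) auto
    finally show ?thesis .
  qed
  have sh: "{x::'a. shell x = k} \<in> sets borel"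
    using measurable_sets[OF measurable_shell, of "{k}"] by (simp add: vimage_def)
  have "{x::'a. dyadic_cell l x = F} =
      (if v \<in> extensional Basis then {x. shell x = k} \<inter> (\<Inter>b\<in>Basis. {x. \<lfloor>2 ^ l * (x \<bullet> b) / 2 ^ k\<rfloor> = v b}) else {})"
    unfolding F dyadic_cell_def by (auto simp: fun_eq_iff extensional_def restrict_def)
  also have "\<dots> \<in> sets borel"
    using sh fl by (auto intro!: sets.Int sets.finite_INT)
  finally show ?thesis .
qed

lemma same_dyadic_cell_dist:
  fixes x y :: "'a::euclidean_space"
  assumes "dyadic_cell l x = dyadic_cell l y"
  shows "(norm (x - y))\<^sup>2 \<le> real DIM('a) * 4 ^ shell x / 4 ^ l"
proof -
  have s: "shell x = shell y" using assms by (simp add: dyadic_cell_def)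
  have "((x - y) \<bullet> b)\<^sup>2 \<le> 4 ^ shell x / 4 ^ l" if b: "b \<in> Basis" for b
  proof -
    let ?s = "2 ^ l * (x \<bullet> b) / 2 ^ shell x" and ?t = "2 ^ l * (y \<bullet> b) / 2 ^ shell x"
    have "\<lfloor>?s\<rfloor> = \<lfloor>?t\<rfloor>"
      using fun_cong[OF arg_cong[where f = snd, OF assms], of b] b s by (simp add: dyadic_cell_def)
    then have "\<bar>?s - ?t\<bar> \<le> 1" by linarith
    moreover have "?s - ?t = 2 ^ l / 2 ^ shell x * ((x - y) \<bullet> b)"
      by (simp add: inner_diff_left field_simps)
    ultimately have "(2 ^ l / 2 ^ shell x * ((x - y) \<bullet> b))\<^sup>2 \<le> 1"
      by (metis abs_square_le_1)
    then have "4 ^ l / 4 ^ shell x * ((x - y) \<bullet> b)\<^sup>2 \<le> 1"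
      by (simp add: power_mult_distrib power_divide power_mult[symmetric] mult.commute[of _ 2] power_mult)
    then show ?thesis by (simp add: field_simps)
  qed
  then have "(\<Sum>b\<in>(Basis::'a set). ((x - y) \<bullet> b)\<^sup>2) \<le> (\<Sum>b\<in>(Basis::'a set). 4 ^ shell x / 4 ^ l)"
    by (rule sum_mono)
  moreover have "(norm (x - y))\<^sup>2 = (\<Sum>b\<in>(Basis::'a set). ((x - y) \<bullet> b)\<^sup>2)"
    unfolding power2_norm_eq_inner euclidean_inner[of "x - y" "x - y"] by (simp only: power2_eq_square)
  ultimately show ?thesis by simp
qed

text \<open>
Charge the pair to the first level at which the two points separate.  At level 0 the cost is bounded
by the two radii; later the points still share the cell of the previous level, whose diameter is
known; if they never separate, the finest mesh bounds the cost.
\<close>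

lemma dyadic_cost:
  fixes x y :: "'a::euclidean_space"
  shows "(norm (x - y))\<^sup>2 \<le> (\<Sum>l\<le>L. if dyadic_cell l x = dyadic_cell l y then 0
      else 4 * real DIM('a) * 4 ^ shell x / 4 ^ l + 4 * real DIM('a) * 4 ^ shell y / 4 ^ l)
    + real DIM('a) * 4 ^ shell x / 4 ^ L" (is "_ \<le> sum ?h _ + _")
proof -
  have h0: "?h l \<ge> 0" for l by simp
  have le_sum: "?h l \<le> sum ?h {..L}" if "l \<le> L" for l
    by (rule member_le_sum) (use that h0 in auto)
  consider "dyadic_cell 0 x \<noteq> dyadic_cell 0 y" | "dyadic_cell L x = dyadic_cell L y"
    | l where "l < L" "dyadic_cell l x = dyadic_cell l y" "dyadic_cell (Suc l) x \<noteq> dyadic_cell (Suc l) y"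
  proof (cases "dyadic_cell 0 x \<noteq> dyadic_cell 0 y \<or> dyadic_cell L x = dyadic_cell L y")
    case False
    then obtain l where "l < L" "\<forall>i\<le>l. dyadic_cell i x = dyadic_cell i y" "dyadic_cell (Suc l) x \<noteq> dyadic_cell (Suc l) y"
      using ex_least_nat_less[of "\<lambda>i. dyadic_cell i x \<noteq> dyadic_cell i y" L] by auto
    then show ?thesis using that(3) by blast
  qed (use that in blast)
  then show ?thesis
  proof cases
    case 1
    have d: "1 \<le> real DIM('a)" by (simp add: Suc_leI)
    have "(norm (x - y))\<^sup>2 \<le> (norm x + norm y)\<^sup>2"
      by (intro power_mono norm_triangle_ineq4) auto
    also have "\<dots> \<le> 2 * (norm x)\<^sup>2 + 2 * (norm y)\<^sup>2"
      using zero_le_power2[of "norm x - norm y"] unfolding power2_sum power2_diff by linarith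
    also have "\<dots> \<le> 1 * (4 * 4 ^ shell x + 4 * 4 ^ shell y)"
    proof -
      have sq: "(norm z)\<^sup>2 \<le> 4 ^ shell z" for z :: 'a
        using power_mono[OF norm_le_shell[of z], of 2]
        by (simp add: power_mult[symmetric] mult.commute[of _ 2] power_mult)
      have "2 * a + 2 * b \<le> 1 * (4 * A + 4 * B)" if "a \<le> A" "b \<le> B" "0 \<le> A" "0 \<le> B" for a b A B :: real
        using that by simp
      from this[OF sq[of x] sq[of y]] show ?thesis by simp
    qed
    finally have "(norm (x - y))\<^sup>2 \<le> 1 * (4 * 4 ^ shell x + 4 * 4 ^ shell y)" .
    also have "\<dots> \<le> real DIM('a) * (4 * 4 ^ shell x + 4 * 4 ^ shell y)"
      using d by (intro mult_right_mono) auto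
    also have "\<dots> = ?h 0" using 1 by (simp add: algebra_simps)
    also have "\<dots> \<le> sum ?h {..L}" by (rule le_sum) simp
    finally show ?thesis by (simp add: add_increasing2)
  next
    case 2
    show ?thesis
      by (rule order_trans[OF same_dyadic_cell_dist[OF 2]]) (simp add: sum_nonneg)
  next
    case (3 l)
    have "(norm (x - y))\<^sup>2 \<le> real DIM('a) * 4 ^ shell x / 4 ^ l" by (rule same_dyadic_cell_dist[OF 3(2)])
    also have "\<dots> \<le> ?h (Suc l)" using 3(3) by simp
    also have "\<dots> \<le> sum ?h {..L}" by (rule le_sum) (use 3 in simp)
    finally show ?thesis by (simp add: add_increasing2)
  qed
qed

definition empirical_mass :: "nat \<Rightarrow> (nat \<Rightarrow> 'a) \<Rightarrow> 'a set \<Rightarrow> real" where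
  "empirical_mass n X A = (\<Sum>i<n. indicator A (X i)) / n"

lemma empirical_mass_eq: "empirical_mass n X A = (\<Sum>i | i \<in> {..<n} \<and> X i \<in> A. 1 / real n)"
proof -
  have "(\<Sum>i | i \<in> {..<n} \<and> X i \<in> A. 1 / real n) = (\<Sum>i<n. if X i \<in> A then 1 / real n else 0)"
    by (rule sum.inter_filter) simp
  also have "\<dots> = empirical_mass n X A"
    unfolding empirical_mass_def sum_divide_distrib by (intro sum.cong) auto
  finally show ?thesis ..
qed

text \<open>
Combining the nested coupling with the multi-scale bound on the cost gives a bound in which the two
samples enter only through differences of empirical masses, and which is therefore measurable.
The sum over shells is an infinite series in the extended nonnegative reals, because the number
of occupied shells depends on the sample.
\<close>

lemma dyadic_coupling:
  fixes X Y :: "nat \<Rightarrow> 'a::euclidean_space"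
  assumes n: "n \<ge> 1" and m: "m \<ge> 1"
  obtains g where "coupling_matrix n m g"
    "ennreal (transport_cost n m X Y g) \<le>
      (\<Sum>l\<le>L. \<Sum>k. \<Sum>v\<in>dyadic_grid l. ennreal (4 * real DIM('a) * 4 ^ k / 4 ^ l *
          \<bar>empirical_mass n X {x. dyadic_cell l x = (k, v)} - empirical_mass m Y {x. dyadic_cell l x = (k, v)}\<bar>))
      + (\<Sum>i<n. ennreal (real DIM('a) * 4 ^ shell (X i) / 4 ^ L / n))"
proof -
  let ?cell = "dyadic_cell :: nat \<Rightarrow> 'a \<Rightarrow> _"
  let ?h = "\<lambda>l F. 4 * real DIM('a) * 4 ^ fst F / 4 ^ l :: real"
  let ?D = "\<lambda>l F. \<bar>empirical_mass n X {x. ?cell l x = F} - empirical_mass m Y {x. ?cell l x = F}\<bar>"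
  have tot: "(\<Sum>i<n. 1 / real n) = (\<Sum>j<m. 1 / real m)" using n m by simp
  obtain g where g: "\<And>i j. i \<in> {..<n} \<Longrightarrow> j \<in> {..<m} \<Longrightarrow> 0 \<le> g i j"
    "\<And>i. i \<in> {..<n} \<Longrightarrow> (\<Sum>j<m. g i j) = 1 / n" "\<And>j. j \<in> {..<m} \<Longrightarrow> (\<Sum>i<n. g i j) = 1 / m"
    "\<And>l F. l \<le> L \<Longrightarrow> min (\<Sum>i | i \<in> {..<n} \<and> ?cell l (X i) = F. 1 / real n) (\<Sum>j | j \<in> {..<m} \<and> ?cell l (Y j) = F. 1 / real m)
      \<le> (\<Sum>i | i \<in> {..<n} \<and> ?cell l (X i) = F. \<Sum>j | j \<in> {..<m} \<and> ?cell l (Y j) = F. g i j)"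
    by (rule nested_coupling[of "{..<n}" "{..<m}" "\<lambda>_. 1 / n" "\<lambda>_. 1 / m" ?cell L X Y])
      (use tot in \<open>auto intro: dyadic_cell_nested\<close>)
  define K where "K = Max (shell ` X ` {..<n} \<union> shell ` Y ` {..<m})"
  have KX: "shell (X i) \<le> K" if "i < n" for i unfolding K_def by (rule Max_ge) (use that in auto)
  have KY: "shell (Y i) \<le> K" if "i < m" for i unfolding K_def by (rule Max_ge) (use that in auto)
  define S where "S l = {..<Suc K} \<times> (dyadic_grid l :: ('a \<Rightarrow> int) set)" for l
  have finS: "finite (S l)" for l unfolding S_def using finite_dyadic_grid by auto
  have inX: "(\<lambda>i. ?cell l (X i)) ` {..<n} \<subseteq> S l" for l
  proof
    fix F assume "F \<in> (\<lambda>i. ?cell l (X i)) ` {..<n}"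
    then obtain i where "i < n" "F = ?cell l (X i)" by auto
    then show "F \<in> S l" using dyadic_cell_in_grid[of l "X i"] KX[of i] by (auto simp: S_def)
  qed
  have inY: "(\<lambda>i. ?cell l (Y i)) ` {..<m} \<subseteq> S l" for l
  proof
    fix F assume "F \<in> (\<lambda>i. ?cell l (Y i)) ` {..<m}"
    then obtain i where "i < m" "F = ?cell l (Y i)" by auto
    then show "F \<in> S l" using dyadic_cell_in_grid[of l "Y i"] KY[of i] by (auto simp: S_def)
  qed
  have fstc: "fst (?cell l x) = shell x" for l x by (simp add: dyadic_cell_def)
  have level: "(\<Sum>i<n. \<Sum>j<m. g i j * (if ?cell l (X i) = ?cell l (Y j) then 0 else ?h l (?cell l (X i)) + ?h l (?cell l (Y j))))
      \<le> (\<Sum>F\<in>S l. ?h l F * ?D l F)" if "l \<le> L" for l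
    using nested_coupling_cost_le[OF _ _ finS inX inY, where h = "?h l" and g = g and a = "\<lambda>_. 1 / n" and b = "\<lambda>_. 1 / m"]
      g(2,3) g(4)[OF that] by (simp add: empirical_mass_eq)
  have cm: "coupling_matrix n m g" using g(1-3) by (auto simp: coupling_matrix_def)
  have "transport_cost n m X Y g \<le> (\<Sum>i<n. \<Sum>j<m. g i j *
      ((\<Sum>l\<le>L. if ?cell l (X i) = ?cell l (Y j) then 0 else ?h l (?cell l (X i)) + ?h l (?cell l (Y j)))
        + real DIM('a) * 4 ^ shell (X i) / 4 ^ L))"
    unfolding transport_cost_def fstc by (intro sum_mono mult_left_mono dyadic_cost g(1))
  also have "\<dots> = (\<Sum>l\<le>L. \<Sum>i<n. \<Sum>j<m. g i j * (if ?cell l (X i) = ?cell l (Y j) then 0 else ?h l (?cell l (X i)) + ?h l (?cell l (Y j))))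
      + (\<Sum>i<n. (\<Sum>j<m. g i j) * (real DIM('a) * 4 ^ shell (X i) / 4 ^ L))"
    by (simp only: distrib_left sum.distrib sum_distrib_left sum_distrib_right
        sum.swap[where A = "{..<n}" and B = "{..L}"] sum.swap[where A = "{..<m}" and B = "{..L}"])
  also have "\<dots> \<le> (\<Sum>l\<le>L. \<Sum>F\<in>S l. ?h l F * ?D l F) + (\<Sum>i<n. real DIM('a) * 4 ^ shell (X i) / 4 ^ L / n)"
    using level g(2) by (intro add_mono sum_mono) (auto simp: mult.commute)
  finally have "ennreal (transport_cost n m X Y g) \<le>
     ennreal ((\<Sum>l\<le>L. \<Sum>F\<in>S l. ?h l F * ?D l F) + (\<Sum>i<n. real DIM('a) * 4 ^ shell (X i) / 4 ^ L / n))"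
    by (rule ennreal_leI)
  also have "\<dots> = (\<Sum>l\<le>L. \<Sum>F\<in>S l. ennreal (?h l F * ?D l F)) + (\<Sum>i<n. ennreal (real DIM('a) * 4 ^ shell (X i) / 4 ^ L / n))"
    by (simp add: sum_nonneg)
  also have "\<dots> \<le> (\<Sum>l\<le>L. \<Sum>k. \<Sum>v\<in>dyadic_grid l. ennreal (?h l (k, v) * ?D l (k, v)))
      + (\<Sum>i<n. ennreal (real DIM('a) * 4 ^ shell (X i) / 4 ^ L / n))"
  proof (rule add_right_mono, rule sum_mono)
    fix l
    have prod_sum: "(\<Sum>F\<in>A \<times> B. f F) = (\<Sum>k\<in>A. \<Sum>v\<in>B. f (k, v))"
      for A :: "nat set" and B :: "('a \<Rightarrow> int) set" and f :: "nat \<times> ('a \<Rightarrow> int) \<Rightarrow> ennreal"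
      by (subst sum.cartesian_product) simp
    have "(\<Sum>F\<in>S l. ennreal (?h l F * ?D l F)) = (\<Sum>k<Suc K. \<Sum>v\<in>dyadic_grid l. ennreal (?h l (k, v) * ?D l (k, v)))"
      unfolding S_def by (rule prod_sum)
    also have "\<dots> \<le> (\<Sum>k. \<Sum>v\<in>dyadic_grid l. ennreal (?h l (k, v) * ?D l (k, v)))"
      by (rule sum_le_suminf) auto
    finally show "(\<Sum>F\<in>S l. ennreal (?h l F * ?D l F)) \<le> \<dots>" .
  qed
  finally show ?thesis using cm that by simp
qed

section \<open>The expected cost of matching two samples of one law\<close>

text \<open>
A sample is a family of independent random variables with a common law, so that it can be composed
with a map; the product measures in the law of the data are an instance.
\<close>

definition iid_sample :: "'w measure \<Rightarrow> nat \<Rightarrow> (nat \<Rightarrow> 'w \<Rightarrow> 'a::euclidean_space) \<Rightarrow> 'a measure \<Rightarrow> bool" where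
  "iid_sample \<Omega> n U Q \<longleftrightarrow> prob_space \<Omega> \<and> prob_space.indep_vars \<Omega> (\<lambda>_. borel) U {..<n} \<and>
     (\<forall>i<n. distr \<Omega> borel (U i) = Q)"

lemma iid_sampleD:
  assumes "iid_sample \<Omega> n U Q"
  shows "prob_space \<Omega>" "\<And>i. i < n \<Longrightarrow> U i \<in> borel_measurable \<Omega>"
    "\<And>i. i < n \<Longrightarrow> distr \<Omega> borel (U i) = Q" "prob_space.indep_vars \<Omega> (\<lambda>_. borel) U {..<n}"
  using assms prob_space.indep_vars_def[of \<Omega> "\<lambda>_. borel" U "{..<n}"] by (auto simp: iid_sample_def)

lemma empirical_mass_measurable:
  assumes "iid_sample \<Omega> n U Q" "A \<in> sets borel"
  shows "(\<lambda>\<omega>. empirical_mass n (\<lambda>i. U i \<omega>) A) \<in> borel_measurable \<Omega>"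
proof -
  have "(\<lambda>\<omega>. indicator A (U i \<omega>) :: real) \<in> borel_measurable \<Omega>" if "i < n" for i
    by (rule measurable_compose[OF iid_sampleD(2)[OF assms(1) that]]) (use assms in simp)
  then show ?thesis unfolding empirical_mass_def by (intro borel_measurable_divide borel_measurable_sum) auto
qed

text \<open>
The mean absolute deviation is at most the standard deviation, and the variance of an empirical
mass is at most $q / n$ by pairwise independence.
\<close>

lemma empirical_mass_deviation:
  fixes U :: "nat \<Rightarrow> 'w \<Rightarrow> 'a::euclidean_space"
  assumes iid: "iid_sample \<Omega> n U Q" and n: "n \<ge> 1" and A: "A \<in> sets borel"
  shows "(\<integral>\<^sup>+\<omega>. ennreal \<bar>empirical_mass n (\<lambda>i. U i \<omega>) A - measure Q A\<bar> \<partial>\<Omega>) \<le> ennreal (sqrt (measure Q A) / sqrt n)"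
proof -
  interpret prob_space \<Omega> by (rule iid_sampleD[OF iid])
  define q where "q = measure Q A"
  define f where "f x = (indicator A x - q :: real)" for x
  have f[measurable]: "f \<in> borel_measurable borel" unfolding f_def using A by simp
  note U = iid_sampleD(2)[OF iid]
  have q: "prob (U i -` A \<inter> space \<Omega>) = q" if "i < n" for i
    unfolding q_def iid_sampleD(3)[OF iid that, symmetric] using U[OF that] A by (simp add: measure_distr)
  have q01: "0 \<le> q" "q \<le> 1" using q[of 0] n prob_le_1[of "U 0 -` A \<inter> space \<Omega>"] by (auto simp: q_def)
  have fm: "(\<lambda>\<omega>. f (U i \<omega>)) \<in> borel_measurable \<Omega>" if "i < n" for i
    by (rule measurable_compose[OF U[OF that] f])
  have fb: "\<bar>f x\<bar> \<le> 1" for x using q01 by (auto simp: f_def indicator_def)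
  have int: "integrable \<Omega> (\<lambda>\<omega>. f (U i \<omega>))" if "i < n" for i
    by (rule integrable_const_bound[where B = 1]) (use fb fm[OF that] in auto)
  have ind: "expectation (\<lambda>\<omega>. indicator A (U i \<omega>)) = q" if "i < n" for i
  proof -
    have "expectation (\<lambda>\<omega>. indicator A (U i \<omega>)) = expectation (indicator (U i -` A \<inter> space \<Omega>))"
      by (intro Bochner_Integration.integral_cong) (auto simp: indicator_def)
    also have "\<dots> = q" using measurable_sets[OF U[OF that] A] q[OF that] by simp
    finally show ?thesis .
  qed
  have intind: "integrable \<Omega> (\<lambda>\<omega>. indicator A (U i \<omega>) :: real)" if "i < n" for i
  proof (rule integrable_const_bound[where B = 1])
    show "(\<lambda>\<omega>. indicator A (U i \<omega>) :: real) \<in> borel_measurable \<Omega>"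
      by (rule measurable_compose[OF U[OF that]]) (use A in simp)
  qed (auto simp: indicator_def)
  have mean: "expectation (\<lambda>\<omega>. f (U i \<omega>)) = 0" if "i < n" for i
    unfolding f_def using ind[OF that] intind[OF that] by (simp add: prob_space)
  have prodint: "integrable \<Omega> (\<lambda>\<omega>. f (U i \<omega>) * f (U j \<omega>))" if "i < n" "j < n" for i j
  proof (rule integrable_const_bound[where B = 1])
    show "AE \<omega> in \<Omega>. norm (f (U i \<omega>) * f (U j \<omega>)) \<le> 1"
      using mult_mono[OF fb fb] by (auto simp: abs_mult)
  qed (use fm that in auto)
  have cov: "expectation (\<lambda>\<omega>. f (U i \<omega>) * f (U j \<omega>)) = 0" if "i < n" "j < n" "i \<noteq> j" for i j
  proof -
    have "indep_vars (\<lambda>_. borel) (\<lambda>i \<omega>. f (U i \<omega>)) {..<n}"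
      by (rule indep_vars_compose2[OF iid_sampleD(4)[OF iid]]) simp
    then have "indep_vars (\<lambda>_. borel) (\<lambda>i \<omega>. f (U i \<omega>)) {i, j}"
      by (rule indep_vars_subset) (use that in auto)
    from indep_vars_lebesgue_integral[OF _ this] have
      "expectation (\<lambda>\<omega>. \<Prod>i\<in>{i, j}. f (U i \<omega>)) = (\<Prod>i\<in>{i, j}. expectation (\<lambda>\<omega>. f (U i \<omega>)))"
      using int that by auto
    then show ?thesis using that mean by simp
  qed
  have var: "expectation (\<lambda>\<omega>. f (U i \<omega>) * f (U i \<omega>)) \<le> q" if "i < n" for i
  proof -
    have "f x * f x \<le> indicator A x + (q * q - 2 * q * indicator A x)" for x
      unfolding f_def by (auto simp: indicator_def algebra_simps)
    then have "expectation (\<lambda>\<omega>. f (U i \<omega>) * f (U i \<omega>)) \<le>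
        expectation (\<lambda>\<omega>. indicator A (U i \<omega>) + (q * q - 2 * q * indicator A (U i \<omega>)))"
      using prodint[OF that that] intind[OF that] by (intro integral_mono) auto
    also have "\<dots> = q + (q * q - 2 * q * q)"
      using intind[OF that] ind[OF that] by (simp add: prob_space)
    also have "\<dots> \<le> q" using q01 by simp
    finally show ?thesis .
  qed
  define S where "S \<omega> = (\<Sum>i<n. f (U i \<omega>))" for \<omega>
  have intS: "integrable \<Omega> S" unfolding S_def using int by (intro Bochner_Integration.integrable_sum) auto
  have S2: "(S \<omega>)\<^sup>2 = (\<Sum>i<n. \<Sum>j<n. f (U i \<omega>) * f (U j \<omega>))" for \<omega>
    by (simp add: S_def power2_eq_square sum_product)
  have intS2: "integrable \<Omega> (\<lambda>\<omega>. (S \<omega>)\<^sup>2)"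
    unfolding S2 using prodint by (intro Bochner_Integration.integrable_sum) auto
  have "expectation (\<lambda>\<omega>. (S \<omega>)\<^sup>2) = (\<Sum>i<n. \<Sum>j<n. expectation (\<lambda>\<omega>. f (U i \<omega>) * f (U j \<omega>)))"
    unfolding S2 using prodint
    by (subst Bochner_Integration.integral_sum, force)
      (intro sum.cong refl Bochner_Integration.integral_sum, auto)
  also have "\<dots> \<le> (\<Sum>i<n. \<Sum>j<n. if i = j then q else 0)"
    using cov var by (intro sum_mono) auto
  also have "\<dots> = n * q" by simp
  finally have ES2: "expectation (\<lambda>\<omega>. (S \<omega>)\<^sup>2) \<le> n * q" .
  have "(expectation (\<lambda>\<omega>. \<bar>S \<omega>\<bar>))\<^sup>2 \<le> expectation (\<lambda>\<omega>. \<bar>S \<omega>\<bar>\<^sup>2)"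
    using variance_positive[of "\<lambda>\<omega>. \<bar>S \<omega>\<bar>"] variance_eq[of "\<lambda>\<omega>. \<bar>S \<omega>\<bar>"] intS intS2 by simp
  then have "(expectation (\<lambda>\<omega>. \<bar>S \<omega>\<bar>))\<^sup>2 \<le> n * q" using ES2 by simp
  then have ES: "expectation (\<lambda>\<omega>. \<bar>S \<omega>\<bar>) \<le> sqrt (n * q)" by (rule real_le_rsqrt)
  have "empirical_mass n (\<lambda>i. U i \<omega>) A - q = S \<omega> / n" for \<omega>
    using n by (simp add: empirical_mass_def S_def f_def sum_subtractf diff_divide_distrib)
  then have "(\<integral>\<^sup>+\<omega>. ennreal \<bar>empirical_mass n (\<lambda>i. U i \<omega>) A - q\<bar> \<partial>\<Omega>) = (\<integral>\<^sup>+\<omega>. ennreal (\<bar>S \<omega>\<bar> / n) \<partial>\<Omega>)" by simp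
  also have "\<dots> = ennreal (expectation (\<lambda>\<omega>. \<bar>S \<omega>\<bar> / n))"
    using intS by (intro nn_integral_eq_integral) auto
  also have "\<dots> \<le> ennreal (sqrt (n * q) / n)"
    using ES n by (intro ennreal_leI) (auto intro!: divide_right_mono)
  also have "sqrt (n * q) / n = sqrt q / sqrt n"
    using n by (simp add: real_sqrt_mult field_simps)
  finally show ?thesis by (simp add: q_def)
qed

text \<open>
Both empirical masses are compared with the mass under the common law, which is valid for
arbitrarily dependent samples.
\<close>

lemma empirical_mass_difference:
  fixes U V :: "nat \<Rightarrow> 'w \<Rightarrow> 'a::euclidean_space"
  assumes U: "iid_sample \<Omega> n U Q" "n \<ge> 1" and V: "iid_sample \<Omega> m V Q" "m \<ge> 1" and A: "A \<in> sets borel"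
  shows "(\<integral>\<^sup>+\<omega>. ennreal \<bar>empirical_mass n (\<lambda>i. U i \<omega>) A - empirical_mass m (\<lambda>j. V j \<omega>) A\<bar> \<partial>\<Omega>)
    \<le> ennreal (sqrt (measure Q A) * (1 / sqrt n + 1 / sqrt m))"
proof -
  note [measurable] = empirical_mass_measurable[OF U(1) A] empirical_mass_measurable[OF V(1) A]
  have "(\<integral>\<^sup>+\<omega>. ennreal \<bar>empirical_mass n (\<lambda>i. U i \<omega>) A - empirical_mass m (\<lambda>j. V j \<omega>) A\<bar> \<partial>\<Omega>)
    \<le> (\<integral>\<^sup>+\<omega>. ennreal \<bar>empirical_mass n (\<lambda>i. U i \<omega>) A - measure Q A\<bar> + ennreal \<bar>empirical_mass m (\<lambda>j. V j \<omega>) A - measure Q A\<bar> \<partial>\<Omega>)"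
    by (intro nn_integral_mono) (simp add: ennreal_plus[symmetric] del: ennreal_plus)
  also have "\<dots> = (\<integral>\<^sup>+\<omega>. ennreal \<bar>empirical_mass n (\<lambda>i. U i \<omega>) A - measure Q A\<bar> \<partial>\<Omega>) + (\<integral>\<^sup>+\<omega>. ennreal \<bar>empirical_mass m (\<lambda>j. V j \<omega>) A - measure Q A\<bar> \<partial>\<Omega>)"
    by (rule nn_integral_add) auto
  also have "\<dots> \<le> ennreal (sqrt (measure Q A) / sqrt n) + ennreal (sqrt (measure Q A) / sqrt m)"
    by (intro add_mono empirical_mass_deviation assms)
  also have "\<dots> = ennreal (sqrt (measure Q A) * (1 / sqrt n + 1 / sqrt m))"
    by (simp add: ennreal_plus[symmetric] distrib_left del: ennreal_plus)
  finally show ?thesis .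
qed

text \<open>
Markov's inequality for the $r$-th moment; the summand 1 takes care of the unit ball.
\<close>

lemma shell_mass:
  fixes Q :: "'a::euclidean_space measure"
  assumes Q: "borel_prob Q" and mom: "(\<integral>\<^sup>+ x. ennreal (norm x powr r) \<partial>Q) \<le> ennreal (M powr r)" and r: "r > 0"
  shows "measure Q {x. shell x = k} \<le> (1 + 2 powr r * M powr r) * 2 powr (- r * k)"
proof -
  interpret prob_space Q using Q by (simp add: borel_prob_def)
  have sets: "sets Q = sets borel" using Q by (simp add: borel_prob_def)
  have sk: "{x::'a. shell x = k} \<in> sets Q"
    using measurable_sets[OF measurable_shell, of "{k}"] by (simp add: vimage_def sets)
  have pw: "2 powr (r * k) \<le> 1 + 2 powr r * norm x powr r" if "shell x = k" for x :: 'a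
  proof (cases k)
    case 0 then show ?thesis by simp
  next
    case (Suc j)
    then have "2 ^ j \<le> norm x" using shell_less[of j x] that by simp
    then have "2 ^ k \<le> 2 * norm x" using Suc by simp
    then have "(2 ^ k) powr r \<le> (2 * norm x) powr r" using r by (intro powr_mono2) auto
    then show ?thesis by (simp add: powr_mult powr_powr powr_realpow[symmetric] mult.commute)
  qed
  have "ennreal (2 powr (r * k)) * emeasure Q {x. shell x = k}
      = (\<integral>\<^sup>+x. ennreal (2 powr (r * k)) * indicator {x. shell x = k} x \<partial>Q)"
    using sk by (simp add: nn_integral_cmult_indicator)
  also have "\<dots> \<le> (\<integral>\<^sup>+x. 1 + ennreal (2 powr r) * ennreal (norm x powr r) \<partial>Q)"
    using pw by (intro nn_integral_mono)
      (auto simp: indicator_def ennreal_mult[symmetric] ennreal_1[symmetric] ennreal_plus[symmetric]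
        simp del: ennreal_1 ennreal_plus intro!: ennreal_leI)
  also have "\<dots> = 1 + ennreal (2 powr r) * (\<integral>\<^sup>+x. ennreal (norm x powr r) \<partial>Q)"
    using sets by (subst nn_integral_add) (auto simp: nn_integral_cmult emeasure_space_1 cong: measurable_cong_sets)
  also have "\<dots> \<le> 1 + ennreal (2 powr r) * ennreal (M powr r)"
    by (intro add_left_mono mult_left_mono mom) simp
  also have "\<dots> = ennreal (1 + 2 powr r * M powr r)"
    by (simp add: ennreal_mult)
  finally have "ennreal (2 powr (r * k) * measure Q {x. shell x = k}) \<le> ennreal (1 + 2 powr r * M powr r)"
    by (simp add: emeasure_eq_measure ennreal_mult[symmetric] del: ennreal_plus)
  then have "2 powr (r * k) * measure Q {x. shell x = k} \<le> 1 + 2 powr r * M powr r"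
    by (subst (asm) ennreal_le_iff) auto
  then show ?thesis by (simp add: powr_minus field_simps)
qed

text \<open>
Cauchy--Schwarz over the at most $4^d 2^{ld}$ cells of level $l$ in a shell.
\<close>

lemma grid_mass_sqrt:
  fixes Q :: "'a::euclidean_space measure"
  assumes Q: "borel_prob Q"
  shows "(\<Sum>v\<in>dyadic_grid l. sqrt (measure Q {x. dyadic_cell l x = (k, v)}))
     \<le> 2 ^ DIM('a) * sqrt (2 ^ (l * DIM('a))) * sqrt (measure Q {x. shell x = k})"
proof -
  interpret prob_space Q using Q by (simp add: borel_prob_def)
  have sets: "sets Q = sets borel" using Q by (simp add: borel_prob_def)
  let ?q = "\<lambda>v. measure Q {x. dyadic_cell l x = (k, v)}"
  let ?G = "dyadic_grid l :: ('a \<Rightarrow> int) set"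
  have sk: "{x::'a. shell x = k} \<in> sets Q"
    using measurable_sets[OF measurable_shell, of "{k}"] by (simp add: vimage_def sets)
  have "(\<Sum>v\<in>?G. ?q v) = measure Q (\<Union>v\<in>?G. {x. dyadic_cell l x = (k, v)})"
    by (rule finite_measure_finite_Union[symmetric])
      (auto simp: finite_dyadic_grid sets disjoint_family_on_def dyadic_cell_measurable)
  also have "\<dots> \<le> measure Q {x. shell x = k}"
    by (rule finite_measure_mono) (auto simp: dyadic_cell_def sk)
  finally have qk: "(\<Sum>v\<in>?G. ?q v) \<le> measure Q {x. shell x = k}" .
  have "(\<Sum>v\<in>?G. 1 * sqrt (?q v))\<^sup>2 \<le> (\<Sum>v\<in>?G. 1\<^sup>2) * (\<Sum>v\<in>?G. (sqrt (?q v))\<^sup>2)"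
    by (rule Cauchy_Schwarz_ineq_sum)
  also have "\<dots> = card ?G * (\<Sum>v\<in>?G. ?q v)" by simp
  also have "\<dots> \<le> (4 ^ DIM('a) * (2 ^ l) ^ DIM('a)) * measure Q {x. shell x = k}"
  proof (intro mult_mono qk)
    have "real (card ?G) \<le> real (4 ^ DIM('a) * (2 ^ l) ^ DIM('a))"
      using card_dyadic_grid of_nat_le_iff by blast
    then show "real (card ?G) \<le> 4 ^ DIM('a) * (2 ^ l) ^ DIM('a)" by simp
  qed (auto intro!: sum_nonneg)
  finally have "(\<Sum>v\<in>?G. sqrt (?q v)) \<le> sqrt ((4 ^ DIM('a) * (2 ^ l) ^ DIM('a)) * measure Q {x. shell x = k})"
    by (intro real_le_rsqrt) simp
  also have "\<dots> = 2 ^ DIM('a) * sqrt (2 ^ (l * DIM('a))) * sqrt (measure Q {x. shell x = k})"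
  proof -
    have "sqrt (4 ^ DIM('a)) = 2 ^ DIM('a)"
      by (simp add: real_sqrt_power)
    then show ?thesis by (simp add: real_sqrt_mult power_mult)
  qed
  finally show ?thesis .
qed


text \<open>
The factor $4^{-l}$ of the cost and the square root of the number $2^{ld}$ of cells combine to a power of
$2^{d/2-2}$; the factor $4^k$ and the square root of the tail $2^{-rk}$ combine to a power of $2^{2-r/2}$.
\<close>

lemma dyadic_discrepancy_level:
  fixes U V :: "nat \<Rightarrow> 'w \<Rightarrow> 'a::euclidean_space"
  assumes Q: "borel_prob Q" and mom: "(\<integral>\<^sup>+ x. ennreal (norm x powr r) \<partial>Q) \<le> ennreal (M powr r)" and r: "r > 4"
    and U: "iid_sample \<Omega> n U Q" "n \<ge> 1" and V: "iid_sample \<Omega> m V Q" "m \<ge> 1"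
  shows "(\<integral>\<^sup>+\<omega>. (\<Sum>v\<in>dyadic_grid l. ennreal (4 * real DIM('a) * 4 ^ k / 4 ^ l *
      \<bar>empirical_mass n (\<lambda>i. U i \<omega>) {x. dyadic_cell l x = (k, v)} - empirical_mass m (\<lambda>j. V j \<omega>) {x. dyadic_cell l x = (k, v)}\<bar>)) \<partial>\<Omega>)
    \<le> ennreal (4 * real DIM('a) * 2 ^ DIM('a) * sqrt (1 + 2 powr r * M powr r) * (1 / sqrt n + 1 / sqrt m)
        * (2 powr (real DIM('a) / 2 - 2)) ^ l * (2 powr (2 - r / 2)) ^ k)"
proof -
  let ?C = "\<lambda>v. {x::'a. dyadic_cell l x = (k, v)}" and ?e = "1 / sqrt n + 1 / sqrt m"
  let ?c = "4 * real DIM('a) * 4 ^ k / 4 ^ l" and ?B = "1 + 2 powr r * M powr r"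
  have [measurable]: "(\<lambda>\<omega>. empirical_mass n (\<lambda>i. U i \<omega>) (?C v)) \<in> borel_measurable \<Omega>"
      "(\<lambda>\<omega>. empirical_mass m (\<lambda>j. V j \<omega>) (?C v)) \<in> borel_measurable \<Omega>" for v
    using empirical_mass_measurable[OF U(1)] empirical_mass_measurable[OF V(1)] dyadic_cell_measurable by auto
  have "(\<integral>\<^sup>+\<omega>. (\<Sum>v\<in>dyadic_grid l. ennreal (?c * \<bar>empirical_mass n (\<lambda>i. U i \<omega>) (?C v) - empirical_mass m (\<lambda>j. V j \<omega>) (?C v)\<bar>)) \<partial>\<Omega>)
     = (\<Sum>v\<in>dyadic_grid l. ennreal ?c * (\<integral>\<^sup>+\<omega>. ennreal \<bar>empirical_mass n (\<lambda>i. U i \<omega>) (?C v) - empirical_mass m (\<lambda>j. V j \<omega>) (?C v)\<bar> \<partial>\<Omega>))"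
  proof (subst nn_integral_sum)
    have "(\<integral>\<^sup>+\<omega>. ennreal (?c * \<bar>empirical_mass n (\<lambda>i. U i \<omega>) (?C v) - empirical_mass m (\<lambda>j. V j \<omega>) (?C v)\<bar>) \<partial>\<Omega>)
       = ennreal ?c * (\<integral>\<^sup>+\<omega>. ennreal \<bar>empirical_mass n (\<lambda>i. U i \<omega>) (?C v) - empirical_mass m (\<lambda>j. V j \<omega>) (?C v)\<bar> \<partial>\<Omega>)" for v
      by (subst nn_integral_cmult[symmetric], measurable) (intro nn_integral_cong ennreal_mult, auto)
    then show "(\<Sum>v\<in>dyadic_grid l. \<integral>\<^sup>+\<omega>. ennreal (?c * \<bar>empirical_mass n (\<lambda>i. U i \<omega>) (?C v) - empirical_mass m (\<lambda>j. V j \<omega>) (?C v)\<bar>) \<partial>\<Omega>)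
     = (\<Sum>v\<in>dyadic_grid l. ennreal ?c * (\<integral>\<^sup>+\<omega>. ennreal \<bar>empirical_mass n (\<lambda>i. U i \<omega>) (?C v) - empirical_mass m (\<lambda>j. V j \<omega>) (?C v)\<bar> \<partial>\<Omega>))"
      by (intro sum.cong refl)
  qed measurable
  also have "\<dots> \<le> (\<Sum>v\<in>dyadic_grid l. ennreal ?c * ennreal (sqrt (measure Q (?C v)) * ?e))"
    by (intro sum_mono mult_left_mono empirical_mass_difference U V dyadic_cell_measurable) auto
  also have "\<dots> = ennreal (?c * ?e * (\<Sum>v\<in>dyadic_grid l. sqrt (measure Q (?C v))))"
    by (simp add: ennreal_mult[symmetric] sum_distrib_left sum_divide_distrib mult_ac)
  also have "\<dots> \<le> ennreal (?c * ?e * (2 ^ DIM('a) * sqrt (2 ^ (l * DIM('a))) * sqrt (?B * 2 powr (- r * k))))"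
  proof (intro ennreal_leI mult_left_mono)
    have "(\<Sum>v\<in>dyadic_grid l. sqrt (measure Q (?C v)))
      \<le> 2 ^ DIM('a) * sqrt (2 ^ (l * DIM('a))) * sqrt (measure Q {x. shell x = k})"
      by (rule grid_mass_sqrt[OF Q])
    also have "\<dots> \<le> 2 ^ DIM('a) * sqrt (2 ^ (l * DIM('a))) * sqrt (?B * 2 powr (- r * k))"
      using shell_mass[OF Q mom, of k] r by (intro mult_left_mono) auto
    finally show "(\<Sum>v\<in>dyadic_grid l. sqrt (measure Q (?C v))) \<le> \<dots>" .
  qed auto
  also have "?c * ?e * (2 ^ DIM('a) * sqrt (2 ^ (l * DIM('a))) * sqrt (?B * 2 powr (- r * k)))
     = 4 * real DIM('a) * 2 ^ DIM('a) * sqrt ?B * ?e * (2 powr (real DIM('a) / 2 - 2)) ^ l * (2 powr (2 - r / 2)) ^ k"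
  proof -
    have 1: "sqrt (2 ^ (l * DIM('a))) = (2 powr (real DIM('a) / 2 - 2)) ^ l * 4 ^ l"
    proof -
      have "sqrt (2 ^ (l * DIM('a))) = 2 powr (real DIM('a) / 2 * l)"
        by (simp add: powr_half_sqrt[symmetric] powr_realpow[symmetric] powr_powr mult.commute)
      also have "\<dots> = 2 powr ((real DIM('a) / 2 - 2) * l) * 2 powr (2 * real l)"
        by (simp add: powr_add[symmetric] algebra_simps)
      also have "2 powr (2 * real l) = 4 ^ l"
        by (simp add: powr_powr[symmetric] powr_realpow)
      finally show ?thesis by (simp add: powr_powr[symmetric] powr_realpow)
    qed
    have 2: "sqrt (?B * 2 powr (- r * k)) = sqrt ?B * ((2 powr (2 - r / 2)) ^ k / 4 ^ k)"
    proof -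
      have "sqrt (2 powr (- r * k)) = 2 powr (- r / 2 * k)"
        by (simp add: powr_half_sqrt[symmetric] powr_powr)
      also have "\<dots> = 2 powr ((2 - r / 2) * k) / 2 powr (2 * real k)"
        by (simp add: powr_diff[symmetric] algebra_simps)
      also have "2 powr (2 * real k) = 4 ^ k"
        by (simp add: powr_powr[symmetric] powr_realpow)
      also have "2 powr ((2 - r / 2) * k) = (2 powr (2 - r / 2)) ^ k"
        by (simp add: powr_powr[symmetric] powr_realpow)
      finally show ?thesis by (simp add: real_sqrt_mult)
    qed
    show ?thesis unfolding 1 2 by simp
  qed
  finally show ?thesis .
qed

text \<open>
Since $d > 4$ the geometric sum over the levels is dominated by its last term, and since $r > 4$ the
geometric series over the shells converges.
\<close>

lemma dyadic_discrepancy: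
  fixes U V :: "nat \<Rightarrow> 'w \<Rightarrow> 'a::euclidean_space"
  assumes Q: "borel_prob Q" and mom: "(\<integral>\<^sup>+ x. ennreal (norm x powr r) \<partial>Q) \<le> ennreal (M powr r)" and r: "r > 4"
    and d: "DIM('a) > 4"
    and U: "iid_sample \<Omega> n U Q" "n \<ge> 1" and V: "iid_sample \<Omega> m V Q" "m \<ge> 1"
  defines "\<theta> \<equiv> 2 powr (real DIM('a) / 2 - 2)" and "\<rho> \<equiv> 2 powr (2 - r / 2)"
  shows "(\<integral>\<^sup>+\<omega>. (\<Sum>l\<le>L. \<Sum>k. \<Sum>v\<in>dyadic_grid l. ennreal (4 * real DIM('a) * 4 ^ k / 4 ^ l *
      \<bar>empirical_mass n (\<lambda>i. U i \<omega>) {x. dyadic_cell l x = (k, v)} - empirical_mass m (\<lambda>j. V j \<omega>) {x. dyadic_cell l x = (k, v)}\<bar>)) \<partial>\<Omega>)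
    \<le> ennreal (4 * real DIM('a) * 2 ^ DIM('a) * sqrt (1 + 2 powr r * M powr r) / (1 - \<rho>) * (\<theta> / (\<theta> - 1))
        * (1 / sqrt n + 1 / sqrt m) * \<theta> ^ L)"
proof -
  let ?C = "\<lambda>l k v. {x::'a. dyadic_cell l x = (k, v)}" and ?e = "1 / sqrt n + 1 / sqrt m"
  let ?K = "4 * real DIM('a) * 2 ^ DIM('a) * sqrt (1 + 2 powr r * M powr r) * ?e"
  have [measurable]: "(\<lambda>\<omega>. empirical_mass n (\<lambda>i. U i \<omega>) (?C l k v)) \<in> borel_measurable \<Omega>"
      "(\<lambda>\<omega>. empirical_mass m (\<lambda>j. V j \<omega>) (?C l k v)) \<in> borel_measurable \<Omega>" for l k v
    using empirical_mass_measurable[OF U(1)] empirical_mass_measurable[OF V(1)] dyadic_cell_measurable by auto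
  have \<theta>: "\<theta> > 1" using d unfolding \<theta>_def by simp
  have "\<rho> < 2 powr 0" using r unfolding \<rho>_def by (intro powr_less_mono) auto
  then have \<rho>: "0 < \<rho>" "\<rho> < 1" unfolding \<rho>_def by auto
  have e0: "0 \<le> ?e" by simp
  have "(\<integral>\<^sup>+\<omega>. (\<Sum>l\<le>L. \<Sum>k. \<Sum>v\<in>dyadic_grid l. ennreal (4 * real DIM('a) * 4 ^ k / 4 ^ l *
        \<bar>empirical_mass n (\<lambda>i. U i \<omega>) (?C l k v) - empirical_mass m (\<lambda>j. V j \<omega>) (?C l k v)\<bar>)) \<partial>\<Omega>)
     = (\<Sum>l\<le>L. \<Sum>k. \<integral>\<^sup>+\<omega>. (\<Sum>v\<in>dyadic_grid l. ennreal (4 * real DIM('a) * 4 ^ k / 4 ^ l *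
        \<bar>empirical_mass n (\<lambda>i. U i \<omega>) (?C l k v) - empirical_mass m (\<lambda>j. V j \<omega>) (?C l k v)\<bar>)) \<partial>\<Omega>)"
    by (subst nn_integral_sum, measurable) (subst nn_integral_suminf, auto)
  also have "\<dots> \<le> (\<Sum>l\<le>L. \<Sum>k. ennreal (?K * \<theta> ^ l * \<rho> ^ k))"
    unfolding \<theta>_def \<rho>_def
    by (intro sum_mono suminf_le dyadic_discrepancy_level[OF Q mom r U V]) auto
  also have "\<dots> = (\<Sum>l\<le>L. ennreal (?K * \<theta> ^ l / (1 - \<rho>)))"
  proof (intro sum.cong refl)
    fix l
    have "(\<lambda>k. ?K * \<theta> ^ l * \<rho> ^ k) sums (?K * \<theta> ^ l * (1 / (1 - \<rho>)))"
      using \<rho> by (intro sums_mult geometric_sums) auto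
    then have "(\<Sum>k. ennreal (?K * \<theta> ^ l * \<rho> ^ k)) = ennreal (?K * \<theta> ^ l * (1 / (1 - \<rho>)))"
      using \<theta> \<rho> e0 by (intro suminf_ennreal_eq) auto
    then show "(\<Sum>k. ennreal (?K * \<theta> ^ l * \<rho> ^ k)) = ennreal (?K * \<theta> ^ l / (1 - \<rho>))" by simp
  qed
  also have "\<dots> = ennreal (?K / (1 - \<rho>) * (\<Sum>l\<le>L. \<theta> ^ l))"
  proof -
    have "(\<Sum>l\<le>L. ennreal (?K * \<theta> ^ l / (1 - \<rho>))) = ennreal (\<Sum>l\<le>L. ?K * \<theta> ^ l / (1 - \<rho>))"
      using \<theta> \<rho> e0 by (intro sum_ennreal) auto
    then show ?thesis by (simp add: sum_distrib_left)
  qed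
  also have "\<dots> \<le> ennreal (?K / (1 - \<rho>) * (\<theta> / (\<theta> - 1) * \<theta> ^ L))"
  proof (intro ennreal_leI mult_left_mono)
    have "(\<Sum>l\<le>L. \<theta> ^ l) = (\<theta> ^ Suc L - 1) / (\<theta> - 1)"
      using \<theta> geometric_sum[of \<theta> "Suc L"] by (simp add: lessThan_Suc_atMost)
    also have "\<dots> \<le> \<theta> ^ Suc L / (\<theta> - 1)" using \<theta> by (intro divide_right_mono) auto
    finally show "(\<Sum>l\<le>L. \<theta> ^ l) \<le> \<theta> / (\<theta> - 1) * \<theta> ^ L" by simp
  qed (use \<rho> e0 in auto)
  also have "?K / (1 - \<rho>) * (\<theta> / (\<theta> - 1) * \<theta> ^ L) = 4 * real DIM('a) * 2 ^ DIM('a) * sqrt (1 + 2 powr r * M powr r) / (1 - \<rho>) * (\<theta> / (\<theta> - 1))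
        * ?e * \<theta> ^ L" by simp
  finally show ?thesis .
qed

lemma power_moment:
  fixes Q :: "'a::euclidean_space measure"
  assumes Q: "borel_prob Q" and mom: "(\<integral>\<^sup>+ x. ennreal (norm x powr r) \<partial>Q) \<le> ennreal (M powr r)" and r: "real p \<le> r" and p: "p > 0"
  shows "(\<integral>\<^sup>+ x. ennreal (norm x ^ p) \<partial>Q) \<le> ennreal (1 + M powr r)"
proof -
  interpret prob_space Q using Q by (simp add: borel_prob_def)
  have sets: "sets Q = sets borel" using Q by (simp add: borel_prob_def)
  have pw: "t ^ p \<le> 1 + t powr r" if "t \<ge> 0" for t :: real
  proof (cases "t \<le> 1")
    case True then show ?thesis using that power_le_one[of t p] powr_ge_zero[of t r] by linarith
  next
    case False
    then have "t ^ p \<le> t powr r" using r by (subst powr_realpow[symmetric]) (auto intro!: powr_mono)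
    then show ?thesis by simp
  qed
  have "(\<integral>\<^sup>+ x. ennreal (norm x ^ p) \<partial>Q) \<le> (\<integral>\<^sup>+ x. 1 + ennreal (norm x powr r) \<partial>Q)"
    using pw by (intro nn_integral_mono) (auto simp: ennreal_1[symmetric] ennreal_plus[symmetric] simp del: ennreal_1 ennreal_plus intro!: ennreal_leI)
  also have "\<dots> = 1 + (\<integral>\<^sup>+ x. ennreal (norm x powr r) \<partial>Q)"
    using sets by (subst nn_integral_add) (auto simp: emeasure_space_1 cong: measurable_cong_sets)
  also have "\<dots> \<le> 1 + ennreal (M powr r)" by (intro add_left_mono mom)
  finally show ?thesis by simp
qed

lemma iid_sample_average:
  fixes U :: "nat \<Rightarrow> 'w \<Rightarrow> 'a::euclidean_space"
  assumes U: "iid_sample \<Omega> n U Q" "n \<ge> 1" and f: "f \<in> borel_measurable borel"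
  shows "(\<integral>\<^sup>+\<omega>. (\<Sum>i<n. ennreal (f (U i \<omega>) / n)) \<partial>\<Omega>) = (\<integral>\<^sup>+x. ennreal (f x) \<partial>Q)"
proof -
  note [measurable] = f
  have [measurable]: "i < n \<Longrightarrow> U i \<in> borel_measurable \<Omega>" for i by (rule iid_sampleD(2)[OF U(1)])
  have "(\<integral>\<^sup>+\<omega>. (\<Sum>i<n. ennreal (f (U i \<omega>) / n)) \<partial>\<Omega>) = (\<Sum>i<n. \<integral>\<^sup>+\<omega>. ennreal (f (U i \<omega>) / n) \<partial>\<Omega>)"
    by (rule nn_integral_sum) auto
  also have "\<dots> = (\<Sum>i<n. ennreal (1 / n) * (\<integral>\<^sup>+x. ennreal (f x) \<partial>Q))"
  proof (intro sum.cong refl)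
    fix i assume i: "i \<in> {..<n}"
    then have [measurable]: "U i \<in> borel_measurable \<Omega>" by auto
    have "(\<integral>\<^sup>+x. ennreal (f x) \<partial>Q) = (\<integral>\<^sup>+x. ennreal (f x) \<partial>distr \<Omega> borel (U i))"
      using iid_sampleD(3)[OF U(1)] i by simp
    also have "\<dots> = (\<integral>\<^sup>+\<omega>. ennreal (f (U i \<omega>)) \<partial>\<Omega>)" by (rule nn_integral_distr) auto
    finally have eq: "(\<integral>\<^sup>+x. ennreal (f x) \<partial>Q) = (\<integral>\<^sup>+\<omega>. ennreal (f (U i \<omega>)) \<partial>\<Omega>)" .
    have "ennreal (f (U i \<omega>) / n) = ennreal (1 / n) * ennreal (f (U i \<omega>))" for \<omega>
      by (subst ennreal_mult'[symmetric]) auto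
    then show "(\<integral>\<^sup>+\<omega>. ennreal (f (U i \<omega>) / n) \<partial>\<Omega>) = ennreal (1 / n) * (\<integral>\<^sup>+x. ennreal (f x) \<partial>Q)"
      unfolding eq by (simp add: nn_integral_cmult)
  qed
  also have "\<dots> = (\<integral>\<^sup>+x. ennreal (f x) \<partial>Q)"
  proof -
    have "of_nat n * ennreal (1 / n) = 1"
      using U(2) by (simp add: ennreal_of_nat_eq_real_of_nat ennreal_mult[symmetric])
    then show ?thesis by (simp add: mult.assoc[symmetric])
  qed
  finally show ?thesis .
qed

text \<open>
The finest level $L$ balances the two error terms: $2^L$ is of order $\min(n, m)^{1/d}$, so that a shell
has, up to a constant factor, as many cells of level $L$ as the smaller sample has points.  The
bound $D$ stands in for the minimal cost because its measurability is evident from its formula.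
\<close>

theorem expected_matching_cost:
  fixes M r :: real
  assumes d: "DIM('a::euclidean_space) > 4" and r: "r > 4"
  obtains C where "C > 0"
    "\<And>(Q :: 'a measure) (\<Omega> :: 'w measure) n m U V.
      borel_prob Q \<Longrightarrow> (\<integral>\<^sup>+ x. ennreal (norm x powr r) \<partial>Q) \<le> ennreal (M powr r) \<Longrightarrow> n \<ge> 1 \<Longrightarrow> m \<ge> 1 \<Longrightarrow>
      iid_sample \<Omega> n U Q \<Longrightarrow> iid_sample \<Omega> m V Q \<Longrightarrow>
      \<exists>D. D \<in> borel_measurable \<Omega> \<and>
        (\<forall>\<omega>. \<exists>g. coupling_matrix n m g \<and> ennreal (transport_cost n m (\<lambda>i. U i \<omega>) (\<lambda>j. V j \<omega>) g) \<le> D \<omega>) \<and>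
        (\<integral>\<^sup>+\<omega>. D \<omega> \<partial>\<Omega>) \<le> ennreal (C * (real n powr (- 2 / real DIM('a)) + real m powr (- 2 / real DIM('a))))"
proof -
  define \<theta> where "\<theta> = 2 powr (real DIM('a) / 2 - 2)"
  define \<rho> where "\<rho> = 2 powr (2 - r / 2)"
  define K where "K = 4 * real DIM('a) * 2 ^ DIM('a) * sqrt (1 + 2 powr r * M powr r) / (1 - \<rho>) * (\<theta> / (\<theta> - 1))"
  define K' where "K' = real DIM('a) * (5 + 4 * M powr r)"
  have \<theta>: "\<theta> > 1" using d unfolding \<theta>_def by simp
  have "\<rho> < 2 powr 0" using r unfolding \<rho>_def by (intro powr_less_mono) auto
  then have \<rho>: "0 < \<rho>" "\<rho> < 1" unfolding \<rho>_def by auto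
  have K0: "K \<ge> 0" unfolding K_def using \<theta> \<rho> by auto
  have K'0: "K' > 0" unfolding K'_def by (auto intro!: mult_pos_pos add_pos_nonneg)
  \<comment> \<open>\<open>K\<close> collects the discrepancies of all levels and shells, \<open>K'\<close> the pairs that share a finest cell.\<close>
  show ?thesis
  proof (rule that)
    show "2 * K + 4 * K' > 0" using K0 K'0 by simp
    fix Q :: "'a measure" and \<Omega> :: "'w measure" and n m :: nat and U V
    assume Q: "borel_prob Q" and mom: "(\<integral>\<^sup>+ x. ennreal (norm x powr r) \<partial>Q) \<le> ennreal (M powr r)"
      and n: "n \<ge> 1" and m: "m \<ge> 1" and U: "iid_sample \<Omega> n U Q" and V: "iid_sample \<Omega> m V Q"
    define N where "N = min n m"
    have N: "N \<ge> 1" using n m by (simp add: N_def)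
    \<comment> \<open>The level \<open>L\<close> is the integer part of \<open>t\<close>, where $2^t = N^{1/d}$ with $N = \min(n, m)$.\<close>
    define t where "t = log 2 N / DIM('a)"
    define L where "L = nat \<lfloor>t\<rfloor>"
    have t0: "t \<ge> 0" using N unfolding t_def by (intro divide_nonneg_nonneg) auto
    have Lt: "real L \<le> t" "t < real L + 1" using t0 unfolding L_def by linarith+
    have pt: "2 powr t = N powr (1 / DIM('a))"
    proof -
      have "2 powr t = (2 powr log 2 N) powr (1 / DIM('a))" unfolding t_def by (simp add: powr_powr)
      then show ?thesis using N by simp
    qed
    define D where "D \<omega> = (\<Sum>l\<le>L. \<Sum>k. \<Sum>v\<in>dyadic_grid l. ennreal (4 * real DIM('a) * 4 ^ k / 4 ^ l *
          \<bar>empirical_mass n (\<lambda>i. U i \<omega>) {x. dyadic_cell l x = (k, v)} - empirical_mass m (\<lambda>j. V j \<omega>) {x. dyadic_cell l x = (k, v)}\<bar>))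
      + (\<Sum>i<n. ennreal (real DIM('a) * 4 ^ shell (U i \<omega>) / 4 ^ L / n))" for \<omega>
    have [measurable]: "(\<lambda>\<omega>. empirical_mass n (\<lambda>i. U i \<omega>) {x. dyadic_cell l x = (k, v)}) \<in> borel_measurable \<Omega>"
        "(\<lambda>\<omega>. empirical_mass m (\<lambda>j. V j \<omega>) {x. dyadic_cell l x = (k, v)}) \<in> borel_measurable \<Omega>" for l k v
      using empirical_mass_measurable[OF U] empirical_mass_measurable[OF V] dyadic_cell_measurable by auto
    have [measurable]: "i < n \<Longrightarrow> U i \<in> borel_measurable \<Omega>" for i by (rule iid_sampleD(2)[OF U])
    have sm[measurable]: "(\<lambda>x::'a. real DIM('a) * 4 ^ shell x / 4 ^ L) \<in> borel_measurable borel" by measurable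
    have Dm: "D \<in> borel_measurable \<Omega>" unfolding D_def by measurable
    have "(\<integral>\<^sup>+\<omega>. (\<Sum>i<n. ennreal (real DIM('a) * 4 ^ shell (U i \<omega>) / 4 ^ L / n)) \<partial>\<Omega>)
        = (\<integral>\<^sup>+x. ennreal (real DIM('a) * 4 ^ shell x / 4 ^ L) \<partial>Q)"
      by (rule iid_sample_average[OF U n sm])
    also have "\<dots> \<le> (\<integral>\<^sup>+x. ennreal (real DIM('a) / 4 ^ L) * (1 + 4 * ennreal (norm x ^ 2)) \<partial>Q)"
    proof (rule nn_integral_mono)
      fix x :: 'a
      have "4 ^ shell x \<le> 1 + 4 * (norm x)\<^sup>2"
      proof (cases "shell x")
        case (Suc j)
        then have "2 ^ j \<le> norm x" using shell_less[of j x] by simp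
        then have "(2 ^ j)\<^sup>2 \<le> (norm x)\<^sup>2" by (rule power_mono) simp
        then show ?thesis using Suc by (simp add: power_mult[symmetric] mult.commute[of _ 2] power_mult)
      qed simp
      then have "real DIM('a) / 4 ^ L * 4 ^ shell x \<le> real DIM('a) / 4 ^ L * (1 + 4 * (norm x)\<^sup>2)"
        by (rule mult_left_mono) simp
      then have "ennreal (real DIM('a) * 4 ^ shell x / 4 ^ L) \<le> ennreal (real DIM('a) / 4 ^ L * (1 + 4 * (norm x)\<^sup>2))"
        by (intro ennreal_leI) simp
      also have "\<dots> = ennreal (real DIM('a) / 4 ^ L) * (1 + 4 * ennreal (norm x ^ 2))"
        by (subst ennreal_mult) (auto simp: ennreal_mult)
      finally show "ennreal (real DIM('a) * 4 ^ shell x / 4 ^ L) \<le> \<dots>" .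
    qed
    also have "\<dots> = ennreal (real DIM('a) / 4 ^ L) * (1 + 4 * (\<integral>\<^sup>+x. ennreal (norm x ^ 2) \<partial>Q))"
    proof -
      interpret prob_space Q using Q by (simp add: borel_prob_def)
      have [measurable_cong]: "sets Q = sets borel" using Q by (simp add: borel_prob_def)
      show ?thesis
        by (subst nn_integral_cmult, measurable, subst nn_integral_add)
          (auto simp: nn_integral_cmult emeasure_space_1)
    qed
    also have "\<dots> \<le> ennreal (real DIM('a) / 4 ^ L) * (1 + 4 * ennreal (1 + M powr r))"
      using power_moment[OF Q mom, of 2] r by (intro mult_left_mono add_left_mono) auto
    also have "\<dots> = ennreal (K' / 4 ^ L)"
    proof -
      have "1 + 4 * ennreal (1 + M powr r) = ennreal (5 + 4 * M powr r)"
        by (simp add: ennreal_mult ennreal_1[symmetric] distrib_left ennreal_numeral[symmetric] ennreal_mult[symmetric] ennreal_plus[symmetric] del: ennreal_1 ennreal_numeral ennreal_plus)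
      then show ?thesis unfolding K'_def by (simp add: ennreal_mult[symmetric] del: ennreal_plus)
    qed
    finally have rem: "(\<integral>\<^sup>+\<omega>. (\<Sum>i<n. ennreal (real DIM('a) * 4 ^ shell (U i \<omega>) / 4 ^ L / n)) \<partial>\<Omega>) \<le> ennreal (K' / 4 ^ L)" .
    have "(\<integral>\<^sup>+\<omega>. D \<omega> \<partial>\<Omega>) \<le> ennreal (K * (1 / sqrt n + 1 / sqrt m) * \<theta> ^ L) + ennreal (K' / 4 ^ L)"
      unfolding D_def K_def \<theta>_def \<rho>_def
      by (subst nn_integral_add, measurable) (intro add_mono dyadic_discrepancy[OF Q mom r d U n V m] rem)
    also have "\<dots> = ennreal (K * (1 / sqrt n + 1 / sqrt m) * \<theta> ^ L + K' / 4 ^ L)"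
      using K0 K'0 \<theta> by simp
    also have "\<dots> \<le> ennreal ((2 * K + 4 * K') * N powr (- 2 / DIM('a)))"
    proof (rule ennreal_leI)
      have "\<theta> ^ L = 2 powr ((real DIM('a) / 2 - 2) * L)" unfolding \<theta>_def by (simp add: powr_powr[symmetric] powr_realpow)
      also have "\<dots> \<le> 2 powr ((real DIM('a) / 2 - 2) * t)"
        using d Lt by (intro powr_mono mult_left_mono) auto
      also have "\<dots> = (2 powr t) powr (real DIM('a) / 2 - 2)" by (simp add: powr_powr mult.commute)
      also have "\<dots> = N powr (1 / 2 - 2 / DIM('a))" 
      proof -
        have "1 / real DIM('a) * (real DIM('a) / 2 - 2) = 1 / 2 - 2 / real DIM('a)"
          using d by (simp add: right_diff_distrib)
        then show ?thesis unfolding pt powr_powr by simp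
      qed
      finally have th: "\<theta> ^ L \<le> N powr (1 / 2 - 2 / DIM('a))" .
      have e: "1 / sqrt n + 1 / sqrt m \<le> 2 * N powr (- 1 / 2)"
      proof -
        have "N powr (- 1 / 2) = 1 / sqrt N" using N by (simp add: powr_minus powr_half_sqrt inverse_eq_divide)
        moreover have "1 / sqrt n \<le> 1 / sqrt N" "1 / sqrt m \<le> 1 / sqrt N"
          using N unfolding N_def by (auto intro!: divide_left_mono)
        ultimately show ?thesis by simp
      qed
      have "K * (1 / sqrt n + 1 / sqrt m) * \<theta> ^ L \<le> K * (2 * N powr (- 1 / 2)) * N powr (1 / 2 - 2 / DIM('a))"
        using K0 \<theta> by (intro mult_mono mult_left_mono th e) auto
      also have "\<dots> = 2 * K * N powr (- 2 / DIM('a))"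
        by (simp add: powr_add[symmetric])
      finally have 1: "K * (1 / sqrt n + 1 / sqrt m) * \<theta> ^ L \<le> 2 * K * N powr (- 2 / DIM('a))" .
      have "1 / 4 ^ L = 2 powr (- 2 * L)"
        by (simp add: powr_minus powr_powr[symmetric] powr_realpow inverse_eq_divide)
      also have "\<dots> \<le> 2 powr (2 - 2 * t)" using Lt by (intro powr_mono) auto
      also have "\<dots> = 4 * (2 powr t) powr (- 2)" by (simp add: powr_diff powr_powr powr_minus field_simps)
      also have "\<dots> = 4 * N powr (- 2 / DIM('a))" unfolding pt by (simp add: powr_powr)
      finally have "K' * (1 / 4 ^ L) \<le> K' * (4 * N powr (- 2 / DIM('a)))" using K'0 by (intro mult_left_mono) auto
      then have 2: "K' / 4 ^ L \<le> 4 * K' * N powr (- 2 / DIM('a))" by simp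
      show "K * (1 / sqrt n + 1 / sqrt m) * \<theta> ^ L + K' / 4 ^ L \<le> (2 * K + 4 * K') * N powr (- 2 / DIM('a))"
        using 1 2 by (simp add: distrib_right)
    qed
    also have "\<dots> \<le> ennreal ((2 * K + 4 * K') * (real n powr (- 2 / real DIM('a)) + real m powr (- 2 / real DIM('a))))"
      using K0 K'0 unfolding N_def by (intro ennreal_leI mult_left_mono) (auto simp: min_def)
    finally have ED: "(\<integral>\<^sup>+\<omega>. D \<omega> \<partial>\<Omega>) \<le> \<dots>" .
    have "\<exists>g. coupling_matrix n m g \<and> ennreal (transport_cost n m (\<lambda>i. U i \<omega>) (\<lambda>j. V j \<omega>) g) \<le> D \<omega>" for \<omega>
      unfolding D_def
      by (rule dyadic_coupling[OF n m, of "\<lambda>i. U i \<omega>" "\<lambda>j. V j \<omega>" L]) (intro exI conjI)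
    then show "\<exists>D. D \<in> borel_measurable \<Omega> \<and>
        (\<forall>\<omega>. \<exists>g. coupling_matrix n m g \<and> ennreal (transport_cost n m (\<lambda>i. U i \<omega>) (\<lambda>j. V j \<omega>) g) \<le> D \<omega>) \<and>
        (\<integral>\<^sup>+\<omega>. D \<omega> \<partial>\<Omega>) \<le> ennreal ((2 * K + 4 * K') * (real n powr (- 2 / real DIM('a)) + real m powr (- 2 / real DIM('a))))"
      using Dm ED by (intro exI[of _ D] conjI) auto
  qed
qed

section \<open>Stability of optimal couplings\<close>

text \<open>
The two quadratic bounds say that $\varphi_0$ is $\alpha$-strongly convex and $\beta$-smooth with gradient $T_0$.
\<close>

locale smooth_strongly_convex =
  fixes \<phi>0 :: "'a::euclidean_space \<Rightarrow> real" and T0 :: "'a \<Rightarrow> 'a" and \<alpha> \<beta> :: real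
  assumes \<alpha>: "\<alpha> > 0" and \<beta>: "\<beta> > 0"
    and T0_cont: "continuous_on UNIV T0" and \<phi>0_cont: "continuous_on UNIV \<phi>0"
    and lower: "\<And>x y. \<alpha> / 2 * (norm (y - x))\<^sup>2 \<le> \<phi>0 y - \<phi>0 x - T0 x \<bullet> (y - x)"
    and upper: "\<And>x y. \<phi>0 y - \<phi>0 x - T0 x \<bullet> (y - x) \<le> \<beta> / 2 * (norm (y - x))\<^sup>2"
begin

text \<open>
The function $x \mapsto \varphi_0(x) - \langle T_0(s), x\rangle$ is minimal at $s$; one gradient step of length
$1/\beta$ from $x$ decreases it by at least $|T_0(x) - T_0(s)|^2 / (2\beta)$.
\<close>

lemma bregman_ge: "(norm (T0 x - T0 s))\<^sup>2 / (2 * \<beta>) \<le> \<phi>0 x - \<phi>0 s - T0 s \<bullet> (x - s)"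
proof -
  define D where "D = T0 x - T0 s"
  \<comment> \<open>The point reached by the gradient step.\<close>
  define z where "z = x - (1 / \<beta>) *\<^sub>R D"
  have "\<phi>0 z - \<phi>0 x - T0 x \<bullet> (z - x) \<le> \<beta> / 2 * (norm (z - x))\<^sup>2" by (rule upper)
  also have "z - x = - ((1 / \<beta>) *\<^sub>R D)" by (simp add: z_def)
  finally have 1: "\<phi>0 z - \<phi>0 x + (T0 x \<bullet> D) / \<beta> \<le> (norm D)\<^sup>2 / (2 * \<beta>)"
    using \<beta> by (simp add: power_divide power2_eq_square)
  have "0 \<le> \<alpha> / 2 * (norm (z - s))\<^sup>2" using \<alpha> by simp
  also have "\<dots> \<le> \<phi>0 z - \<phi>0 s - T0 s \<bullet> (z - s)" by (rule lower)
  also have "T0 s \<bullet> (z - s) = T0 s \<bullet> (x - s) - (T0 s \<bullet> D) / \<beta>"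
    by (simp add: z_def algebra_simps inner_diff_right)
  finally have 2: "0 \<le> \<phi>0 z - \<phi>0 s - T0 s \<bullet> (x - s) + (T0 s \<bullet> D) / \<beta>" by simp
  have "(T0 x \<bullet> D) / \<beta> - (T0 s \<bullet> D) / \<beta> = (norm D)\<^sup>2 / \<beta>"
    by (simp add: D_def diff_divide_distrib[symmetric] inner_diff_left[symmetric] power2_norm_eq_inner)
  moreover have "(norm D)\<^sup>2 / \<beta> = 2 * ((norm D)\<^sup>2 / (2 * \<beta>))" by simp
  ultimately show ?thesis using 1 2 unfolding D_def[symmetric] by linarith
qed

text \<open>
Maximize the lower quadratic bound at $x$ over the distance $|x - s|$.
\<close>

lemma bregman_le: "\<phi>0 x - \<phi>0 s - T0 s \<bullet> (x - s) \<le> (norm (T0 x - T0 s))\<^sup>2 / (2 * \<alpha>)"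
proof -
  define D where "D = T0 x - T0 s"
  have "\<alpha> / 2 * (norm (s - x))\<^sup>2 \<le> \<phi>0 s - \<phi>0 x - T0 x \<bullet> (s - x)" by (rule lower)
  then have "\<phi>0 x - \<phi>0 s - T0 s \<bullet> (x - s) \<le> D \<bullet> (x - s) - \<alpha> / 2 * (norm (x - s))\<^sup>2"
    by (simp add: D_def inner_diff_left inner_diff_right norm_minus_commute)
  also have "\<dots> \<le> norm D * norm (x - s) - \<alpha> / 2 * (norm (x - s))\<^sup>2"
    using norm_cauchy_schwarz[of D "x - s"] by simp
  also have "\<dots> \<le> (norm D)\<^sup>2 / (2 * \<alpha>)"
  proof -
    have "0 \<le> (norm D - \<alpha> * norm (x - s))\<^sup>2 / (2 * \<alpha>)" using \<alpha> by simp
    also have "\<dots> = (norm D)\<^sup>2 / (2 * \<alpha>) - norm D * norm (x - s) + \<alpha> / 2 * (norm (x - s))\<^sup>2"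
      using \<alpha> by (simp add: field_simps power2_eq_square)
    finally show ?thesis by simp
  qed
  finally show ?thesis by (simp add: D_def)
qed

lemma T0_lipschitz: "norm (T0 x - T0 s) \<le> \<beta> * norm (x - s)"
proof -
  have h: "(norm (T0 x - T0 s))\<^sup>2 / (2 * \<beta>) \<le> \<beta> / 2 * (norm (x - s))\<^sup>2"
    using bregman_ge[of x s] upper[of x s] by linarith
  have "(norm (T0 x - T0 s))\<^sup>2 \<le> (\<beta> * norm (x - s))\<^sup>2"
    using mult_right_mono[OF h, of "2 * \<beta>"] \<beta> by (simp add: power_mult_distrib power2_eq_square mult_ac)
  then show ?thesis by (rule power2_le_imp_le) (use \<beta> in auto)
qed

lemma T0_expand: "\<alpha> * norm (x - s) \<le> norm (T0 x - T0 s)"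
proof -
  have h: "\<alpha> / 2 * (norm (x - s))\<^sup>2 \<le> (norm (T0 x - T0 s))\<^sup>2 / (2 * \<alpha>)"
    using bregman_le[of x s] lower[of x s] by linarith
  have "(\<alpha> * norm (x - s))\<^sup>2 \<le> (norm (T0 x - T0 s))\<^sup>2"
    using mult_right_mono[OF h, of "2 * \<alpha>"] \<alpha> by (simp add: power_mult_distrib power2_eq_square mult_ac)
  then show ?thesis by (rule power2_le_imp_le) auto
qed

lemma T0_inj: "T0 x = T0 s \<Longrightarrow> x = s"
  using T0_expand[of x s] \<alpha> by (simp add: mult_le_0_iff)

text \<open>
By strong convexity $x \mapsto \langle x, y\rangle - \varphi_0(x)$ attains its maximum; a gradient step from the
maximum point would increase the value unless the gradient $y - T_0(s)$ vanishes there.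
\<close>

lemma ex_T0_preimage: "\<exists>s. T0 s = y"
proof -
  define f where "f x = x \<bullet> y - \<phi>0 x" for x
  \<comment> \<open>Outside the ball of radius \<open>R\<close> the quadratic term beats the linear one.\<close>
  define R where "R = 2 * norm (y - T0 0) / \<alpha>"
  have R0: "R \<ge> 0" using \<alpha> by (simp add: R_def)
  have "continuous_on (cball 0 R) f"
    unfolding f_def using continuous_on_subset[OF \<phi>0_cont] by (intro continuous_intros) auto
  then obtain s where s: "s \<in> cball 0 R" "\<And>x. x \<in> cball 0 R \<Longrightarrow> f x \<le> f s"
    using continuous_attains_sup[of "cball 0 R" f] R0 by auto
  have max: "f x \<le> f s" for x
  proof (cases "norm x \<le> R")
    case True then show ?thesis using s by simp
  next
    case False
    have "\<phi>0 x \<ge> \<phi>0 0 + T0 0 \<bullet> x + \<alpha> / 2 * (norm x)\<^sup>2" using lower[of x 0] by simp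
    then have "f x \<le> f 0 + (y - T0 0) \<bullet> x - \<alpha> / 2 * (norm x)\<^sup>2"
      by (simp add: f_def inner_diff_left inner_diff_right inner_commute)
    also have "\<dots> \<le> f 0 + norm (y - T0 0) * norm x - \<alpha> / 2 * (norm x)\<^sup>2"
      using norm_cauchy_schwarz[of "y - T0 0" x] by simp
    also have "\<dots> \<le> f 0"
    proof -
      have "norm (y - T0 0) \<le> \<alpha> / 2 * norm x"
        using False \<alpha> unfolding R_def by (simp add: field_simps)
      then have "norm (y - T0 0) * norm x \<le> \<alpha> / 2 * norm x * norm x" by (rule mult_right_mono) simp
      then show ?thesis by (simp add: power2_eq_square)
    qed
    also have "f 0 \<le> f s" using s R0 by simp
    finally show ?thesis .
  qed
  define v where "v = y - T0 s"
  define w where "w = (1 / \<beta>) *\<^sub>R v"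
  have "f (s + w) \<le> f s" by (rule max)
  then have "w \<bullet> y \<le> \<phi>0 (s + w) - \<phi>0 s" by (simp add: f_def inner_add_left)
  moreover have "\<phi>0 (s + w) - \<phi>0 s - T0 s \<bullet> w \<le> \<beta> / 2 * (norm w)\<^sup>2"
    using upper[of "s + w" s] by simp
  ultimately have "w \<bullet> v \<le> \<beta> / 2 * (norm w)\<^sup>2"
    by (simp add: v_def inner_diff_right inner_commute)
  moreover have "w \<bullet> v = (v \<bullet> v) / \<beta>" by (simp add: w_def)
  moreover have "\<beta> / 2 * (norm w)\<^sup>2 = (v \<bullet> v) / (2 * \<beta>)"
  proof -
    have "(norm w)\<^sup>2 = (v \<bullet> v) / (\<beta> * \<beta>)" unfolding power2_norm_eq_inner w_def by simp
    then show ?thesis using \<beta> by simp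
  qed
  ultimately have "(v \<bullet> v) / \<beta> \<le> (v \<bullet> v) / (2 * \<beta>)" by linarith
  then have "v \<bullet> v \<le> 0" using \<beta> by (simp add: divide_le_cancel field_simps)
  then have "v = 0" using inner_ge_zero[of v] by (simp add: order_antisym)
  then show ?thesis by (auto simp: v_def)
qed

definition T0_inv :: "'a \<Rightarrow> 'a" where "T0_inv y = (SOME s. T0 s = y)"

lemma T0_T0_inv[simp]: "T0 (T0_inv y) = y"
  unfolding T0_inv_def using ex_T0_preimage by (rule someI_ex)

lemma T0_inv_T0[simp]: "T0_inv (T0 x) = x"
  by (rule T0_inj) simp

lemma T0_inv_lipschitz: "norm (T0_inv x - T0_inv y) \<le> norm (x - y) / \<alpha>"
  using T0_expand[of "T0_inv x" "T0_inv y"] \<alpha> by (simp add: field_simps)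

lemma T0_inv_cont: "continuous_on UNIV T0_inv"
proof (rule continuous_onI)
  fix x :: 'a and e :: real assume e: "e > 0"
  have "norm (T0_inv x' - T0_inv x) \<le> e" if "norm (x' - x) < \<alpha> * e" for x'
  proof -
    have "norm (x' - x) / \<alpha> \<le> e" using that \<alpha> by (simp add: divide_le_eq mult.commute)
    with T0_inv_lipschitz[of x' x] show ?thesis by simp
  qed
  then show "\<exists>d>0. \<forall>x'\<in>UNIV. dist x' x < d \<longrightarrow> dist (T0_inv x') (T0_inv x) \<le> e"
    using e \<alpha> by (intro exI[of _ "\<alpha> * e"]) (auto simp: dist_norm)
qed

text \<open>
The quantity $b_{ij}$ is the Fenchel gap at $(X_i, Y_j)$, written as a Bregman divergence.  For a coupling its
total is half the transport cost plus terms that depend on the marginals only, hence $p$ minimizes it;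
the two Bregman bounds translate this into the cost $|T_0(X_i) - Y_j|^2$.
\<close>

lemma coupling_stability:
  fixes X Y :: "nat \<Rightarrow> 'a"
  assumes opt: "optimal_coupling n m X Y p" and g: "coupling_matrix n m g"
  shows "transport_cost n m (\<lambda>i. T0 (X i)) Y p \<le> \<beta> / \<alpha> * transport_cost n m (\<lambda>i. T0 (X i)) Y g"
proof -
  define b where "b i j = \<phi>0 (X i) - \<phi>0 (T0_inv (Y j)) - Y j \<bullet> (X i - T0_inv (Y j))" for i j
  have ge: "(norm (T0 (X i) - Y j))\<^sup>2 \<le> 2 * \<beta> * b i j" for i j
    using bregman_ge[of "X i" "T0_inv (Y j)"] \<beta> by (simp add: b_def field_simps)
  have le: "b i j \<le> (norm (T0 (X i) - Y j))\<^sup>2 / (2 * \<alpha>)" for i j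
    using bregman_le[of "X i" "T0_inv (Y j)"] by (simp add: b_def)
  have beq: "(\<Sum>i<n. \<Sum>j<m. q i j * b i j) = transport_cost n m X Y q / 2
     + ((\<Sum>i<n. (\<phi>0 (X i) - (norm (X i))\<^sup>2 / 2) / n)
     + (\<Sum>j<m. (T0_inv (Y j) \<bullet> Y j - \<phi>0 (T0_inv (Y j)) - (norm (Y j))\<^sup>2 / 2) / m))"
    if q: "coupling_matrix n m q" for q
  proof -
    let ?u = "\<lambda>i. \<phi>0 (X i) - (norm (X i))\<^sup>2 / 2" and ?v = "\<lambda>j. T0_inv (Y j) \<bullet> Y j - \<phi>0 (T0_inv (Y j)) - (norm (Y j))\<^sup>2 / 2"
    have "b i j = (norm (X i - Y j))\<^sup>2 / 2 + ?u i + ?v j" for i j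
      unfolding b_def by (simp add: power2_norm_eq_inner inner_diff_left inner_diff_right inner_commute add_divide_distrib diff_divide_distrib)
    then have "(\<Sum>i<n. \<Sum>j<m. q i j * b i j) = (\<Sum>i<n. \<Sum>j<m. q i j * (norm (X i - Y j))\<^sup>2 / 2 + q i j * ?u i + q i j * ?v j)"
      by (simp add: distrib_left)
    also have "\<dots> = transport_cost n m X Y q / 2 + (\<Sum>i<n. \<Sum>j<m. q i j * ?u i) + (\<Sum>i<n. \<Sum>j<m. q i j * ?v j)"
      by (simp only: sum.distrib transport_cost_def sum_divide_distrib)
    also have "(\<Sum>i<n. \<Sum>j<m. q i j * ?u i) = (\<Sum>i<n. ?u i / n)"
      using q by (intro sum.cong refl) (auto simp: sum_distrib_right[symmetric] coupling_matrix_def)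
    also have "(\<Sum>i<n. \<Sum>j<m. q i j * ?v j) = (\<Sum>j<m. \<Sum>i<n. q i j * ?v j)" by (rule sum.swap)
    also have "\<dots> = (\<Sum>j<m. ?v j / m)"
      using q by (intro sum.cong refl) (auto simp: sum_distrib_right[symmetric] coupling_matrix_def)
    finally show ?thesis by simp
  qed
  have p: "coupling_matrix n m p" using opt by (simp add: optimal_coupling_def)
  have p0: "0 \<le> p i j" "0 \<le> g i j" if "i < n" "j < m" for i j using p g that by (auto simp: coupling_matrix_def)
  have "transport_cost n m (\<lambda>i. T0 (X i)) Y p \<le> (\<Sum>i<n. \<Sum>j<m. p i j * (2 * \<beta> * b i j))"
    unfolding transport_cost_def using p0 ge by (intro sum_mono mult_left_mono) auto
  also have "\<dots> = 2 * \<beta> * (\<Sum>i<n. \<Sum>j<m. p i j * b i j)"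
    by (simp add: sum_distrib_left mult_ac)
  also have "\<dots> \<le> 2 * \<beta> * (\<Sum>i<n. \<Sum>j<m. g i j * b i j)"
    using opt g \<beta> unfolding beq[OF p] beq[OF g] optimal_coupling_def by simp
  also have "\<dots> \<le> 2 * \<beta> * (\<Sum>i<n. \<Sum>j<m. g i j * ((norm (T0 (X i) - Y j))\<^sup>2 / (2 * \<alpha>)))"
    using p0 le \<beta> by (intro mult_left_mono sum_mono) auto
  also have "\<dots> = \<beta> / \<alpha> * transport_cost n m (\<lambda>i. T0 (X i)) Y g"
    unfolding transport_cost_def by (simp add: sum_distrib_left mult_ac)
  finally show ?thesis .
qed

end

section \<open>The semi-dual problem and the push-forward\<close>

text \<open>
Indicators of closed sets are pointwise limits of the Lipschitz functions $\max(0, 1 - n\, d(x, A))$.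
\<close>

lemma measure_eq_lipschitzI:
  fixes P Q :: "'a::euclidean_space measure"
  assumes P: "borel_prob P" and Q: "borel_prob Q"
    and eq: "\<And>h L. (\<And>x. 0 \<le> h x \<and> h x \<le> (1::real)) \<Longrightarrow> (\<And>x y. \<bar>h x - h y\<bar> \<le> L * norm (x - y)) \<Longrightarrow>
      (\<integral>x. h x \<partial>P) = (\<integral>x. h x \<partial>Q)"
  shows "P = Q"
proof -
  interpret P: prob_space P using P by (simp add: borel_prob_def)
  interpret Q: prob_space Q using Q by (simp add: borel_prob_def)
  have sP: "sets P = sets borel" and sQ: "sets Q = sets borel"
    using P Q by (auto simp: borel_prob_def)
  note [measurable_cong] = sP sQ
  \<comment> \<open>Closed sets form a generator that is stable under intersection.\<close>
  have closed: "emeasure P A = emeasure Q A" if A: "closed A" for A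
  proof (cases "A = {}")
    case False
    define h where "h n x = max 0 (1 - real n * infdist x A)" for n :: nat and x
    have h01: "0 \<le> h n x \<and> h n x \<le> 1" for n x
      using infdist_nonneg[of x A] by (auto simp: h_def)
    have lip: "\<bar>h n x - h n y\<bar> \<le> real n * norm (x - y)" for n x y
    proof -
      have "\<bar>infdist x A - infdist y A\<bar> \<le> dist x y" by (rule infdist_triangle_abs)
      then have "\<bar>real n * infdist x A - real n * infdist y A\<bar> \<le> real n * norm (x - y)"
        by (simp add: right_diff_distrib[symmetric] abs_mult dist_norm mult_left_mono)
      then show ?thesis unfolding h_def by linarith
    qed
    have hm: "h n \<in> borel_measurable borel" for n
      unfolding h_def by (intro borel_measurable_continuous_onI continuous_intros)
    have lim: "(\<lambda>n. h n x) \<longlonglongrightarrow> indicator A x" for x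
    proof (cases "x \<in> A")
      case True
      then show ?thesis by (simp add: h_def)
    next
      case F: False
      then have "infdist x A > 0" using A False by (simp add: infdist_pos_not_in_closed)
      then obtain N :: nat where N: "1 < real N * infdist x A" using reals_Archimedean3 by blast
      have "h n x = 0" if "n \<ge> N" for n
      proof -
        have "real N * infdist x A \<le> real n * infdist x A" using that infdist_nonneg by (intro mult_right_mono) auto
        then show ?thesis using N by (simp add: h_def)
      qed
      then have "eventually (\<lambda>n. h n x = indicator A x) sequentially"
        using F by (auto simp: eventually_sequentially)
      then show ?thesis by (rule tendsto_eventually)
    qed
    have A_sets: "A \<in> sets borel" using A by simp
    have conv: "(\<lambda>n. \<integral>x. h n x \<partial>M) \<longlonglongrightarrow> measure M A" if M: "prob_space M" and sM: "sets M = sets borel" for M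
    proof -
      interpret prob_space M by (rule M)
      note [measurable_cong] = sM
      have "(\<lambda>n. \<integral>x. h n x \<partial>M) \<longlonglongrightarrow> (\<integral>x. indicator A x \<partial>M)"
        by (rule integral_dominated_convergence[where w = "\<lambda>_. 1"]) (use hm lim h01 A_sets in auto)
      then show ?thesis using A_sets sM by simp
    qed
    have "(\<integral>x. h n x \<partial>P) = (\<integral>x. h n x \<partial>Q)" for n by (rule eq[OF h01 lip])
    then have "measure P A = measure Q A"
      using conv[OF P.prob_space_axioms sP] conv[OF Q.prob_space_axioms sQ] LIMSEQ_unique by auto
    then show ?thesis by (simp add: P.emeasure_eq_measure Q.emeasure_eq_measure)
  qed simp
  show ?thesis
  proof (rule measure_eqI_generator_eq[where E = "{S. closed S}" and \<Omega> = UNIV and A = "\<lambda>_. UNIV"])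
    show "Int_stable {S::'a set. closed S}" by (auto simp: Int_stable_def)
    show "sets P = sigma_sets UNIV {S. closed S}" "sets Q = sigma_sets UNIV {S. closed S}"
      unfolding sP sQ borel_eq_closed by simp_all
  qed (use closed P.emeasure_space_1 Q.emeasure_space_1 in auto)
qed

lemma ereal_integral_real:
  assumes "integrable M f"
  shows "ereal_integral M (\<lambda>x. ereal (f x)) = ereal (\<integral>x. f x \<partial>M)"
proof -
  have fin: "(\<integral>\<^sup>+ x. ennreal (f x) \<partial>M) < \<infinity>" "(\<integral>\<^sup>+ x. ennreal (- f x) \<partial>M) < \<infinity>"
    using assms by (auto simp: real_integrable_def top.not_eq_extremum)
  obtain a where a: "(\<integral>\<^sup>+ x. ennreal (f x) \<partial>M) = ennreal a" "a \<ge> 0" using fin(1) by (cases "\<integral>\<^sup>+ x. ennreal (f x) \<partial>M") auto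
  obtain b where b: "(\<integral>\<^sup>+ x. ennreal (- f x) \<partial>M) = ennreal b" "b \<ge> 0" using fin(2) by (cases "\<integral>\<^sup>+ x. ennreal (- f x) \<partial>M") auto
  have "ereal_integral M (\<lambda>x. ereal (f x)) = enn2ereal (ennreal a) - enn2ereal (ennreal b)"
    by (simp add: ereal_integral_def a(1)[symmetric] b(1)[symmetric] e2ennreal_ereal)
  also have "\<dots> = ereal (a - b)" using a b by simp
  also have "a - b = (\<integral>x. f x \<partial>M)" using real_lebesgue_integral_def[OF assms] a b by simp
  finally show ?thesis .
qed

lemma ereal_integral_mono:
  assumes "\<And>x. f x \<le> g x"
  shows "ereal_integral M f \<le> ereal_integral M g"
  unfolding ereal_integral_def using assms
  by (intro ereal_minus_mono) (auto intro!: nn_integral_mono e2ennreal_mono simp: less_eq_ennreal.rep_eq[symmetric])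

context smooth_strongly_convex
begin

lemma fenchel_gap_ge: "x \<bullet> y - \<phi>0 x \<le> T0_inv y \<bullet> y - \<phi>0 (T0_inv y) - \<alpha> / 2 * (norm (x - T0_inv y))\<^sup>2"
  using lower[of x "T0_inv y"] by (simp add: inner_diff_right inner_commute)

lemma conjugate_eq: "conjugate \<phi>0 y = ereal (T0_inv y \<bullet> y - \<phi>0 (T0_inv y))"
proof (rule antisym)
  have "x \<bullet> y - \<phi>0 x \<le> T0_inv y \<bullet> y - \<phi>0 (T0_inv y)" for x
  proof -
    have "0 \<le> \<alpha> / 2 * (norm (x - T0_inv y))\<^sup>2" using \<alpha> by simp
    with fenchel_gap_ge[of x y] show ?thesis by linarith
  qed
  then show "conjugate \<phi>0 y \<le> ereal (T0_inv y \<bullet> y - \<phi>0 (T0_inv y))"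
    unfolding conjugate_def by (intro SUP_least) simp
  show "ereal (T0_inv y \<bullet> y - \<phi>0 (T0_inv y)) \<le> conjugate \<phi>0 y"
    unfolding conjugate_def by (rule SUP_upper) simp
qed

text \<open>
First-order expansion of the conjugate with an explicit error: moving away from the maximum point
$S(y)$ by $w$ gains at most $|t| L w$ from the perturbation but loses $\frac\alpha2 w^2$.
\<close>

lemma conjugate_perturbed:
  assumes lip: "\<And>x y. \<bar>h x - h y\<bar> \<le> L * norm (x - y)"
  shows "conjugate (\<lambda>x. \<phi>0 x + t * h x) y \<le> ereal (T0_inv y \<bullet> y - \<phi>0 (T0_inv y) - t * h (T0_inv y) + t\<^sup>2 * L\<^sup>2 / (2 * \<alpha>))"
proof -
  have "x \<bullet> y - (\<phi>0 x + t * h x) \<le> T0_inv y \<bullet> y - \<phi>0 (T0_inv y) - t * h (T0_inv y) + t\<^sup>2 * L\<^sup>2 / (2 * \<alpha>)" for x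
  proof -
    define w where "w = norm (x - T0_inv y)"
    have "- (t * h x) + t * h (T0_inv y) \<le> \<bar>t\<bar> * \<bar>h x - h (T0_inv y)\<bar>"
      by (metis abs_le_D2 abs_mult add.commute diff_conv_add_uminus minus_diff_eq order_refl right_diff_distrib)
    also have "\<dots> \<le> \<bar>t\<bar> * (L * w)" unfolding w_def by (intro mult_left_mono lip) simp
    also have "\<dots> \<le> t\<^sup>2 * L\<^sup>2 / (2 * \<alpha>) + \<alpha> / 2 * w\<^sup>2"
    proof -
      have "0 \<le> (\<bar>t\<bar> * L - \<alpha> * w)\<^sup>2 / (2 * \<alpha>)" using \<alpha> by simp
      also have "\<dots> = t\<^sup>2 * L\<^sup>2 / (2 * \<alpha>) - \<bar>t\<bar> * (L * w) + \<alpha> / 2 * w\<^sup>2"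
        using \<alpha> by (simp add: power2_diff power_mult_distrib field_simps power2_eq_square)
      finally show ?thesis by simp
    qed
    finally show ?thesis using fenchel_gap_ge[of x y] unfolding w_def by linarith
  qed
  then show ?thesis unfolding conjugate_def by (intro SUP_least) simp
qed

text \<open>
This makes the conjugate integrable for a law with second moment.
\<close>

lemma quadratic_growth: "\<exists>c. \<forall>y. \<bar>T0_inv y \<bullet> y - \<phi>0 (T0_inv y)\<bar> \<le> c * (1 + (norm y)\<^sup>2)"
proof -
  define k where "k = norm (T0 0)"
  have "\<bar>T0_inv y \<bullet> y - \<phi>0 (T0_inv y)\<bar> \<le> (\<bar>\<phi>0 0\<bar> + k\<^sup>2 / \<alpha> + 1 / \<alpha>) * (1 + (norm y)\<^sup>2)" for y
  proof -
    have "0 \<le> (norm (T0 0 - T0 (T0_inv y)))\<^sup>2 / (2 * \<beta>)" using \<beta> by simp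
    then have 1: "- \<phi>0 0 \<le> T0_inv y \<bullet> y - \<phi>0 (T0_inv y)"
      using bregman_ge[of 0 "T0_inv y"] by (simp add: inner_commute)
    have "T0_inv y \<bullet> y - \<phi>0 (T0_inv y) + \<phi>0 0 \<le> (norm (T0 0 - y))\<^sup>2 / (2 * \<alpha>)"
      using bregman_le[of 0 "T0_inv y"] by (simp add: inner_commute)
    also have "(norm (T0 0 - y))\<^sup>2 \<le> (k + norm y)\<^sup>2"
      unfolding k_def by (intro power_mono norm_triangle_ineq4) simp
    also have "(k + norm y)\<^sup>2 \<le> 2 * k\<^sup>2 + 2 * (norm y)\<^sup>2"
      using zero_le_power2[of "k - norm y"] unfolding power2_sum power2_diff by linarith
    finally have 2: "T0_inv y \<bullet> y - \<phi>0 (T0_inv y) + \<phi>0 0 \<le> (2 * k\<^sup>2 + 2 * (norm y)\<^sup>2) / (2 * \<alpha>)"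
      using \<alpha> by (simp add: divide_right_mono)
    have "(2 * k\<^sup>2 + 2 * (norm y)\<^sup>2) / (2 * \<alpha>) = k\<^sup>2 / \<alpha> + (norm y)\<^sup>2 / \<alpha>"
      using \<alpha> by (simp add: field_simps)
    with 1 2 have "\<bar>T0_inv y \<bullet> y - \<phi>0 (T0_inv y)\<bar> \<le> \<bar>\<phi>0 0\<bar> + k\<^sup>2 / \<alpha> + (norm y)\<^sup>2 / \<alpha>"
      using \<alpha> by (smt (verit) divide_nonneg_pos zero_le_power2)
    also have "\<dots> \<le> (\<bar>\<phi>0 0\<bar> + k\<^sup>2 / \<alpha> + 1 / \<alpha>) * (1 + (norm y)\<^sup>2)"
    proof -
      have "0 \<le> (\<bar>\<phi>0 0\<bar> + k\<^sup>2 / \<alpha>) * (norm y)\<^sup>2 + 1 / \<alpha>" using \<alpha> by (intro add_nonneg_nonneg mult_nonneg_nonneg) auto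
      then show ?thesis by (simp add: algebra_simps)
    qed
    finally show ?thesis .
  qed
  then show ?thesis by blast
qed

text \<open>
Perturb $\varphi_0$ by $t h$ with $h$ bounded and Lipschitz.  The objective changes by at most
$t (\int h\,dP - \int h \circ S\,dQ) + O(t^2)$, where $S$ is the inverse of $T_0$.  Minimality for $t$ of
both signs makes the linear coefficient vanish, which says $P = S_\# Q$.
\<close>

lemma pushforward:
  assumes P: "borel_prob P" and Q: "borel_prob Q" and Q2: "(\<integral>\<^sup>+ y. ennreal (norm y ^ 2) \<partial>Q) < \<infinity>"
    and sd: "solves_semi_dual P Q \<phi>0"
  shows "distr P borel T0 = Q"
proof -
  interpret P: prob_space P using P by (simp add: borel_prob_def)
  interpret Q: prob_space Q using Q by (simp add: borel_prob_def)
  have sP: "sets P = sets borel" and sQ: "sets Q = sets borel"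
    using P Q by (auto simp: borel_prob_def)
  note [measurable_cong] = sP sQ
  have [measurable]: "T0_inv \<in> borel_measurable borel" "T0 \<in> borel_measurable borel" "\<phi>0 \<in> borel_measurable borel"
    using T0_inv_cont T0_cont \<phi>0_cont by (auto intro: borel_measurable_continuous_onI)
  define c where "c y = T0_inv y \<bullet> y - \<phi>0 (T0_inv y)" for y
  have [measurable]: "c \<in> borel_measurable borel" unfolding c_def by measurable
  have int2: "integrable Q (\<lambda>y. norm y ^ 2)"
    using Q2 by (intro integrableI_nonneg) auto
  obtain K where K: "\<And>y. \<bar>c y\<bar> \<le> K * (1 + (norm y)\<^sup>2)" using quadratic_growth unfolding c_def by blast
  have intc: "integrable Q c"
  proof (rule Bochner_Integration.integrable_bound)
    show "integrable Q (\<lambda>y. K * (1 + (norm y)\<^sup>2))" using int2 by simp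
    show "AE y in Q. norm (c y) \<le> norm (K * (1 + (norm y)\<^sup>2))" using K by (intro AE_I2) (auto intro: order_trans[OF _ abs_ge_self])
  qed simp
  have int\<phi>: "integrable P \<phi>0" using sd by (simp add: solves_semi_dual_def)
  have obj0: "semi_dual_objective P Q \<phi>0 = ereal ((\<integral>x. \<phi>0 x \<partial>P) + (\<integral>y. c y \<partial>Q))"
    unfolding semi_dual_objective_def conjugate_eq using ereal_integral_real[OF intc] by (simp add: c_def)
  have eq: "(\<integral>x. h x \<partial>P) = (\<integral>x. h x \<partial>distr Q borel T0_inv)"
    if h01: "\<And>x. 0 \<le> h x \<and> h x \<le> (1::real)" and lip: "\<And>x y. \<bar>h x - h y\<bar> \<le> L * norm (x - y)" for h :: "'a \<Rightarrow> real" and L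
  proof -
    have "continuous_on UNIV h"
    proof (rule continuous_onI)
      fix x :: 'a and e :: real assume e: "e > 0"
      have "dist (h x') (h x) \<le> e" if "dist x' x < e / (\<bar>L\<bar> + 1)" for x'
      proof -
        have "L * norm (x' - x) \<le> (\<bar>L\<bar> + 1) * norm (x' - x)" by (intro mult_right_mono) auto
        also have "\<dots> \<le> e" using that by (simp add: dist_norm less_divide_eq mult.commute split: if_splits)
        finally show ?thesis using lip[of x' x] by (simp add: dist_norm)
      qed
      then show "\<exists>d>0. \<forall>x'\<in>UNIV. dist x' x < d \<longrightarrow> dist (h x') (h x) \<le> e"
        using e by (intro exI[of _ "e / (\<bar>L\<bar> + 1)"]) auto
    qed
    then have [measurable]: "h \<in> borel_measurable borel" by (rule borel_measurable_continuous_onI)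
    have inth: "integrable P h" by (rule P.integrable_const_bound[where B = 1]) (use h01 in auto)
    have inthS: "integrable Q (\<lambda>y. h (T0_inv y))" by (rule Q.integrable_const_bound[where B = 1]) (use h01 in auto)
    define \<delta> where "\<delta> = (\<integral>x. h x \<partial>P) - (\<integral>y. h (T0_inv y) \<partial>Q)"
    define B where "B = L\<^sup>2 / (2 * \<alpha>)"
    have B: "B \<ge> 0" using \<alpha> by (simp add: B_def)
    have key: "0 \<le> t * \<delta> + t\<^sup>2 * B" for t
    proof -
      have int\<psi>: "integrable P (\<lambda>x. \<phi>0 x + t * h x)" using int\<phi> inth by simp
      have intd: "integrable Q (\<lambda>y. c y - t * h (T0_inv y) + t\<^sup>2 * B)" using intc inthS by simp
      have "semi_dual_objective P Q \<phi>0 \<le> semi_dual_objective P Q (\<lambda>x. \<phi>0 x + t * h x)"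
        using sd int\<psi> by (simp add: solves_semi_dual_def)
      also have "\<dots> \<le> ereal (\<integral>x. \<phi>0 x + t * h x \<partial>P) + ereal_integral Q (\<lambda>y. ereal (c y - t * h (T0_inv y) + t\<^sup>2 * B))"
        unfolding semi_dual_objective_def c_def B_def
        using conjugate_perturbed[OF lip] by (intro add_left_mono ereal_integral_mono) simp
      also have "\<dots> = ereal ((\<integral>x. \<phi>0 x \<partial>P) + t * (\<integral>x. h x \<partial>P) + ((\<integral>y. c y \<partial>Q) - t * (\<integral>y. h (T0_inv y) \<partial>Q) + t\<^sup>2 * B))"
        unfolding ereal_integral_real[OF intd] using int\<phi> inth intc inthS by (simp add: Q.prob_space)
      finally show ?thesis unfolding obj0 \<delta>_def by (simp add: algebra_simps)
    qed
    have "\<delta> = 0"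
    proof (rule ccontr)
      assume "\<delta> \<noteq> 0"
      then have "\<delta>\<^sup>2 > 0" by simp
      \<comment> \<open>The value $t = -\delta u$ would make the objective smaller than at $t = 0$.\<close>
      define u where "u = 1 / (B + 1)"
      have u: "u > 0" "u * B = 1 - u" using B by (auto simp: u_def field_simps)
      have "0 \<le> (- \<delta> * u) * \<delta> + (- \<delta> * u)\<^sup>2 * B" by (rule key)
      also have "\<dots> = - (\<delta>\<^sup>2 * u) + \<delta>\<^sup>2 * u * (u * B)"
        by (simp add: power2_eq_square algebra_simps)
      also have "\<dots> = - (\<delta>\<^sup>2 * (u * u))" unfolding u(2) by (simp add: algebra_simps)
      also have "\<dots> < 0" using \<open>\<delta>\<^sup>2 > 0\<close> u(1) by simp
      finally show False by simp
    qed
    then show ?thesis unfolding \<delta>_def by (simp add: integral_distr)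
  qed
  have "borel_prob (distr Q borel T0_inv)"
    unfolding borel_prob_def by (auto intro: Q.prob_space_distr)
  then have "P = distr Q borel T0_inv" by (rule measure_eq_lipschitzI[OF P]) (rule eq)
  then have "distr P borel T0 = distr (distr Q borel T0_inv) borel T0" by simp
  also have "\<dots> = distr Q borel (T0 \<circ> T0_inv)" by (rule distr_distr) auto
  also have "T0 \<circ> T0_inv = (\<lambda>x. x)" by (auto simp: fun_eq_iff)
  also have "distr Q borel (\<lambda>x. x) = Q" using sQ by (intro distr_id2) simp
  finally show ?thesis .
qed

end

section \<open>The mass of Voronoi cells\<close>

text \<open>
Directions within distance $1/2$ of $w$, so that two directions in the cone make an angle of less
than 60 degrees.
\<close>

definition narrow_cone :: "'a::euclidean_space \<Rightarrow> 'a set" where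
  "narrow_cone w = {v. v \<noteq> 0 \<and> norm (v /\<^sub>R norm v - w) < 1 / 2}"

lemma finite_cone_cover:
  obtains W :: "'a::euclidean_space set" where "finite W" "\<And>v. v \<noteq> 0 \<Longrightarrow> \<exists>w\<in>W. v \<in> narrow_cone w"
proof -
  have "compact (sphere (0::'a) 1)" by simp
  then obtain W where W: "finite W" "sphere (0::'a) 1 \<subseteq> (\<Union>x\<in>W. ball x (1 / 2))"
    unfolding compact_eq_totally_bounded by (meson half_gt_zero zero_less_one)
  have "\<exists>w\<in>W. v \<in> narrow_cone w" if "v \<noteq> 0" for v
  proof -
    have "v /\<^sub>R norm v \<in> sphere 0 1" using that by simp
    then obtain w where "w \<in> W" "v /\<^sub>R norm v \<in> ball w (1 / 2)" using W(2) by blast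
    then show ?thesis using that by (auto simp: narrow_cone_def dist_norm norm_minus_commute)
  qed
  with W(1) show ?thesis by (rule that)
qed

text \<open>
The angle between $u$ and $v$ is less than 60 degrees, hence $2 \langle u, v\rangle > |u|\,|v| \ge |u|^2$.
\<close>

lemma cone_closer:
  assumes u: "u \<in> narrow_cone w" and v: "v \<in> narrow_cone w" and uv: "norm u \<le> norm v"
  shows "norm (v - u) < norm v"
proof -
  have n: "norm u > 0" "norm v > 0" using u v by (auto simp: narrow_cone_def)
  define a where "a = u /\<^sub>R norm u" define b where "b = v /\<^sub>R norm v"
  have ab: "a \<bullet> a = 1" "b \<bullet> b = 1"
    using n by (simp_all add: a_def b_def dot_square_norm power2_eq_square)
  have "norm (a - b) \<le> norm (a - w) + norm (b - w)"
    using norm_triangle_ineq4[of "a - w" "b - w"] by simp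
  also have "\<dots> < 1" using u v by (simp add: a_def b_def narrow_cone_def)
  finally have "(norm (a - b))\<^sup>2 < 1" using power_strict_mono[of "norm (a - b)" 1 2] by simp
  then have "1 / 2 < a \<bullet> b"
    by (simp add: power2_norm_eq_inner inner_diff_left inner_diff_right ab inner_commute)
  moreover have "u \<bullet> v = norm u * norm v * (a \<bullet> b)"
  proof -
    have "norm u *\<^sub>R a = u" "norm v *\<^sub>R b = v" using n by (simp_all add: a_def b_def)
    then have "u \<bullet> v = (norm u *\<^sub>R a) \<bullet> (norm v *\<^sub>R b)" by simp
    then show ?thesis by simp
  qed
  ultimately have "norm u * norm v * (1 / 2) < u \<bullet> v" using n by (simp only: mult_less_cancel_left_pos mult_pos_pos)
  then have "norm u * norm v < 2 * (u \<bullet> v)" by simp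
  moreover have "norm u * norm u \<le> norm u * norm v" using uv by (intro mult_left_mono) auto
  moreover have "(norm (v - u))\<^sup>2 = (norm v)\<^sup>2 + norm u * norm u - 2 * (u \<bullet> v)"
    by (simp add: power2_norm_eq_inner inner_diff_left inner_diff_right inner_commute
        power2_eq_square[of "norm u", symmetric])
  ultimately have "(norm (v - u))\<^sup>2 < (norm v)\<^sup>2" by linarith
  then show ?thesis by (rule power2_less_imp_less) simp
qed

lemma cone_borel: "narrow_cone w \<in> sets borel"
proof -
  have "narrow_cone w = {v. v \<noteq> 0} \<inter> {v. norm (v /\<^sub>R norm v - w) < 1 / 2}" by (auto simp: narrow_cone_def)
  also have "\<dots> \<in> sets borel"
  proof (rule sets.Int)
    show "{v. norm (v /\<^sub>R norm v - w) < 1 / 2} \<in> sets borel" by measurable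
  qed simp
  finally show ?thesis .
qed

text \<open>
The quantile of order $s$ of the distance to $z$, for $P$ restricted to $K$: continuity of the measure from above
and from below at the infimum of the radii whose closed ball carries mass at least $s$.
\<close>

lemma radial_quantile:
  fixes P :: "'a::euclidean_space measure"
  assumes P: "borel_prob P" and K: "K \<in> sets borel" and s: "0 < s" "s < measure P K"
  obtains \<rho> where "s \<le> measure P (K \<inter> cball z \<rho>)" "measure P (K \<inter> ball z \<rho>) \<le> s"
proof -
  interpret prob_space P using P by (simp add: borel_prob_def)
  have sP: "sets P = sets borel" using P by (simp add: borel_prob_def)
  define G where "G \<rho> = measure P (K \<inter> cball z \<rho>)" for \<rho>
  have mono: "G \<rho> \<le> G \<sigma>" if "\<rho> \<le> \<sigma>" for \<rho> \<sigma>
    unfolding G_def using that K by (intro finite_measure_mono) (auto simp: sP)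
  have "(\<lambda>n. G (real n)) \<longlonglongrightarrow> measure P (\<Union>n. K \<inter> cball z (real n))"
    unfolding G_def using K by (intro finite_Lim_measure_incseq) (auto simp: sP incseq_def)
  also have "(\<Union>n. K \<inter> cball z (real n)) = K"
    using real_arch_simple[of "dist z _"] by auto
  finally have "eventually (\<lambda>n. s < G (real n)) sequentially"
    by (rule order_tendstoD(1)[OF _ s(2)])
  then obtain N where N: "s < G (real N)" by (auto simp: eventually_sequentially)
  define S where "S = {\<rho>. s \<le> G \<rho>}"
  have neg: "\<rho> \<notin> S" if "\<rho> < 0" for \<rho> using that s by (simp add: S_def G_def)
  have "real N \<in> S" using N by (simp add: S_def)
  then have S: "S \<noteq> {}" by blast
  have Sb: "bdd_below S" using neg by (intro bdd_belowI[of _ 0]) (metis not_le)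
  have inv: "inverse (real (Suc n)) \<le> inverse (real (Suc m))" if "m \<le> n" for m n :: nat
    using that by (intro le_imp_inverse_le) auto
  define \<rho> where "\<rho> = Inf S"
  have above: "s \<le> G \<sigma>" if lt: "\<rho> < \<sigma>" for \<sigma>
  proof -
    obtain x where "x \<in> S" "x < \<sigma>" using lt cInf_lessD[OF S] unfolding \<rho>_def by blast
    then show ?thesis using mono[of x \<sigma>] by (simp add: S_def)
  qed
  have below: "G \<sigma> < s" if "\<sigma> < \<rho>" for \<sigma>
    using that Sb cInf_lower[of \<sigma> S] unfolding \<rho>_def by (auto simp: S_def not_le[symmetric])
  have "(\<lambda>n. G (\<rho> + inverse (real (Suc n)))) \<longlonglongrightarrow> measure P (\<Inter>n. K \<inter> cball z (\<rho> + inverse (real (Suc n))))"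
    unfolding G_def using K
  proof (intro finite_Lim_measure_decseq)
    show "decseq (\<lambda>n. K \<inter> cball z (\<rho> + inverse (real (Suc n))))"
      unfolding decseq_def
    proof (intro allI impI subsetI)
      fix m n x assume "m \<le> n" "x \<in> K \<inter> cball z (\<rho> + inverse (real (Suc n)))"
      then have "x \<in> K" "dist z x \<le> \<rho> + inverse (real (Suc n))" "inverse (real (Suc n)) \<le> inverse (real (Suc m))"
        by (simp_all only: inv Int_iff mem_cball)
      then have "dist z x \<le> \<rho> + inverse (real (Suc m))" by linarith
      with \<open>x \<in> K\<close> show "x \<in> K \<inter> cball z (\<rho> + inverse (real (Suc m)))" by (simp only: Int_iff mem_cball)
    qed
  qed (auto simp: sP)
  also have "(\<Inter>n. K \<inter> cball z (\<rho> + inverse (real (Suc n)))) = K \<inter> cball z \<rho>"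
  proof (intro equalityI subsetI)
    fix x assume x: "x \<in> (\<Inter>n. K \<inter> cball z (\<rho> + inverse (real (Suc n))))"
    have "dist z x \<le> \<rho> + 0"
      by (rule LIMSEQ_le_const[OF tendsto_add[OF tendsto_const LIMSEQ_inverse_real_of_nat]])
        (use x in \<open>auto simp del: of_nat_Suc\<close>)
    then show "x \<in> K \<inter> cball z \<rho>" using x by auto
  qed (auto intro: order_trans)
  finally have 1: "s \<le> measure P (K \<inter> cball z \<rho>)"
    by (rule LIMSEQ_le_const) (use above in auto)
  have "(\<lambda>n. G (\<rho> - inverse (real (Suc n)))) \<longlonglongrightarrow> measure P (\<Union>n. K \<inter> cball z (\<rho> - inverse (real (Suc n))))"
    unfolding G_def using K
  proof (intro finite_Lim_measure_incseq)
    show "incseq (\<lambda>n. K \<inter> cball z (\<rho> - inverse (real (Suc n))))"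
      unfolding incseq_def
    proof (intro allI impI subsetI)
      fix m n x assume "m \<le> n" "x \<in> K \<inter> cball z (\<rho> - inverse (real (Suc m)))"
      then have "x \<in> K" "dist z x \<le> \<rho> - inverse (real (Suc m))" "inverse (real (Suc n)) \<le> inverse (real (Suc m))"
        by (simp_all only: inv Int_iff mem_cball)
      then have "dist z x \<le> \<rho> - inverse (real (Suc n))" by linarith
      with \<open>x \<in> K\<close> show "x \<in> K \<inter> cball z (\<rho> - inverse (real (Suc n)))" by (simp only: Int_iff mem_cball)
    qed
  qed (auto simp: sP)
  also have "(\<Union>n. K \<inter> cball z (\<rho> - inverse (real (Suc n)))) = K \<inter> ball z \<rho>"
  proof (intro equalityI subsetI)
    fix x assume x: "x \<in> K \<inter> ball z \<rho>"
    then obtain n where "inverse (real (Suc n)) < \<rho> - dist z x" using reals_Archimedean[of "\<rho> - dist z x"] by auto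
    then have "x \<in> K \<inter> cball z (\<rho> - inverse (real (Suc n)))" using x by auto
    then show "x \<in> (\<Union>n. K \<inter> cball z (\<rho> - inverse (real (Suc n))))" by blast
  next
    fix x assume "x \<in> (\<Union>n. K \<inter> cball z (\<rho> - inverse (real (Suc n))))"
    then obtain n where "x \<in> K" "dist z x \<le> \<rho> - inverse (real (Suc n))" by auto
    moreover have "0 < inverse (real (Suc n))" by simp
    ultimately have "dist z x < \<rho>" by linarith
    with \<open>x \<in> K\<close> show "x \<in> K \<inter> ball z \<rho>" by simp
  qed
  finally have 2: "measure P (K \<inter> ball z \<rho>) \<le> s"
    by (rule LIMSEQ_le_const2) (use below in \<open>auto intro!: less_imp_le\<close>)
  from 1 2 show ?thesis by (rule that)
qed

text \<open>
If a sample point lies in the cone at distance at most $\rho$, then no point of the cone at distance $\rho$ or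
more belongs to the cell, because it is closer to that sample point.  So each cone contributes
at most $s$; the centre itself carries no mass.
\<close>

lemma voronoi_cell_mass:
  fixes P :: "'a::euclidean_space measure" and s :: real
  assumes P: "borel_prob P" and W: "finite W" "\<And>v. v \<noteq> 0 \<Longrightarrow> \<exists>w\<in>W. v \<in> narrow_cone w"
    and z: "measure P {X i} = 0" and V: "V \<in> sets borel" "V \<subseteq> voronoi n X i"
    and s: "s > 0"
    and hit: "\<And>w. w \<in> W \<Longrightarrow> s < measure P {x. x - X i \<in> narrow_cone w} \<Longrightarrow>
       measure P ({x. x - X i \<in> narrow_cone w} \<inter> ball (X i) (\<rho> w)) \<le> s \<and>
       (\<exists>l<n. l \<noteq> i \<and> X l \<in> {x. x - X i \<in> narrow_cone w} \<inter> cball (X i) (\<rho> w))"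
  shows "measure P V \<le> card W * s"
proof -
  interpret prob_space P using P by (simp add: borel_prob_def)
  have sP: "sets P = sets borel" using P by (simp add: borel_prob_def)
  let ?K = "\<lambda>w. {x. x - X i \<in> narrow_cone w}"
  have Ks: "?K w \<in> sets borel" for w
  proof -
    have "(\<lambda>x. x - X i) -` narrow_cone w \<inter> space borel \<in> sets borel"
      by (rule measurable_sets[OF _ cone_borel]) measurable
    then show ?thesis by (simp add: vimage_def)
  qed
  have part: "measure P (V \<inter> ?K w) \<le> s" if w: "w \<in> W" for w
  proof (cases "s < measure P (?K w)")
    case False
    have "measure P (V \<inter> ?K w) \<le> measure P (?K w)"
      using Ks by (intro finite_measure_mono) (auto simp: sP)
    with False show ?thesis by simp
  next
    case True
    obtain l where l: "l < n" "l \<noteq> i" "X l - X i \<in> narrow_cone w" "dist (X i) (X l) \<le> \<rho> w"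
      and small: "measure P (?K w \<inter> ball (X i) (\<rho> w)) \<le> s"
      using hit[OF w True] by auto
    have "V \<inter> ?K w \<subseteq> ?K w \<inter> ball (X i) (\<rho> w)"
    proof
      fix x assume x: "x \<in> V \<inter> ?K w"
      have "dist (X i) x < \<rho> w"
      proof (rule ccontr)
        assume "\<not> ?thesis"
        then have "norm (X l - X i) \<le> norm (x - X i)" using l by (simp add: dist_norm norm_minus_commute)
        from cone_closer[OF l(3) _ this] x have "norm (x - X l) < norm (x - X i)" by simp
        moreover have "norm (x - X i) \<le> norm (x - X l)" using x V(2) l by (auto simp: voronoi_def)
        ultimately show False by simp
      qed
      then show "x \<in> ?K w \<inter> ball (X i) (\<rho> w)" using x by simp
    qed
    then have "measure P (V \<inter> ?K w) \<le> measure P (?K w \<inter> ball (X i) (\<rho> w))"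
      using Ks by (intro finite_measure_mono) (auto simp: sP)
    with small show ?thesis by simp
  qed
  have "V \<subseteq> {X i} \<union> (\<Union>w\<in>W. V \<inter> ?K w)"
  proof
    fix x assume "x \<in> V"
    then show "x \<in> {X i} \<union> (\<Union>w\<in>W. V \<inter> ?K w)" using W(2)[of "x - X i"] by (cases "x = X i") auto
  qed
  then have "measure P V \<le> measure P ({X i} \<union> (\<Union>w\<in>W. V \<inter> ?K w))"
    using Ks V W(1) by (intro finite_measure_mono) (auto simp: sP)
  also have "\<dots> \<le> measure P {X i} + measure P (\<Union>w\<in>W. V \<inter> ?K w)"
    using Ks V W(1) by (intro measure_Un_le) (auto simp: sP)
  also have "measure P (\<Union>w\<in>W. V \<inter> ?K w) \<le> (\<Sum>w\<in>W. measure P (V \<inter> ?K w))"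
    using Ks V W(1) by (intro finite_measure_subadditive_finite) (auto simp: sP)
  also have "\<dots> \<le> (\<Sum>w\<in>W. s)" by (intro sum_mono part)
  finally show ?thesis using z by simp
qed

lemma box_miss_prob:
  fixes P :: "'a::euclidean_space measure"
  assumes P: "borel_prob P" and I: "finite I" and A: "A \<in> sets borel" and s: "s \<le> measure P A"
  shows "emeasure (\<Pi>\<^sub>M i\<in>I. P) (\<Pi>\<^sub>E i\<in>I. - A) \<le> ennreal (exp (- s) ^ card I)"
proof -
  interpret P: prob_space P using P by (simp add: borel_prob_def)
  interpret product_sigma_finite "\<lambda>_. P" ..
  have sP: "sets P = sets borel" using P by (simp add: borel_prob_def)
  then have spP: "space P = UNIV" by (metis sets_eq_imp_space_eq space_borel)
  have "emeasure (\<Pi>\<^sub>M i\<in>I. P) (\<Pi>\<^sub>E i\<in>I. - A) = (\<Prod>i\<in>I. emeasure P (- A))"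
    using I A by (intro emeasure_PiM) (auto simp: sP)
  also have "emeasure P (- A) = ennreal (1 - measure P A)"
    using P.prob_compl[of A] A by (simp add: sP spP P.emeasure_eq_measure Compl_eq_Diff_UNIV)
  also have "(\<Prod>i\<in>I. ennreal (1 - measure P A)) = ennreal ((1 - measure P A) ^ card I)"
    by (simp add: ennreal_power)
  also have "\<dots> \<le> ennreal (exp (- s) ^ card I)"
  proof (intro ennreal_leI power_mono)
    have "1 - measure P A \<le> exp (- measure P A)" using exp_ge_add_one_self[of "- measure P A"] by simp
    also have "\<dots> \<le> exp (- s)" using s by simp
    finally show "1 - measure P A \<le> exp (- s)" .
  qed simp
  finally show ?thesis .
qed

lemma tie_breaking_cell:
  assumes "tie_breaking n k"
  shows "X \<in> space (sample_space n) \<Longrightarrow> {x. k X x = i} \<in> sets borel"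
    and "X \<in> space (sample_space n) \<Longrightarrow> {x. k X x = i} \<subseteq> voronoi n X i"
    and "{(X, x). X \<in> space (sample_space n) \<and> k X x = i} \<in> sets (sample_space n \<Otimes>\<^sub>M borel)"
proof -
  have m: "(\<lambda>(X, x). k X x) \<in> measurable (sample_space n \<Otimes>\<^sub>M borel) (count_space UNIV)"
    using assms by (simp add: tie_breaking_def)
  show "{x. k X x = i} \<subseteq> voronoi n X i" if "X \<in> space (sample_space n)"
    using assms that by (auto simp: tie_breaking_def)
  have "(\<lambda>(X, x). k X x) -` {i} \<inter> space (sample_space n \<Otimes>\<^sub>M borel) \<in> sets (sample_space n \<Otimes>\<^sub>M borel)"
    by (rule measurable_sets[OF m]) simp
  moreover have "(\<lambda>(X, x). k X x) -` {i} \<inter> space (sample_space n \<Otimes>\<^sub>M borel)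
      = {(X, x). X \<in> space (sample_space n) \<and> k X x = i}"
    by (auto simp: space_pair_measure)
  ultimately show G: "{(X, x). X \<in> space (sample_space n) \<and> k X x = i} \<in> sets (sample_space n \<Otimes>\<^sub>M borel)"
    by simp
  show "{x. k X x = i} \<in> sets borel" if "X \<in> space (sample_space n)"
    using sets_Pair1[OF G, of X] that by (simp add: vimage_def)
qed

lemma nonatomic_singleton:
  assumes "borel_prob P" "nonatomic P"
  shows "measure P {z} = 0"
proof (rule ccontr)
  interpret prob_space P using assms by (simp add: borel_prob_def)
  assume "measure P {z} \<noteq> 0"
  then have "emeasure P {z} > 0" by (simp add: emeasure_eq_measure zero_less_iff_neq_zero)
  moreover have "{z} \<in> sets P" using assms by (simp add: borel_prob_def)
  ultimately obtain B where "B \<subseteq> {z}" "emeasure P B \<noteq> 0" "emeasure P ({z} - B) \<noteq> 0"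
    using assms unfolding nonatomic_def by blast
  then show False by (auto simp: subset_singleton_iff)
qed

text \<open>
Condition on $X_i = z$.  The sets to be hit by the other $n - 1$ sample points then no longer depend on the
sample; each of them has mass at least $s$ and is missed with probability at most $e^{-s(n-1)}$.
\<close>

lemma max_voronoi_mass:
  fixes P :: "'a::euclidean_space measure" and s :: real
  assumes P: "borel_prob P" "nonatomic P" and W: "finite W" "\<And>v::'a. v \<noteq> 0 \<Longrightarrow> \<exists>w\<in>W. v \<in> narrow_cone w"
    and k: "tie_breaking n k" and s: "s > 0"
  defines "Bad \<equiv> {X \<in> space (\<Pi>\<^sub>M i\<in>{..<n}. P). \<exists>i<n. card W * s < measure P {x. k X x = i}}"
  shows "Bad \<in> sets (\<Pi>\<^sub>M i\<in>{..<n}. P)"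
    "emeasure (\<Pi>\<^sub>M i\<in>{..<n}. P) Bad \<le> ennreal (real n * real (card W) * exp (- s) ^ (n - 1))"
proof -
  interpret P: prob_space P using P by (simp add: borel_prob_def)
  interpret product_sigma_finite "\<lambda>_. P" ..
  have sP: "sets P = sets borel" using P by (simp add: borel_prob_def)
  then have spP: "space P = UNIV" by (metis sets_eq_imp_space_eq space_borel)
  have sPi: "sets (\<Pi>\<^sub>M i\<in>I. P) = sets (\<Pi>\<^sub>M i\<in>I. borel)" for I :: "nat set"
    by (intro sets_PiM_cong) (auto simp: sP)
  have spPi: "space (\<Pi>\<^sub>M i\<in>I. P) = space (\<Pi>\<^sub>M i\<in>I. borel)" for I :: "nat set"
    by (rule sets_eq_imp_space_eq[OF sPi])
  let ?M = "\<Pi>\<^sub>M i\<in>{..<n}. P"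
  define B where "B i = {X \<in> space ?M. card W * s < measure P {x. k X x = i}}" for i
  have Bs: "B i \<in> sets ?M" for i
  proof -
    have "(\<lambda>X. emeasure P (Pair X -` {(X, x). X \<in> space (sample_space n) \<and> k X x = i})) \<in> borel_measurable ?M"
      using tie_breaking_cell(3)[OF k] by (intro P.measurable_emeasure_Pair) (simp add: sets_pair_measure_cong[OF sPi sP])
    then have "(\<lambda>X. measure P {x. k X x = i}) \<in> borel_measurable ?M"
      unfolding measure_def by (subst measurable_cong[where g = "\<lambda>X. enn2real (emeasure P (Pair X -` {(X, x). X \<in> space (sample_space n) \<and> k X x = i}))"])
        (auto simp: spPi vimage_def)
    then show ?thesis unfolding B_def by measurable
  qed
  have Bad: "Bad = (\<Union>i<n. B i)" by (auto simp: Bad_def B_def)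
  show "Bad \<in> sets ?M" unfolding Bad using Bs by auto
  have Bi: "emeasure ?M (B i) \<le> ennreal (real (card W) * exp (- s) ^ (n - 1))" if i: "i < n" for i
  proof -
    let ?I = "{..<n} - {i}"
    have ins: "insert i ?I = {..<n}" using i by auto
    have "emeasure ?M (B i) = (\<integral>\<^sup>+X. indicator (B i) X \<partial>(\<Pi>\<^sub>M i\<in>insert i ?I. P))"
      unfolding ins using Bs by simp
    also have "\<dots> = (\<integral>\<^sup>+z. (\<integral>\<^sup>+X. indicator (B i) (X(i := z)) \<partial>(\<Pi>\<^sub>M i\<in>?I. P)) \<partial>P)"
      using Bs[of i] ins by (intro product_nn_integral_insert_rev) auto
    also have "\<dots> \<le> (\<integral>\<^sup>+z. ennreal (real (card W) * exp (- s) ^ (n - 1)) \<partial>P)"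
    proof (rule nn_integral_mono)
      fix z :: 'a
      let ?K = "\<lambda>w. {x. x - z \<in> narrow_cone w}"
      have Ks: "?K w \<in> sets borel" for w
      proof -
        have "(\<lambda>x. x - z) -` narrow_cone w \<inter> space borel \<in> sets borel"
          by (rule measurable_sets[OF _ cone_borel]) measurable
        then show ?thesis by (simp add: vimage_def)
      qed
      \<comment> \<open>Only cones of mass more than \<open>s\<close> have to be hit; the others contribute at most \<open>s\<close> anyway.\<close>
      define W' where "W' = {w \<in> W. s < measure P (?K w)}"
      have "\<exists>\<rho>. s \<le> measure P (?K w \<inter> cball z \<rho>) \<and> measure P (?K w \<inter> ball z \<rho>) \<le> s" if "w \<in> W'" for w
        by (rule radial_quantile[OF P(1) Ks s]) (use that in \<open>auto simp: W'_def\<close>)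
      then obtain \<rho> where \<rho>: "\<And>w. w \<in> W' \<Longrightarrow> s \<le> measure P (?K w \<inter> cball z (\<rho> w)) \<and> measure P (?K w \<inter> ball z (\<rho> w)) \<le> s"
        by metis
      let ?A = "\<lambda>w. ?K w \<inter> cball z (\<rho> w)"
      have As: "?A w \<in> sets borel" for w using Ks by auto
      have box: "(\<Pi>\<^sub>E l\<in>?I. - ?A w) \<in> sets (\<Pi>\<^sub>M i\<in>?I. P)" for w
        using borel_comp[OF As[of w]] by (intro sets_PiM_I_finite) (simp_all only: sP finite_Diff finite_lessThan)
      have cover: "indicator (B i) (X(i := z)) \<le> (\<Sum>w\<in>W'. indicator (\<Pi>\<^sub>E l\<in>?I. - ?A w) X :: ennreal)"
        if X: "X \<in> space (\<Pi>\<^sub>M i\<in>?I. P)" for X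
      proof (cases "\<exists>w\<in>W'. X \<in> (\<Pi>\<^sub>E l\<in>?I. - ?A w)")
        case True
        then obtain w where w: "w \<in> W'" "X \<in> (\<Pi>\<^sub>E l\<in>?I. - ?A w)" by blast
        have "indicator (B i) (X(i := z)) \<le> (indicator (\<Pi>\<^sub>E l\<in>?I. - ?A w) X :: ennreal)"
          using w by (simp add: indicator_def)
        also have "\<dots> \<le> (\<Sum>w\<in>W'. indicator (\<Pi>\<^sub>E l\<in>?I. - ?A w) X)"
          using w W(1) by (intro member_le_sum) (auto simp: W'_def)
        finally show ?thesis .
      next
        case False
        have Xext: "X \<in> extensional ?I" using X by (auto simp: space_PiM PiE_def)
        have hit: "\<exists>l<n. l \<noteq> i \<and> X l \<in> ?A w" if "w \<in> W'" for w
        proof (rule ccontr)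
          assume "\<not> (\<exists>l<n. l \<noteq> i \<and> X l \<in> ?A w)"
          then have "X \<in> (\<Pi>\<^sub>E l\<in>?I. - ?A w)" using Xext by (auto simp: PiE_def)
          with False that show False by blast
        qed
        let ?X = "X(i := z)"
        have "X(i := z) \<in> space ?M" using X i by (auto simp: space_PiM PiE_def extensional_def spP)
        then have spX: "?X \<in> space (sample_space n)" by (simp add: spPi)
        have "measure P {x. k ?X x = i} \<le> card W * s"
        proof (rule voronoi_cell_mass[OF P(1) W, where X = ?X and i = i and n = n and \<rho> = \<rho>])
          show "measure P {?X i} = 0" by (rule nonatomic_singleton[OF P])
          show "{x. k ?X x = i} \<in> sets borel" by (rule tie_breaking_cell(1)[OF k spX])
          show "{x. k ?X x = i} \<subseteq> voronoi n ?X i" by (rule tie_breaking_cell(2)[OF k spX])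
          fix w assume "w \<in> W" "s < measure P {x. x - ?X i \<in> narrow_cone w}"
          then have w: "w \<in> W'" by (simp add: W'_def)
          obtain l where "l < n" "l \<noteq> i" "X l \<in> ?A w" using hit[OF w] by blast
          then show "measure P ({x. x - ?X i \<in> narrow_cone w} \<inter> ball (?X i) (\<rho> w)) \<le> s \<and>
            (\<exists>l<n. l \<noteq> i \<and> ?X l \<in> {x. x - ?X i \<in> narrow_cone w} \<inter> cball (?X i) (\<rho> w))"
            using \<rho>[OF w] by auto
        qed (use s in auto)
        then have "?X \<notin> B i" by (auto simp: B_def)
        then show ?thesis by simp
      qed
      have "(\<integral>\<^sup>+X. indicator (B i) (X(i := z)) \<partial>(\<Pi>\<^sub>M i\<in>?I. P))
          \<le> (\<integral>\<^sup>+X. (\<Sum>w\<in>W'. indicator (\<Pi>\<^sub>E l\<in>?I. - ?A w) X) \<partial>(\<Pi>\<^sub>M i\<in>?I. P))"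
        by (rule nn_integral_mono) (rule cover)
      also have "\<dots> = (\<Sum>w\<in>W'. emeasure (\<Pi>\<^sub>M i\<in>?I. P) (\<Pi>\<^sub>E l\<in>?I. - ?A w))"
        using box by (subst nn_integral_sum) auto
      also have "\<dots> \<le> (\<Sum>w\<in>W'. ennreal (exp (- s) ^ card ?I))"
        using \<rho> As by (intro sum_mono box_miss_prob[OF P(1)]) auto
      also have "\<dots> = ennreal (real (card W') * exp (- s) ^ (n - 1))"
        using i by (simp add: ennreal_of_nat_eq_real_of_nat ennreal_mult)
      also have "\<dots> \<le> ennreal (real (card W) * exp (- s) ^ (n - 1))"
        using W(1) by (intro ennreal_leI mult_right_mono) (auto simp: W'_def intro!: card_mono)
      finally show "(\<integral>\<^sup>+X. indicator (B i) (X(i := z)) \<partial>(\<Pi>\<^sub>M i\<in>?I. P)) \<le> \<dots>" .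
    qed
    also have "\<dots> = ennreal (real (card W) * exp (- s) ^ (n - 1))"
      by (simp add: P.emeasure_space_1)
    finally show ?thesis .
  qed
  have "emeasure ?M Bad \<le> (\<Sum>i<n. emeasure ?M (B i))"
    unfolding Bad using Bs by (intro emeasure_subadditive_finite) auto
  also have "\<dots> \<le> (\<Sum>i<n. ennreal (real (card W) * exp (- s) ^ (n - 1)))"
    using Bi by (intro sum_mono) auto
  also have "\<dots> = ennreal (real n * real (card W) * exp (- s) ^ (n - 1))"
    by (simp add: ennreal_of_nat_eq_real_of_nat ennreal_mult mult.assoc)
  finally show "emeasure ?M Bad \<le> \<dots>" .
qed

section \<open>Barycentres, samples and nearest neighbours\<close>

lemma norm_convex_combination_sq:
  fixes v :: "'j \<Rightarrow> 'a::real_inner"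
  assumes c: "\<And>j. j \<in> J \<Longrightarrow> 0 \<le> c j" "sum c J = 1"
  shows "(norm (\<Sum>j\<in>J. c j *\<^sub>R v j))\<^sup>2 \<le> (\<Sum>j\<in>J. c j * (norm (v j))\<^sup>2)"
proof -
  have "norm (\<Sum>j\<in>J. c j *\<^sub>R v j) \<le> (\<Sum>j\<in>J. norm (c j *\<^sub>R v j))" by (rule norm_sum)
  also have "\<dots> = (\<Sum>j\<in>J. sqrt (c j) * (sqrt (c j) * norm (v j)))"
    using c(1) by (intro sum.cong) (auto simp: mult.assoc[symmetric])
  finally have "(norm (\<Sum>j\<in>J. c j *\<^sub>R v j))\<^sup>2 \<le> (\<Sum>j\<in>J. sqrt (c j) * (sqrt (c j) * norm (v j)))\<^sup>2"
    by (rule power_mono) simp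
  also have "\<dots> \<le> (\<Sum>j\<in>J. (sqrt (c j))\<^sup>2) * (\<Sum>j\<in>J. (sqrt (c j) * norm (v j))\<^sup>2)"
    by (rule Cauchy_Schwarz_ineq_sum)
  also have "\<dots> = (\<Sum>j\<in>J. c j) * (\<Sum>j\<in>J. c j * (norm (v j))\<^sup>2)"
    using c(1) by (intro arg_cong2[where f = "(*)"] sum.cong) (auto simp: power_mult_distrib)
  finally show ?thesis using c(2) by simp
qed

lemma norm_convex_combination_4:
  fixes v :: "'j \<Rightarrow> 'a::real_inner"
  assumes c: "\<And>j. j \<in> J \<Longrightarrow> 0 \<le> c j" "sum c J = 1"
  shows "norm (\<Sum>j\<in>J. c j *\<^sub>R v j) ^ 4 \<le> (\<Sum>j\<in>J. c j * norm (v j) ^ 4)"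
proof -
  have "norm (\<Sum>j\<in>J. c j *\<^sub>R v j) ^ 4 = ((norm (\<Sum>j\<in>J. c j *\<^sub>R v j))\<^sup>2)\<^sup>2" by simp
  also have "\<dots> \<le> (\<Sum>j\<in>J. c j * (norm (v j))\<^sup>2)\<^sup>2"
    by (intro power_mono norm_convex_combination_sq c) auto
  also have "\<dots> = (norm (\<Sum>j\<in>J. c j *\<^sub>R (norm (v j))\<^sup>2))\<^sup>2" by simp
  also have "\<dots> \<le> (\<Sum>j\<in>J. c j * (norm ((norm (v j))\<^sup>2))\<^sup>2)"
    by (intro norm_convex_combination_sq c) auto
  finally show ?thesis by simp
qed

text \<open>
A crude bound, which enters the risk only with the small factor $n^{-3}$.
\<close>

lemma sum_norm_diff_sq_sq_le:
  fixes a b :: "nat \<Rightarrow> 'a::real_inner"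
  shows "(\<Sum>i<n. (norm (a i - b i))\<^sup>2)\<^sup>2 \<le> 8 * real n * ((\<Sum>i<n. norm (a i) ^ 4) + (\<Sum>i<n. norm (b i) ^ 4))"
proof -
  have sq: "(x + y)\<^sup>2 \<le> 2 * x\<^sup>2 + 2 * y\<^sup>2" for x y :: real
    using zero_le_power2[of "x - y"] unfolding power2_sum power2_diff by linarith
  have "(\<Sum>i<n. 1 * (norm (a i - b i))\<^sup>2)\<^sup>2 \<le> (\<Sum>i<n. 1\<^sup>2) * (\<Sum>i<n. ((norm (a i - b i))\<^sup>2)\<^sup>2)"
    by (rule Cauchy_Schwarz_ineq_sum)
  also have "\<dots> \<le> real n * (\<Sum>i<n. 8 * norm (a i) ^ 4 + 8 * norm (b i) ^ 4)"
  proof -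
    have "((norm (a i - b i))\<^sup>2)\<^sup>2 \<le> 8 * norm (a i) ^ 4 + 8 * norm (b i) ^ 4" for i
    proof -
      have "(norm (a i - b i))\<^sup>2 \<le> (norm (a i) + norm (b i))\<^sup>2"
        by (intro power_mono norm_triangle_ineq4) simp
      also have "\<dots> \<le> 2 * (norm (a i))\<^sup>2 + 2 * (norm (b i))\<^sup>2" by (rule sq)
      finally have "((norm (a i - b i))\<^sup>2)\<^sup>2 \<le> (2 * (norm (a i))\<^sup>2 + 2 * (norm (b i))\<^sup>2)\<^sup>2" by (rule power_mono) simp
      also have "\<dots> \<le> 2 * (2 * (norm (a i))\<^sup>2)\<^sup>2 + 2 * (2 * (norm (b i))\<^sup>2)\<^sup>2" by (rule sq)
      finally show ?thesis by (simp add: power_mult_distrib)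
    qed
    then show ?thesis by (auto intro!: mult_left_mono sum_mono)
  qed
  also have "\<dots> = 8 * real n * ((\<Sum>i<n. norm (a i) ^ 4) + (\<Sum>i<n. norm (b i) ^ 4))"
    by (simp add: sum.distrib sum_distrib_left[symmetric] distrib_left)
  finally show ?thesis by simp
qed

text \<open>
Jensen's inequality in each row, whose weights $n p_{ij}$ sum to 1.
\<close>

lemma barycenter_error:
  fixes Y :: "nat \<Rightarrow> 'a::euclidean_space"
  assumes p: "coupling_matrix n m p" and n: "n \<ge> 1"
  shows "(\<Sum>i<n. (norm ((\<Sum>j<m. (n * p i j) *\<^sub>R Y j) - U i))\<^sup>2) \<le> n * transport_cost n m U Y p"
proof -
  have "(norm ((\<Sum>j<m. (n * p i j) *\<^sub>R Y j) - U i))\<^sup>2 \<le> (\<Sum>j<m. n * p i j * (norm (U i - Y j))\<^sup>2)" if i: "i < n" for i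
  proof -
    have c: "(\<Sum>j<m. n * p i j) = 1" using p i n by (simp add: coupling_matrix_def sum_distrib_left[symmetric])
    have "(\<Sum>j<m. (n * p i j) *\<^sub>R Y j) - U i = (\<Sum>j<m. (n * p i j) *\<^sub>R (Y j - U i))"
      using c by (simp add: scaleR_right_diff_distrib sum_subtractf scaleR_sum_left[symmetric])
    then have "(norm ((\<Sum>j<m. (n * p i j) *\<^sub>R Y j) - U i))\<^sup>2 \<le> (\<Sum>j<m. n * p i j * (norm (Y j - U i))\<^sup>2)"
      using norm_convex_combination_sq[of "{..<m}" "\<lambda>j. n * p i j" "\<lambda>j. Y j - U i"] c p i
      by (simp add: coupling_matrix_def)
    then show ?thesis by (simp add: norm_minus_commute)
  qed
  then have "(\<Sum>i<n. (norm ((\<Sum>j<m. (n * p i j) *\<^sub>R Y j) - U i))\<^sup>2) \<le> (\<Sum>i<n. \<Sum>j<m. n * p i j * (norm (U i - Y j))\<^sup>2)"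
    by (intro sum_mono) simp
  then show ?thesis by (simp add: transport_cost_def sum_distrib_left mult_ac)
qed

lemma barycenter_fourth_moment:
  fixes Y :: "nat \<Rightarrow> 'a::euclidean_space"
  assumes p: "coupling_matrix n m p" and n: "n \<ge> 1"
  shows "(\<Sum>i<n. norm (\<Sum>j<m. (n * p i j) *\<^sub>R Y j) ^ 4) \<le> n * (\<Sum>j<m. norm (Y j) ^ 4 / m)"
proof -
  have "norm (\<Sum>j<m. (n * p i j) *\<^sub>R Y j) ^ 4 \<le> (\<Sum>j<m. n * p i j * norm (Y j) ^ 4)" if i: "i < n" for i
    using p i n by (intro norm_convex_combination_4) (auto simp: coupling_matrix_def sum_distrib_left[symmetric])
  then have "(\<Sum>i<n. norm (\<Sum>j<m. (n * p i j) *\<^sub>R Y j) ^ 4) \<le> (\<Sum>i<n. \<Sum>j<m. n * p i j * norm (Y j) ^ 4)"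
    by (intro sum_mono) simp
  also have "\<dots> = (\<Sum>j<m. \<Sum>i<n. n * p i j * norm (Y j) ^ 4)" by (rule sum.swap)
  also have "\<dots> = (\<Sum>j<m. n * (\<Sum>i<n. p i j) * norm (Y j) ^ 4)"
    by (simp add: sum_distrib_left sum_distrib_right)
  also have "\<dots> = n * (\<Sum>j<m. norm (Y j) ^ 4 / m)"
    using p by (simp add: coupling_matrix_def sum_distrib_left)
  finally show ?thesis .
qed

lemma sets_PiM_borel_prob:
  fixes P :: "'a::euclidean_space measure"
  assumes "borel_prob P" shows "sets (\<Pi>\<^sub>M i\<in>{..<n::nat}. P) = sets (sample_space n)"
  using assms by (intro sets_PiM_cong) (auto simp: borel_prob_def)

text \<open>
A random vector whose law is a product measure has independent coordinates.
\<close>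

lemma iid_sampleI:
  fixes P :: "'a::euclidean_space measure"
  assumes \<Omega>: "prob_space \<Omega>" and P: "borel_prob P" and F: "F \<in> measurable \<Omega> (sample_space n)"
    and law: "distr \<Omega> (sample_space n) F = (\<Pi>\<^sub>M i\<in>{..<n}. P)" and n: "n \<ge> 1"
  shows "iid_sample \<Omega> n (\<lambda>i \<omega>. F \<omega> i) P"
proof -
  interpret prob_space \<Omega> by (rule \<Omega>)
  have sP: "sets P = sets borel" using P by (simp add: borel_prob_def)
  have pP: "prob_space P" using P by (simp add: borel_prob_def)
  have comp: "(\<lambda>\<omega>. F \<omega> i) \<in> borel_measurable \<Omega>" if "i < n" for i
    using measurable_compose[OF F measurable_component_singleton[of i "{..<n}" "\<lambda>_. borel"]] that by simp
  have marg: "distr \<Omega> borel (\<lambda>\<omega>. F \<omega> i) = P" if i: "i < n" for i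
  proof -
    have "distr \<Omega> borel (\<lambda>\<omega>. F \<omega> i) = distr (distr \<Omega> (sample_space n) F) borel (\<lambda>X. X i)"
      using i by (subst distr_distr[OF _ F]) (auto simp: comp_def)
    also have "\<dots> = distr (\<Pi>\<^sub>M i\<in>{..<n}. P) P (\<lambda>X. X i)"
      unfolding law by (rule distr_cong) (auto simp: sP)
    also have "\<dots> = P" using i pP by (intro distr_PiM_component) auto
    finally show ?thesis .
  qed
  have "0 \<in> {..<n}" using n by simp
  then have ne: "{..<n} \<noteq> {}" by blast
  have "distr \<Omega> (\<Pi>\<^sub>M i\<in>{..<n}. borel) (\<lambda>\<omega>. \<lambda>i\<in>{..<n}. F \<omega> i) = distr \<Omega> (sample_space n) F"
  proof (rule distr_cong)
    fix \<omega> assume "\<omega> \<in> space \<Omega>"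
    then have "F \<omega> \<in> space (sample_space n)" using measurable_space[OF F] by blast
    then show "(\<lambda>i\<in>{..<n}. F \<omega> i) = F \<omega>" by (auto simp: space_PiM PiE_def extensional_def restrict_def)
  qed auto
  also have "\<dots> = (\<Pi>\<^sub>M i\<in>{..<n}. distr \<Omega> borel (\<lambda>\<omega>. F \<omega> i))"
    unfolding law using marg by (intro PiM_cong) auto
  finally have "indep_vars (\<lambda>_. borel) (\<lambda>i \<omega>. F \<omega> i) {..<n}"
    using comp indep_vars_iff_distr_eq_PiM'[OF ne, where M' = "\<lambda>_. borel" and X = "\<lambda>i \<omega>. F \<omega> i"] by auto
  then show ?thesis using \<Omega> marg by (simp add: iid_sample_def)
qed

lemma iid_sample_compose:
  assumes U: "iid_sample \<Omega> n U P" and T: "T \<in> borel_measurable borel"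
  shows "iid_sample \<Omega> n (\<lambda>i \<omega>. T (U i \<omega>)) (distr P borel T)"
proof -
  interpret prob_space \<Omega> by (rule iid_sampleD[OF U])
  have "indep_vars (\<lambda>_. borel) (\<lambda>i \<omega>. T (U i \<omega>)) {..<n}"
    by (rule indep_vars_compose2[OF iid_sampleD(4)[OF U]]) (rule T)
  moreover have "distr \<Omega> borel (\<lambda>\<omega>. T (U i \<omega>)) = distr P borel T" if "i < n" for i
    unfolding iid_sampleD(3)[OF U that, symmetric]
    by (subst distr_distr[OF T iid_sampleD(2)[OF U that]]) (simp add: comp_def)
  ultimately show ?thesis using prob_space_axioms by (simp add: iid_sample_def)
qed

text \<open>
The sample $X$ is compared with an independent copy $X'$ on the product space.  In a coupling the
$j$-th column carries mass $1/n$, all of which travels at least the distance from $X'_j$ to its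
nearest neighbour; averaging over the copy gives the integral with respect to $P$.
\<close>

lemma expected_nearest_neighbour_distance:
  fixes P :: "'a::euclidean_space measure"
  assumes P: "borel_prob P" and k: "tie_breaking n k" and n: "n \<ge> 1"
    and matching: "\<And>(\<Omega> :: ((nat \<Rightarrow> 'a) \<times> (nat \<Rightarrow> 'a)) measure) U V.
      iid_sample \<Omega> n U P \<Longrightarrow> iid_sample \<Omega> n V P \<Longrightarrow>
      \<exists>D. D \<in> borel_measurable \<Omega> \<and>
        (\<forall>\<omega>. \<exists>g. coupling_matrix n n g \<and> ennreal (transport_cost n n (\<lambda>i. U i \<omega>) (\<lambda>j. V j \<omega>) g) \<le> D \<omega>) \<and>
        (\<integral>\<^sup>+\<omega>. D \<omega> \<partial>\<Omega>) \<le> B"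
  shows "(\<integral>\<^sup>+X. (\<integral>\<^sup>+x. ennreal ((norm (x - X (k X x)))\<^sup>2) \<partial>P) \<partial>(\<Pi>\<^sub>M i\<in>{..<n}. P)) \<le> B"
    and "(\<lambda>(X, x). (norm (x - X (k X x)))\<^sup>2) \<in> borel_measurable (sample_space n \<Otimes>\<^sub>M borel)"
proof -
  interpret P: prob_space P using P by (simp add: borel_prob_def)
  let ?M = "\<Pi>\<^sub>M i\<in>{..<n}. P"
  interpret M: prob_space ?M by (intro prob_space_PiM P.prob_space_axioms)
  interpret MM: pair_prob_space ?M ?M ..
  have sM: "sets ?M = sets (sample_space n)" by (rule sets_PiM_borel_prob[OF P])
  then have spM: "space ?M = space (sample_space n)" by (rule sets_eq_imp_space_eq)
  have sP: "sets P = sets borel" using P by (simp add: borel_prob_def)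
  define g where "g X x = (norm (x - X (k X x)))\<^sup>2" for X x
  have km: "(\<lambda>(X, x). k X x) \<in> measurable (sample_space n \<Otimes>\<^sub>M borel) (count_space UNIV)"
    using k by (simp add: tie_breaking_def)
  have kn: "k X x < n" if "X \<in> space (sample_space n)" for X x
    using k that by (auto simp: tie_breaking_def)
  have gm: "(\<lambda>z. g (fst z) (snd z)) \<in> borel_measurable (sample_space n \<Otimes>\<^sub>M borel)"
  proof -
    have kz: "(\<lambda>z. k (fst z) (snd z)) \<in> measurable (sample_space n \<Otimes>\<^sub>M borel) (count_space UNIV)"
      using km by (simp add: case_prod_beta)
    have cell: "{z \<in> space (sample_space n \<Otimes>\<^sub>M borel). k (fst z) (snd z) = i} \<in> sets (sample_space n \<Otimes>\<^sub>M borel)" for i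
      using measurable_sets[OF kz, of "{i}"] by (simp add: vimage_def Int_def conj_commute)
    have "(\<lambda>z. \<Sum>i<n. (norm (snd z - fst z i))\<^sup>2 * indicator {z \<in> space (sample_space n \<Otimes>\<^sub>M borel). k (fst z) (snd z) = i} z)
        \<in> borel_measurable (sample_space n \<Otimes>\<^sub>M (borel :: 'a measure))"
    proof (intro borel_measurable_sum borel_measurable_times borel_measurable_indicator cell)
      fix i assume i: "i \<in> {..<n}"
      have comp: "(\<lambda>z::(nat \<Rightarrow> 'a) \<times> 'a. fst z i) \<in> borel_measurable (sample_space n \<Otimes>\<^sub>M borel)"
        using measurable_compose[OF measurable_fst measurable_component_singleton[of i "{..<n}"]] i by auto
      have "(\<lambda>z. norm (snd z - fst z i)) \<in> borel_measurable (sample_space n \<Otimes>\<^sub>M (borel :: 'a measure))"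
        by (rule measurable_compose[OF borel_measurable_diff[OF measurable_snd comp]]) simp
      then show "(\<lambda>z. (norm (snd z - fst z i))\<^sup>2) \<in> borel_measurable (sample_space n \<Otimes>\<^sub>M (borel :: 'a measure))"
        by (rule borel_measurable_power)
    qed
    then show ?thesis
    proof (rule measurable_cong[THEN iffD1, rotated])
      fix z :: "(nat \<Rightarrow> 'a) \<times> 'a" assume z: "z \<in> space (sample_space n \<Otimes>\<^sub>M borel)"
      then have "k (fst z) (snd z) < n" by (auto simp: space_pair_measure kn)
      then show "(\<Sum>i<n. (norm (snd z - fst z i))\<^sup>2 * indicator {z \<in> space (sample_space n \<Otimes>\<^sub>M borel). k (fst z) (snd z) = i} z)
          = g (fst z) (snd z)"
        using z by (subst sum.remove[of _ "k (fst z) (snd z)"]) (auto simp: g_def intro!: sum.neutral)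
    qed
  qed
  then show "(\<lambda>(X, x). (norm (x - X (k X x)))\<^sup>2) \<in> borel_measurable (sample_space n \<Otimes>\<^sub>M borel)"
    by (simp add: g_def case_prod_beta)
  let ?J = "?M \<Otimes>\<^sub>M ?M"
  have sJ: "sets ?J = sets (sample_space n \<Otimes>\<^sub>M sample_space n)"
    by (intro sets_pair_measure_cong sM)
  have fstm: "fst \<in> measurable ?J (sample_space n)" and sndm: "snd \<in> measurable ?J (sample_space n)"
    using measurable_fst[of ?M ?M] measurable_snd[of ?M ?M] by (simp_all cong: measurable_cong_sets[OF refl sM])
  have dfst: "distr ?J (sample_space n) fst = ?M"
  proof -
    have "distr ?J (sample_space n) fst = distr ?J ?M fst" by (rule distr_cong) (auto simp: sM)
    also have "\<dots> = ?M" by (rule M.distr_pair_fst)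
    finally show ?thesis .
  qed
  have dsnd: "distr ?J (sample_space n) snd = ?M"
  proof (rule measure_eqI)
    show "sets (distr ?J (sample_space n) snd) = sets ?M" by (simp add: sM)
    fix A assume "A \<in> sets (distr ?J (sample_space n) snd)"
    then have A: "A \<in> sets ?M" by (simp add: sM)
    then have "emeasure (distr ?J (sample_space n) snd) A = emeasure ?J (snd -` A \<inter> space ?J)"
      by (intro emeasure_distr sndm) (simp add: sM)
    also have "snd -` A \<inter> space ?J = space ?M \<times> A"
      using sets.sets_into_space[OF A] by (auto simp: space_pair_measure)
    also have "emeasure ?J (space ?M \<times> A) = emeasure ?M A"
      using A by (simp add: M.emeasure_pair_measure_Times M.emeasure_space_1)
    finally show "emeasure (distr ?J (sample_space n) snd) A = emeasure ?M A" .
  qed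
  have U: "iid_sample ?J n (\<lambda>i \<omega>. fst \<omega> i) P"
    by (rule iid_sampleI[OF MM.prob_space_axioms P fstm dfst n])
  have V: "iid_sample ?J n (\<lambda>i \<omega>. snd \<omega> i) P"
    by (rule iid_sampleI[OF MM.prob_space_axioms P sndm dsnd n])
  obtain D where D: "D \<in> borel_measurable ?J"
      "\<And>\<omega>. \<exists>g. coupling_matrix n n g \<and> ennreal (transport_cost n n (fst \<omega>) (snd \<omega>) g) \<le> D \<omega>"
      "(\<integral>\<^sup>+\<omega>. D \<omega> \<partial>?J) \<le> B"
    using matching[OF U V] by auto
  have pt: "(\<Sum>j<n. ennreal (g (fst \<omega>) (snd \<omega> j) / n)) \<le> D \<omega>" if \<omega>: "\<omega> \<in> space ?J" for \<omega>
  proof -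
    have X: "fst \<omega> \<in> space (sample_space n)" using \<omega> by (auto simp: space_pair_measure spM)
    obtain c where c: "coupling_matrix n n c" "ennreal (transport_cost n n (fst \<omega>) (snd \<omega>) c) \<le> D \<omega>" using D(2) by blast
    have near: "g (fst \<omega>) y \<le> (norm (fst \<omega> i - y))\<^sup>2" if "i < n" for y i
    proof -
      have "y \<in> voronoi n (fst \<omega>) (k (fst \<omega>) y)" using k X by (auto simp: tie_breaking_def)
      then have "norm (y - fst \<omega> (k (fst \<omega>) y)) \<le> norm (fst \<omega> i - y)"
        using that by (cases "i = k (fst \<omega>) y") (auto simp: voronoi_def norm_minus_commute)
      then show ?thesis unfolding g_def by (rule power_mono) simp
    qed
    have "(\<Sum>j<n. g (fst \<omega>) (snd \<omega> j) / n) = (\<Sum>j<n. \<Sum>i<n. c i j * g (fst \<omega>) (snd \<omega> j))"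
      using c(1) by (intro sum.cong refl) (simp add: coupling_matrix_def sum_distrib_right[symmetric])
    also have "\<dots> \<le> (\<Sum>j<n. \<Sum>i<n. c i j * (norm (fst \<omega> i - snd \<omega> j))\<^sup>2)"
      using c(1) near by (intro sum_mono mult_left_mono) (auto simp: coupling_matrix_def)
    also have "\<dots> = transport_cost n n (fst \<omega>) (snd \<omega>) c"
      unfolding transport_cost_def by (rule sum.swap)
    finally have "ennreal (\<Sum>j<n. g (fst \<omega>) (snd \<omega> j) / n) \<le> D \<omega>"
      using c(2) ennreal_leI order_trans by blast
    then show ?thesis by (subst sum_ennreal) (auto simp: g_def)
  qed
  have gX: "g X \<in> borel_measurable borel" if X: "X \<in> space ?M" for X
    using measurable_compose[OF measurable_Pair1' gm, of X] X by (simp add: spM)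
  have meas: "(\<lambda>\<omega>. \<Sum>j<n. ennreal (g (fst \<omega>) (snd \<omega> j) / n)) \<in> borel_measurable ?J"
  proof (intro borel_measurable_sum measurable_compose[OF _ measurable_ennreal] borel_measurable_divide borel_measurable_const)
    fix j assume j: "j \<in> {..<n}"
    have "(\<lambda>\<omega>. (fst \<omega>, snd \<omega> j)) \<in> measurable ?J (sample_space n \<Otimes>\<^sub>M borel)"
      using fstm measurable_compose[OF sndm measurable_component_singleton[OF j]] by (intro measurable_Pair)
    from measurable_compose[OF this gm] show "(\<lambda>\<omega>. g (fst \<omega>) (snd \<omega> j)) \<in> borel_measurable ?J" by simp
  qed
  have idM: "iid_sample ?M n (\<lambda>i X. X i) P"
  proof (rule iid_sampleI[OF M.prob_space_axioms P _ _ n, of "\<lambda>X. X"])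
    show "(\<lambda>X. X) \<in> measurable ?M (sample_space n)"
      using measurable_ident_sets[OF sM] by simp
    show "distr ?M (sample_space n) (\<lambda>X. X) = ?M" by (rule distr_id2) (simp add: sM)
  qed
  have "(\<integral>\<^sup>+X. (\<integral>\<^sup>+x. ennreal (g X x) \<partial>P) \<partial>?M) = (\<integral>\<^sup>+X. (\<integral>\<^sup>+X'. (\<Sum>j<n. ennreal (g X (X' j) / n)) \<partial>?M) \<partial>?M)"
    by (intro nn_integral_cong iid_sample_average[OF idM n, symmetric] gX)
  also have "\<dots> = (\<integral>\<^sup>+\<omega>. (\<Sum>j<n. ennreal (g (fst \<omega>) (snd \<omega> j) / n)) \<partial>?J)"
    using M.nn_integral_fst[OF meas] by simp
  also have "\<dots> \<le> (\<integral>\<^sup>+\<omega>. D \<omega> \<partial>?J)" by (intro nn_integral_mono pt)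
  also note D(3)
  finally show "(\<integral>\<^sup>+X. (\<integral>\<^sup>+x. ennreal ((norm (x - X (k X x)))\<^sup>2) \<partial>P) \<partial>?M) \<le> B" by (simp add: g_def)
qed

section \<open>The risk of the one-nearest-neighbour estimator\<close>

lemma T_1NN_eq:
  assumes "k X x < n"
  shows "T_1NN n m \<pi> k X Y x = (\<Sum>j<m. (n * \<pi> X Y (k X x) j) *\<^sub>R Y j)"
proof -
  have "T_1NN n m \<pi> k X Y x = (\<Sum>i<n. if i = k X x then (\<Sum>j<m. (n * \<pi> X Y i j) *\<^sub>R Y j) else 0)"
    unfolding T_1NN_def by (intro sum.cong) auto
  then show ?thesis using assms by simp
qed

text \<open>
On the cell of $X_i$ the error is split at $T_0(X_i)$.
\<close>

lemma T_1NN_loss: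
  fixes P :: "'a::euclidean_space measure" and \<beta> :: real
  assumes P: "borel_prob P" and k: "tie_breaking n k" and X: "X \<in> space (sample_space n)"
    and T0: "\<And>x y. norm (T0 x - T0 y) \<le> \<beta> * norm (x - y)" and \<beta>: "\<beta> > 0"
    and gm: "(\<lambda>x. (norm (x - X (k X x)))\<^sup>2) \<in> borel_measurable borel"
  shows "(\<integral>\<^sup>+x. ennreal ((norm (T_1NN n m \<pi> k X Y x - T0 x))\<^sup>2) \<partial>P)
    \<le> ennreal (2 * (\<Sum>i<n. measure P {x. k X x = i} * (norm ((\<Sum>j<m. (n * \<pi> X Y i j) *\<^sub>R Y j) - T0 (X i)))\<^sup>2))
      + ennreal (2 * \<beta>\<^sup>2) * (\<integral>\<^sup>+x. ennreal ((norm (x - X (k X x)))\<^sup>2) \<partial>P)"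
proof -
  interpret prob_space P using P by (simp add: borel_prob_def)
  have [measurable_cong]: "sets P = sets borel" using P by (simp add: borel_prob_def)
  have gmP: "(\<lambda>x. (norm (x - X (k X x)))\<^sup>2) \<in> borel_measurable P" using gm by simp
  have cell: "{x. k X x = i} \<in> sets P" for i
    using tie_breaking_cell(1)[OF k X] P by (simp add: borel_prob_def)
  have kn: "k X x < n" for x using k X by (auto simp: tie_breaking_def)
  define f where "f i = (norm ((\<Sum>j<m. (n * \<pi> X Y i j) *\<^sub>R Y j) - T0 (X i)))\<^sup>2" for i
  have f0: "f i \<ge> 0" for i by (simp add: f_def)
  have pt: "ennreal ((norm (T_1NN n m \<pi> k X Y x - T0 x))\<^sup>2)
      \<le> (\<Sum>i<n. ennreal (2 * f i) * indicator {x. k X x = i} x) + ennreal (2 * \<beta>\<^sup>2) * ennreal ((norm (x - X (k X x)))\<^sup>2)" for x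
  proof -
    let ?i = "k X x"
    let ?t = "(\<Sum>j<m. (n * \<pi> X Y ?i j) *\<^sub>R Y j)"
    have "(norm (?t - T0 x))\<^sup>2 \<le> (norm (?t - T0 (X ?i)) + \<beta> * norm (x - X ?i))\<^sup>2"
    proof (rule power_mono)
      have "norm (?t - T0 x) \<le> norm (?t - T0 (X ?i)) + norm (T0 (X ?i) - T0 x)"
        using norm_triangle_ineq[of "?t - T0 (X ?i)" "T0 (X ?i) - T0 x"] by simp
      also have "norm (T0 (X ?i) - T0 x) \<le> \<beta> * norm (x - X ?i)" using T0[of "X ?i" x] by (simp add: norm_minus_commute)
      finally show "norm (?t - T0 x) \<le> norm (?t - T0 (X ?i)) + \<beta> * norm (x - X ?i)" by simp
    qed simp
    also have "\<dots> \<le> 2 * (norm (?t - T0 (X ?i)))\<^sup>2 + 2 * (\<beta> * norm (x - X ?i))\<^sup>2"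
      using zero_le_power2[of "norm (?t - T0 (X ?i)) - \<beta> * norm (x - X ?i)"] unfolding power2_sum power2_diff by linarith
    finally have "(norm (T_1NN n m \<pi> k X Y x - T0 x))\<^sup>2 \<le> 2 * f ?i + 2 * \<beta>\<^sup>2 * (norm (x - X ?i))\<^sup>2"
      unfolding T_1NN_eq[of k X x, OF kn] f_def by (simp add: power_mult_distrib)
    then have "ennreal ((norm (T_1NN n m \<pi> k X Y x - T0 x))\<^sup>2) \<le> ennreal (2 * f ?i + 2 * \<beta>\<^sup>2 * (norm (x - X ?i))\<^sup>2)"
      by (rule ennreal_leI)
    also have "\<dots> = ennreal (2 * f ?i) + ennreal (2 * \<beta>\<^sup>2) * ennreal ((norm (x - X ?i))\<^sup>2)"
      using f0 by (simp add: ennreal_mult[symmetric])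
    also have "ennreal (2 * f ?i) = ennreal (2 * f ?i) * indicator {x. k X x = ?i} x" by simp
    also have "\<dots> \<le> (\<Sum>i<n. ennreal (2 * f i) * indicator {x. k X x = i} x)"
      using kn[of x] by (intro member_le_sum[where i = ?i and f = "\<lambda>i. ennreal (2 * f i) * indicator {x. k X x = i} x"]) auto
    finally show ?thesis by (simp add: add_right_mono)
  qed
  have "(\<integral>\<^sup>+x. ennreal ((norm (T_1NN n m \<pi> k X Y x - T0 x))\<^sup>2) \<partial>P)
      \<le> (\<integral>\<^sup>+x. (\<Sum>i<n. ennreal (2 * f i) * indicator {x. k X x = i} x) + ennreal (2 * \<beta>\<^sup>2) * ennreal ((norm (x - X (k X x)))\<^sup>2) \<partial>P)"
    by (rule nn_integral_mono) (rule pt)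
  also have "\<dots> = (\<integral>\<^sup>+x. (\<Sum>i<n. ennreal (2 * f i) * indicator {x. k X x = i} x) \<partial>P)
      + (\<integral>\<^sup>+x. ennreal (2 * \<beta>\<^sup>2) * ennreal ((norm (x - X (k X x)))\<^sup>2) \<partial>P)"
    by (intro nn_integral_add borel_measurable_sum borel_measurable_times_ennreal borel_measurable_const
        borel_measurable_indicator cell measurable_compose[OF gmP measurable_ennreal])
  also have "(\<integral>\<^sup>+x. ennreal (2 * \<beta>\<^sup>2) * ennreal ((norm (x - X (k X x)))\<^sup>2) \<partial>P)
      = ennreal (2 * \<beta>\<^sup>2) * (\<integral>\<^sup>+x. ennreal ((norm (x - X (k X x)))\<^sup>2) \<partial>P)"
    using gm by (intro nn_integral_cmult) auto
  also have "(\<integral>\<^sup>+x. (\<Sum>i<n. ennreal (2 * f i) * indicator {x. k X x = i} x) \<partial>P)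
      = (\<Sum>i<n. ennreal (2 * f i) * emeasure P {x. k X x = i})"
    using cell by (subst nn_integral_sum) (auto simp: nn_integral_cmult_indicator)
  also have "\<dots> = (\<Sum>i<n. ennreal (2 * (measure P {x. k X x = i} * f i)))"
    using f0 by (intro sum.cong refl) (simp add: emeasure_eq_measure ennreal_mult[symmetric] mult_ac)
  also have "\<dots> = ennreal (2 * (\<Sum>i<n. measure P {x. k X x = i} * f i))"
    using f0 by (subst sum_ennreal) (auto simp: sum_distrib_left)
  finally show ?thesis unfolding f_def .
qed

text \<open>
On the exceptional event the weights are only known to be at most 1, and $2F \le c + F^2/c$ separates the
event from the size of the errors, so that each can be integrated on its own.
\<close>

lemma weighted_error:
  fixes f p :: "nat \<Rightarrow> real"
  assumes f: "\<And>i. i < n \<Longrightarrow> 0 \<le> f i" and p: "\<And>i. i < n \<Longrightarrow> p i \<le> 1"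
    and good: "\<not> B \<Longrightarrow> (\<And>i. i < n \<Longrightarrow> p i \<le> q)" and q: "q \<ge> 0" and c: "c > 0"
  shows "2 * (\<Sum>i<n. p i * f i) \<le> 2 * q * (\<Sum>i<n. f i) + (c * of_bool B + (\<Sum>i<n. f i)\<^sup>2 / c)"
proof (cases B)
  case False
  then have "(\<Sum>i<n. p i * f i) \<le> (\<Sum>i<n. q * f i)"
    using good f by (intro sum_mono mult_right_mono) auto
  moreover have "0 \<le> (\<Sum>i<n. f i)\<^sup>2 / c" using c by simp
  ultimately show ?thesis using False by (simp add: sum_distrib_left[symmetric])
next
  case True
  define F where "F = (\<Sum>i<n. f i)"
  have F: "F \<ge> 0" unfolding F_def using f by (intro sum_nonneg) auto
  have "(\<Sum>i<n. p i * f i) \<le> (\<Sum>i<n. 1 * f i)"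
    using p f by (intro sum_mono mult_right_mono) auto
  also have "\<dots> = F" by (simp add: F_def)
  finally have 1: "2 * (\<Sum>i<n. p i * f i) \<le> 2 * F" by simp
  have "0 \<le> (c - F)\<^sup>2 / c" using c by simp
  also have "\<dots> = c - 2 * F + F\<^sup>2 / c" using c by (simp add: power2_eq_square field_simps)
  finally have "2 * F \<le> c + F\<^sup>2 / c" by simp
  moreover have "0 \<le> 2 * q * F" using q F by simp
  ultimately have "2 * (\<Sum>i<n. p i * f i) \<le> 2 * q * F + (c + F\<^sup>2 / c)" using 1 by linarith
  then show ?thesis using True by (simp add: F_def)
qed

theorem corollary5:
  fixes M r \<alpha> \<beta> :: real
  assumes "DIM('a::euclidean_space) > 4" and "r > 4" and "M \<ge> 0" and "\<alpha> > 0" and "\<beta> > 0"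
  shows "\<exists>C>0. \<forall>(P :: 'a measure) (Q :: 'a measure) (\<phi>0 :: 'a \<Rightarrow> real) (T0 :: 'a \<Rightarrow> 'a).
           borel_prob P \<and> borel_prob Q \<and>
           (\<integral>\<^sup>+ x. ennreal (norm x powr r) \<partial>P) \<le> ennreal (M powr r) \<and>
           (\<integral>\<^sup>+ y. ennreal (norm y powr r) \<partial>Q) \<le> ennreal (M powr r) \<and>
           nonatomic P \<and>
           strictly_convex \<phi>0 \<and> (\<forall>x. GDERIV \<phi>0 x :> T0 x) \<and> continuous_on UNIV T0 \<and>
           solves_semi_dual P Q \<phi>0 \<and>
           (\<forall>x y. \<alpha> / 2 * (norm (y - x))\<^sup>2 \<le> \<phi>0 y - \<phi>0 x - T0 x \<bullet> (y - x) \<and>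
                  \<phi>0 y - \<phi>0 x - T0 x \<bullet> (y - x) \<le> \<beta> / 2 * (norm (y - x))\<^sup>2)
           \<longrightarrow> (\<forall>n\<ge>2. \<forall>m\<ge>1. \<forall>J \<pi> k.
                 iid_samples_law P Q n m J \<and> optimal_coupling_estimator n m \<pi> \<and> tie_breaking n k
                 \<longrightarrow> risk J P (T_1NN n m \<pi> k) T0
                     \<le> ennreal (C * (real n powr (- 2 / real DIM('a)) + real m powr (- 2 / real DIM('a)))
                                  * ln (real n)))"
proof -
  note d = assms(1) and r = assms(2) and \<alpha> = assms(4) and \<beta> = assms(5)
  obtain C1 where C1: "C1 > 0" and matching: "\<And>(Q :: 'a measure) (\<Omega> :: ((nat \<Rightarrow> 'a) \<times> (nat \<Rightarrow> 'a)) measure) n m U V.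
      borel_prob Q \<Longrightarrow> (\<integral>\<^sup>+ x. ennreal (norm x powr r) \<partial>Q) \<le> ennreal (M powr r) \<Longrightarrow> n \<ge> 1 \<Longrightarrow> m \<ge> 1 \<Longrightarrow>
      iid_sample \<Omega> n U Q \<Longrightarrow> iid_sample \<Omega> m V Q \<Longrightarrow>
      \<exists>D. D \<in> borel_measurable \<Omega> \<and>
        (\<forall>\<omega>. \<exists>g. coupling_matrix n m g \<and> ennreal (transport_cost n m (\<lambda>i. U i \<omega>) (\<lambda>j. V j \<omega>) g) \<le> D \<omega>) \<and>
        (\<integral>\<^sup>+\<omega>. D \<omega> \<partial>\<Omega>) \<le> ennreal (C1 * (real n powr (- 2 / real DIM('a)) + real m powr (- 2 / real DIM('a))))"
    using expected_matching_cost[OF d r, where 'w = "(nat \<Rightarrow> 'a) \<times> (nat \<Rightarrow> 'a)" and M = M] by blast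
  obtain W :: "'a set" where W: "finite W" "\<And>v. v \<noteq> 0 \<Longrightarrow> \<exists>w\<in>W. v \<in> narrow_cone w"
    using finite_cone_cover by blast
  define \<gamma> where "\<gamma> = real (card W)"
  define m4 where "m4 = 1 + M powr r"
  define C where "C = 20 * \<gamma> * (\<beta> / \<alpha>) * C1 + 2 * (\<gamma> + 16 * m4 + 4 * \<beta>\<^sup>2 * C1)"
  have \<gamma>: "\<gamma> \<ge> 0" and m4: "m4 > 0" by (auto simp: \<gamma>_def m4_def add_pos_nonneg)
  have C0: "C > 0" unfolding C_def using \<gamma> m4 \<alpha> \<beta> C1 by (intro add_nonneg_pos mult_nonneg_nonneg mult_pos_pos) (auto intro: add_nonneg_pos add_pos_nonneg)
  show ?thesis
  proof (rule exI[of _ C], intro conjI allI impI C0, elim conjE)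
    fix P Q :: "'a measure" and \<phi>0 :: "'a \<Rightarrow> real" and T0 :: "'a \<Rightarrow> 'a" and n m :: nat
      and J :: "((nat \<Rightarrow> 'a) \<times> (nat \<Rightarrow> 'a)) measure"
      and \<pi> :: "(nat \<Rightarrow> 'a) \<Rightarrow> (nat \<Rightarrow> 'a) \<Rightarrow> nat \<Rightarrow> nat \<Rightarrow> real" and k :: "(nat \<Rightarrow> 'a) \<Rightarrow> 'a \<Rightarrow> nat"
    assume P: "borel_prob P" and Q: "borel_prob Q"
      and momP: "(\<integral>\<^sup>+ x. ennreal (norm x powr r) \<partial>P) \<le> ennreal (M powr r)"
      and momQ: "(\<integral>\<^sup>+ y. ennreal (norm y powr r) \<partial>Q) \<le> ennreal (M powr r)"
      and na: "nonatomic P" and grad: "\<forall>x. GDERIV \<phi>0 x :> T0 x" and T0c: "continuous_on UNIV T0"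
      and sd: "solves_semi_dual P Q \<phi>0"
      and bounds: "\<forall>x y. \<alpha> / 2 * (norm (y - x))\<^sup>2 \<le> \<phi>0 y - \<phi>0 x - T0 x \<bullet> (y - x) \<and>
                  \<phi>0 y - \<phi>0 x - T0 x \<bullet> (y - x) \<le> \<beta> / 2 * (norm (y - x))\<^sup>2"
      and n2: "2 \<le> n" and m: "1 \<le> m" and law: "iid_samples_law P Q n m J"
      and opt: "optimal_coupling_estimator n m \<pi>" and k: "tie_breaking n k"
    have n: "1 \<le> n" using n2 by simp
    have \<phi>c: "continuous_on UNIV \<phi>0"
      using grad unfolding gderiv_def by (intro continuous_at_imp_continuous_on) (auto intro: has_derivative_continuous)
    interpret smooth_strongly_convex \<phi>0 T0 \<alpha> \<beta>
      using \<alpha> \<beta> T0c \<phi>c bounds by unfold_locales auto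
    interpret P: prob_space P using P by (simp add: borel_prob_def)
    have T0m: "T0 \<in> borel_measurable borel" using T0c by (rule borel_measurable_continuous_onI)
    have "(\<integral>\<^sup>+ y. ennreal (norm y ^ 2) \<partial>Q) \<le> ennreal (1 + M powr r)"
      by (rule power_moment[OF Q momQ]) (use r in auto)
    also have "\<dots> < \<infinity>" by simp
    finally have push: "distr P borel T0 = Q" by (rule pushforward[OF P Q _ sd])

    let ?M = "\<Pi>\<^sub>M i\<in>{..<n}. P"
    have sM: "sets ?M = sets (sample_space n)" by (rule sets_PiM_borel_prob[OF P])
    have sJ: "sets J = sets (sample_space n \<Otimes>\<^sub>M sample_space m)"
      and dX: "distr J (sample_space n) fst = ?M" and dY: "distr J (sample_space m) snd = (\<Pi>\<^sub>M j\<in>{..<m}. Q)"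
      using law by (auto simp: iid_samples_law_def)
    have fstJ: "fst \<in> measurable J (sample_space n)" and sndJ: "snd \<in> measurable J (sample_space m)"
      by (simp_all add: measurable_cong_sets[OF sJ refl])
    have spJ: "fst \<omega> \<in> space (sample_space n)" "snd \<omega> \<in> space (sample_space m)" if "\<omega> \<in> space J" for \<omega>
      using measurable_space[OF fstJ that] measurable_space[OF sndJ that] by auto
    have J: "prob_space J"
    proof
      interpret M: prob_space ?M by (intro prob_space_PiM P.prob_space_axioms)
      have "emeasure J (space J) = emeasure (distr J (sample_space n) fst) (space (sample_space n))"
        using spJ by (subst emeasure_distr[OF fstJ]) (auto intro!: arg_cong[where f = "emeasure J"])
      also have "\<dots> = 1" unfolding dX using M.emeasure_space_1 sets_eq_imp_space_eq[OF sM] by simp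
      finally show "emeasure J (space J) = 1" .
    qed
    have XJ: "iid_sample J n (\<lambda>i \<omega>. fst \<omega> i) P" by (rule iid_sampleI[OF J P fstJ dX n])
    have TJ: "iid_sample J n (\<lambda>i \<omega>. T0 (fst \<omega> i)) Q" using iid_sample_compose[OF XJ T0m] push by simp
    have YJ: "iid_sample J m (\<lambda>j \<omega>. snd \<omega> j) Q" by (rule iid_sampleI[OF J Q sndJ dY m])

    \<comment> \<open>The two samples of the law \<open>Q\<close> that are matched are \<open>T0 (X i)\<close> and \<open>Y j\<close>.\<close>
    let ?\<epsilon> = "real n powr (- 2 / real DIM('a)) + real m powr (- 2 / real DIM('a))"
    obtain D where Dm: "D \<in> borel_measurable J"
      and Dg: "\<And>\<omega>. \<exists>g. coupling_matrix n m g \<and> ennreal (transport_cost n m (\<lambda>i. T0 (fst \<omega> i)) (snd \<omega>) g) \<le> D \<omega>"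
      and ED: "(\<integral>\<^sup>+\<omega>. D \<omega> \<partial>J) \<le> ennreal (C1 * ?\<epsilon>)"
      using matching[OF Q momQ n m TJ YJ] by auto

    \<comment> \<open>Chosen so that $e^{-s(n-1)} = n^{-5}$, while $s \le 10 \ln n / n$ for $n \ge 2$.\<close>
    define s :: real where "s = 5 * ln n / (real n - 1)"
    have lnn: "ln (real n) > 0" using n2 by simp
    have s: "s > 0" using n2 lnn by (simp add: s_def)
    define Bad where "Bad = {X \<in> space ?M. \<exists>i<n. real (card W) * s < measure P {x. k X x = i}}"
    have Bad: "Bad \<in> sets ?M"
      unfolding Bad_def by (rule max_voronoi_mass(1)[OF P na W k s])
    have EBad: "emeasure ?M Bad \<le> ennreal (real n * real (card W) * exp (- s) ^ (n - 1))"
      unfolding Bad_def by (rule max_voronoi_mass(2)[OF P na W k s])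
    \<comment> \<open>The squared nearest-neighbour distance, integrated over the query point.\<close>
    define h where "h X = (\<integral>\<^sup>+x. ennreal ((norm (x - X (k X x)))\<^sup>2) \<partial>P)" for X
    have gm: "(\<lambda>(X, x). (norm (x - X (k X x)))\<^sup>2) \<in> borel_measurable (sample_space n \<Otimes>\<^sub>M borel)"
      and Eh: "(\<integral>\<^sup>+X. h X \<partial>?M) \<le> ennreal (C1 * (real n powr (- 2 / real DIM('a)) + real n powr (- 2 / real DIM('a))))"
      unfolding h_def using expected_nearest_neighbour_distance[OF P k n matching[OF P momP n n]] by blast+
    have hm: "h \<in> borel_measurable (sample_space n)"
    proof -
      have "(\<lambda>z. ennreal ((norm (snd z - fst z (k (fst z) (snd z))))\<^sup>2)) \<in> borel_measurable (sample_space n \<Otimes>\<^sub>M P)"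
        using measurable_compose[OF gm measurable_ennreal] P
        by (simp add: case_prod_beta borel_prob_def cong: measurable_cong_sets sets_pair_measure_cong)
      from P.borel_measurable_nn_integral_fst[OF this] show ?thesis by (simp add: h_def[abs_def])
    qed
    \<comment> \<open>Average fourth powers: they control the errors on the exceptional event \<open>Bad\<close>.\<close>
    define aY where "aY \<omega> = (\<Sum>j<m. norm (snd \<omega> j :: 'a) ^ 4 / m)" for \<omega> :: "(nat \<Rightarrow> 'a) \<times> (nat \<Rightarrow> 'a)"
    define aX where "aX \<omega> = (\<Sum>i<n. norm (T0 (fst \<omega> i)) ^ 4 / n)" for \<omega> :: "(nat \<Rightarrow> 'a) \<times> (nat \<Rightarrow> 'a)"

    have loss: "(\<integral>\<^sup>+x. ennreal ((norm (T_1NN n m \<pi> k (fst \<omega>) (snd \<omega>) x - T0 x))\<^sup>2) \<partial>P)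
       \<le> ennreal (20 * \<gamma> * ln n * (\<beta> / \<alpha>)) * D \<omega> + (ennreal (real n ^ 3) * indicator Bad (fst \<omega>)
           + ennreal (8 / n) * (ennreal (aY \<omega>) + ennreal (aX \<omega>))) + ennreal (2 * \<beta>\<^sup>2) * h (fst \<omega>)"
      if \<omega>: "\<omega> \<in> space J" for \<omega>
    proof -
      define X where "X = fst \<omega>" define Y where "Y = snd \<omega>"
      have X: "X \<in> space (sample_space n)" and Y: "Y \<in> space (sample_space m)" using spJ[OF \<omega>] by (auto simp: X_def Y_def)
      have o: "optimal_coupling n m X Y (\<pi> X Y)" using opt X Y by (auto simp: optimal_coupling_estimator_def)
      then have p: "coupling_matrix n m (\<pi> X Y)" by (simp add: optimal_coupling_def)
      define f where "f i = (norm ((\<Sum>j<m. (n * \<pi> X Y i j) *\<^sub>R Y j) - T0 (X i)))\<^sup>2" for i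
      define T where "T = transport_cost n m (\<lambda>i. T0 (X i)) Y (\<pi> X Y)"
      have F: "(\<Sum>i<n. f i) \<le> n * T" unfolding f_def T_def by (rule barycenter_error[OF p n])
      have "(\<Sum>i<n. f i) \<ge> 0" unfolding f_def by (intro sum_nonneg) simp
      then have "0 \<le> real n * T" using F by linarith
      then have T0': "T \<ge> 0" using n2 by (simp add: zero_le_mult_iff)
      have F2: "(\<Sum>i<n. f i)\<^sup>2 \<le> 8 * real n ^ 2 * (aY \<omega> + aX \<omega>)"
      proof -
        have "(\<Sum>i<n. f i)\<^sup>2 \<le> 8 * real n * ((\<Sum>i<n. norm (\<Sum>j<m. (n * \<pi> X Y i j) *\<^sub>R Y j) ^ 4) + (\<Sum>i<n. norm (T0 (X i)) ^ 4))"
          unfolding f_def by (rule sum_norm_diff_sq_sq_le)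
        also have "\<dots> \<le> 8 * real n * (n * (\<Sum>j<m. norm (Y j) ^ 4 / m) + n * aX \<omega>)"
        proof (intro mult_left_mono add_mono barycenter_fourth_moment[OF p n])
          show "(\<Sum>i<n. norm (T0 (X i)) ^ 4) \<le> n * aX \<omega>"
            using n by (simp add: aX_def X_def sum_distrib_left)
        qed simp
        also have "\<dots> = 8 * real n ^ 2 * (aY \<omega> + aX \<omega>)"
          by (simp add: aY_def Y_def power2_eq_square distrib_left)
        finally show ?thesis .
      qed
      define q where "q = \<gamma> * s"
      have q: "q \<ge> 0" using \<gamma> s by (simp add: q_def)
      have qn: "q * n \<le> 10 * \<gamma> * ln n"
      proof -
        have "real n / (real n - 1) \<le> 2" using n2 by (simp add: divide_le_eq)
        then have "5 * \<gamma> * ln n * (real n / (real n - 1)) \<le> 5 * \<gamma> * ln n * 2"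
          using \<gamma> lnn by (intro mult_left_mono) auto
        then show ?thesis by (simp add: q_def s_def mult_ac)
      qed
      \<comment> \<open>The cut-off $n^3$ balances $n^3 \cdot n^{-4}$ against $n^2 / n^3$; both are $O(1/n)$.\<close>
      have "2 * (\<Sum>i<n. measure P {x. k X x = i} * f i)
          \<le> 2 * q * (\<Sum>i<n. f i) + (real n ^ 3 * of_bool (X \<in> Bad) + (\<Sum>i<n. f i)\<^sup>2 / real n ^ 3)"
      proof (rule weighted_error)
        fix i assume nB: "X \<notin> Bad" and i: "i < n"
        have "X \<in> space ?M" using X sets_eq_imp_space_eq[OF sM] by simp
        then have "\<not> real (card W) * s < measure P {x. k X x = i}" using nB i unfolding Bad_def by blast
        then show "measure P {x. k X x = i} \<le> q" by (simp add: q_def \<gamma>_def)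
      qed (use q n in \<open>auto simp: f_def\<close>)
      also have "\<dots> \<le> 20 * \<gamma> * ln n * T + (real n ^ 3 * of_bool (X \<in> Bad) + 8 / n * (aY \<omega> + aX \<omega>))"
      proof (intro add_mono order_refl)
        have "2 * q * (\<Sum>i<n. f i) \<le> 2 * q * (n * T)" using q F by (intro mult_left_mono) auto
        also have "\<dots> = 2 * (q * n) * T" by simp
        also have "\<dots> \<le> 2 * (10 * \<gamma> * ln n) * T" using qn T0' by (intro mult_right_mono mult_left_mono) auto
        finally show "2 * q * (\<Sum>i<n. f i) \<le> 20 * \<gamma> * ln n * T" by simp
        have "(\<Sum>i<n. f i)\<^sup>2 / real n ^ 3 \<le> 8 * real n ^ 2 * (aY \<omega> + aX \<omega>) / real n ^ 3"
          using F2 by (rule divide_right_mono) simp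
        also have "\<dots> = 8 / n * (aY \<omega> + aX \<omega>)"
          using n by (simp add: power2_eq_square power3_eq_cube)
        finally show "(\<Sum>i<n. f i)\<^sup>2 / real n ^ 3 \<le> 8 / n * (aY \<omega> + aX \<omega>)" .
      qed
      finally have "ennreal (2 * (\<Sum>i<n. measure P {x. k X x = i} * f i))
          \<le> ennreal (20 * \<gamma> * ln n * T + (real n ^ 3 * of_bool (X \<in> Bad) + 8 / n * (aY \<omega> + aX \<omega>)))"
        by (rule ennreal_leI)
      also have "\<dots> = ennreal (20 * \<gamma> * ln n) * ennreal T + (ennreal (real n ^ 3) * indicator Bad X + ennreal (8 / n) * (ennreal (aY \<omega>) + ennreal (aX \<omega>)))"
      proof -
        have nn: "aY \<omega> \<ge> 0" "aX \<omega> \<ge> 0" by (auto simp: aY_def aX_def intro!: sum_nonneg)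
        have "ennreal (real n ^ 3 * of_bool (X \<in> Bad)) = ennreal (real n ^ 3) * indicator Bad X" by auto
        moreover have "ennreal (8 / n * (aY \<omega> + aX \<omega>)) = ennreal (8 / n) * (ennreal (aY \<omega>) + ennreal (aX \<omega>))"
          using nn by (subst ennreal_mult) auto
        moreover have "ennreal (20 * \<gamma> * ln n * T) = ennreal (20 * \<gamma> * ln n) * ennreal T"
          using \<gamma> lnn T0' by (intro ennreal_mult) auto
        ultimately show ?thesis using nn \<gamma> lnn T0' by (subst ennreal_plus, force, force) (subst ennreal_plus, auto)
      qed
      also have "ennreal T \<le> ennreal (\<beta> / \<alpha>) * D \<omega>"
      proof -
        obtain g where g: "coupling_matrix n m g" "ennreal (transport_cost n m (\<lambda>i. T0 (X i)) Y g) \<le> D \<omega>"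
          using Dg[of \<omega>] unfolding X_def Y_def by blast
        have "T \<le> \<beta> / \<alpha> * transport_cost n m (\<lambda>i. T0 (X i)) Y g"
          unfolding T_def by (rule coupling_stability[OF o g(1)])
        then have "ennreal T \<le> ennreal (\<beta> / \<alpha> * transport_cost n m (\<lambda>i. T0 (X i)) Y g)" by (rule ennreal_leI)
        also have "\<dots> = ennreal (\<beta> / \<alpha>) * ennreal (transport_cost n m (\<lambda>i. T0 (X i)) Y g)"
          using \<alpha> \<beta> by (intro ennreal_mult') simp
        also have "\<dots> \<le> ennreal (\<beta> / \<alpha>) * D \<omega>" using g(2) by (rule mult_left_mono) simp
        finally show ?thesis .
      qed
      finally have main: "ennreal (2 * (\<Sum>i<n. measure P {x. k X x = i} * f i))
          \<le> ennreal (20 * \<gamma> * ln n) * (ennreal (\<beta> / \<alpha>) * D \<omega>) + (ennreal (real n ^ 3) * indicator Bad X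
             + ennreal (8 / n) * (ennreal (aY \<omega>) + ennreal (aX \<omega>)))"
        by (simp add: add_right_mono mult_left_mono)
      have "ennreal (20 * \<gamma> * ln n) * (ennreal (\<beta> / \<alpha>) * D \<omega>) = ennreal (20 * \<gamma> * ln n * (\<beta> / \<alpha>)) * D \<omega>"
        using \<gamma> lnn \<alpha> \<beta> by (subst ennreal_mult) (auto simp: mult.assoc)
      note main = main[unfolded this]
      have gX: "(\<lambda>x. (norm (x - X (k X x)))\<^sup>2) \<in> borel_measurable borel"
        using measurable_compose[OF measurable_Pair1'[OF X] gm] by simp
      show ?thesis
        using T_1NN_loss[OF P k X T0_lipschitz \<beta> gX, of m \<pi> Y] main
        unfolding X_def[symmetric] Y_def[symmetric] h_def f_def[symmetric]
        by (meson add_right_mono order_trans)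
    qed

    note [measurable] = Dm
    have [measurable]: "aY \<in> borel_measurable J"
      unfolding aY_def using iid_sampleD(2)[OF YJ] by (intro borel_measurable_sum borel_measurable_divide borel_measurable_power borel_measurable_norm) auto
    have [measurable]: "aX \<in> borel_measurable J"
      unfolding aX_def using iid_sampleD(2)[OF TJ] by (intro borel_measurable_sum borel_measurable_divide borel_measurable_power borel_measurable_norm) auto
    have Bad': "Bad \<in> sets (sample_space n)" using Bad sM by simp
    have Bm[measurable]: "(\<lambda>\<omega>. indicator Bad (fst \<omega>) :: ennreal) \<in> borel_measurable J"
      by (rule measurable_compose[OF fstJ]) (use Bad' in simp)
    have hJ[measurable]: "(\<lambda>\<omega>. h (fst \<omega>)) \<in> borel_measurable J"
      by (rule measurable_compose[OF fstJ hm])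
    have EB: "(\<integral>\<^sup>+\<omega>. indicator Bad (fst \<omega>) \<partial>J) \<le> ennreal (\<gamma> / real n ^ 4)"
    proof -
      have "(\<integral>\<^sup>+\<omega>. indicator Bad (fst \<omega>) \<partial>J) = (\<integral>\<^sup>+X. indicator Bad X \<partial>distr J (sample_space n) fst)"
        using Bad' by (subst nn_integral_distr[OF fstJ]) auto
      also have "\<dots> = emeasure ?M Bad" unfolding dX using Bad by simp
      also have "\<dots> \<le> ennreal (real n * real (card W) * exp (- s) ^ (n - 1))" by (rule EBad)
      also have "real n * real (card W) * exp (- s) ^ (n - 1) = \<gamma> / real n ^ 4"
      proof -
        have "exp (- s) ^ (n - 1) = exp (real (n - 1) * (- s))" by (rule exp_of_nat_mult[symmetric])
        also have "real (n - 1) * (- s) = - (real 5 * ln n)" using n2 by (simp add: s_def of_nat_diff)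
        also have "exp (- (real 5 * ln n)) = 1 / real n ^ 5" using n by (subst exp_minus, subst exp_of_nat_mult) (simp add: inverse_eq_divide)
        finally show ?thesis using n by (simp add: \<gamma>_def field_simps eval_nat_numeral)
      qed
      finally show ?thesis .
    qed
    have m4bound: "(\<integral>\<^sup>+ y. ennreal (norm y ^ 4) \<partial>Q) \<le> ennreal m4"
      unfolding m4_def by (rule power_moment[OF Q momQ]) (use r in auto)
    have n4: "(\<lambda>y::'a. norm y ^ 4) \<in> borel_measurable borel" by measurable
    have EaY: "(\<integral>\<^sup>+\<omega>. ennreal (aY \<omega>) \<partial>J) \<le> ennreal m4"
      using iid_sample_average[OF YJ m n4] m4bound unfolding aY_def by (subst sum_ennreal[symmetric]) auto
    have EaX: "(\<integral>\<^sup>+\<omega>. ennreal (aX \<omega>) \<partial>J) \<le> ennreal m4"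
      using iid_sample_average[OF TJ n n4] m4bound unfolding aX_def by (subst sum_ennreal[symmetric]) auto
    have EhJ: "(\<integral>\<^sup>+\<omega>. h (fst \<omega>) \<partial>J) \<le> ennreal (2 * C1 * real n powr (- 2 / real DIM('a)))"
    proof -
      have "(\<integral>\<^sup>+\<omega>. h (fst \<omega>) \<partial>J) = (\<integral>\<^sup>+X. h X \<partial>distr J (sample_space n) fst)"
        by (rule nn_integral_distr[OF fstJ, symmetric]) (use hm in simp)
      also have "\<dots> = (\<integral>\<^sup>+X. h X \<partial>?M)" unfolding dX ..
      also note Eh
      finally show ?thesis by (simp add: mult_ac)
    qed

    have "risk J P (T_1NN n m \<pi> k) T0 = (\<integral>\<^sup>+\<omega>. (\<integral>\<^sup>+x. ennreal ((norm (T_1NN n m \<pi> k (fst \<omega>) (snd \<omega>) x - T0 x))\<^sup>2) \<partial>P) \<partial>J)"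
      unfolding risk_def by (intro nn_integral_cong) (auto split: prod.split)
    also have "\<dots> \<le> (\<integral>\<^sup>+\<omega>. ennreal (20 * \<gamma> * ln n * (\<beta> / \<alpha>)) * D \<omega> + (ennreal (real n ^ 3) * indicator Bad (fst \<omega>)
           + ennreal (8 / n) * (ennreal (aY \<omega>) + ennreal (aX \<omega>))) + ennreal (2 * \<beta>\<^sup>2) * h (fst \<omega>) \<partial>J)"
      by (intro nn_integral_mono loss)
    also have "\<dots> = ennreal (20 * \<gamma> * ln n * (\<beta> / \<alpha>)) * (\<integral>\<^sup>+\<omega>. D \<omega> \<partial>J)
        + (ennreal (real n ^ 3) * (\<integral>\<^sup>+\<omega>. indicator Bad (fst \<omega>) \<partial>J)
           + ennreal (8 / n) * ((\<integral>\<^sup>+\<omega>. ennreal (aY \<omega>) \<partial>J) + (\<integral>\<^sup>+\<omega>. ennreal (aX \<omega>) \<partial>J)))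
        + ennreal (2 * \<beta>\<^sup>2) * (\<integral>\<^sup>+\<omega>. h (fst \<omega>) \<partial>J)"
      by (simp add: nn_integral_add nn_integral_cmult)
    also have "\<dots> \<le> ennreal (20 * \<gamma> * ln n * (\<beta> / \<alpha>)) * ennreal (C1 * ?\<epsilon>)
        + (ennreal (real n ^ 3) * ennreal (\<gamma> / real n ^ 4) + ennreal (8 / n) * (ennreal m4 + ennreal m4))
        + ennreal (2 * \<beta>\<^sup>2) * ennreal (2 * C1 * real n powr (- 2 / real DIM('a)))"
      by (intro add_mono mult_left_mono ED EB EaY EaX EhJ) auto
    also have "\<dots> = ennreal (20 * \<gamma> * ln n * (\<beta> / \<alpha>) * (C1 * ?\<epsilon>) + (real n ^ 3 * (\<gamma> / real n ^ 4) + 8 / n * (m4 + m4))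
        + 2 * \<beta>\<^sup>2 * (2 * C1 * real n powr (- 2 / real DIM('a))))"
    proof -
      have nonneg: "0 \<le> 20 * \<gamma> * ln n * (\<beta> / \<alpha>)" "0 \<le> C1 * ?\<epsilon>" "0 \<le> real n ^ 3" "0 \<le> \<gamma> / real n ^ 4" "0 \<le> 8 / real n"
         "0 \<le> m4 + m4" "0 \<le> m4" "0 \<le> 2 * \<beta>\<^sup>2" "0 \<le> 2 * C1 * real n powr (- 2 / real DIM('a))"
        using \<gamma> lnn \<alpha> \<beta> C1 m4 by auto
      show ?thesis
        by (simp only: ennreal_plus[symmetric] ennreal_mult[symmetric] nonneg mult_nonneg_nonneg add_nonneg_nonneg)
    qed
    also have "\<dots> \<le> ennreal (C * ?\<epsilon> * ln n)"
    proof (rule ennreal_leI)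
      let ?e = "real n powr (- 2 / real DIM('a))"
      have e\<epsilon>: "?e \<le> ?\<epsilon>" by simp
      have "1 / n = real n powr (- 1)" using n by (simp add: powr_minus inverse_eq_divide)
      also have "\<dots> \<le> ?e" using n d by (intro powr_mono) (auto simp: divide_le_eq)
      finally have inv: "1 / n \<le> ?\<epsilon>" using e\<epsilon> by linarith
      \<comment> \<open>The terms without logarithm are absorbed by $\ln n \ge \ln 2$.\<close>
      have "1 / 2 \<le> ln (2::real)" using ln2_ge_two_thirds by simp
      also have "\<dots> \<le> ln n" using n2 by simp
      finally have ln: "1 \<le> 2 * ln n" by simp
      have "real n ^ 3 * (\<gamma> / real n ^ 4) + 8 / n * (m4 + m4) + 2 * \<beta>\<^sup>2 * (2 * C1 * ?e)
          = (\<gamma> + 16 * m4) * (1 / n) + 4 * \<beta>\<^sup>2 * C1 * ?e"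
        using n by (simp add: field_simps eval_nat_numeral)
      also have "\<dots> \<le> (\<gamma> + 16 * m4) * ?\<epsilon> + 4 * \<beta>\<^sup>2 * C1 * ?\<epsilon>"
        using inv e\<epsilon> \<gamma> m4 C1 by (intro add_mono mult_left_mono) auto
      also have "\<dots> = ((\<gamma> + 16 * m4 + 4 * \<beta>\<^sup>2 * C1) * ?\<epsilon>) * 1" by (simp add: algebra_simps)
      also have "\<dots> \<le> ((\<gamma> + 16 * m4 + 4 * \<beta>\<^sup>2 * C1) * ?\<epsilon>) * (2 * ln n)"
        using ln \<gamma> m4 C1 by (intro mult_left_mono) auto
      finally show "20 * \<gamma> * ln n * (\<beta> / \<alpha>) * (C1 * ?\<epsilon>) + (real n ^ 3 * (\<gamma> / real n ^ 4) + 8 / n * (m4 + m4))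
        + 2 * \<beta>\<^sup>2 * (2 * C1 * ?e) \<le> C * ?\<epsilon> * ln n"
        unfolding C_def by (simp add: algebra_simps)
    qed
    finally show "risk J P (T_1NN n m \<pi> k) T0 \<le> ennreal (C * ?\<epsilon> * ln (real n))" .
  qed
qed

end
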